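(* Let $X$ be a smooth proper connected algebraic variety over $\mathbb{C}$ with $\operatorname{Pic}^0(X)=0$ and with $\operatorname{Pic}(X)$ torsion-free, let $\mathbb{T}_X$ be its Néron--Severi torus, and let $\mathcal{U}=L_1^\times\times_X\cdots\times_XL_\rho^\times$ be the universal torsor built from line bundles $L_1,\dots,L_\rho$ whose classes form a basis of $\operatorname{Pic}(X)$. Let $\mathbb{T}_X^c\subset\mathbb{T}_X(\mathbb{C})$ denote the compact subtorus (product of unit circles). Suppose that $\Gamma$ is a subgroup of $\operatorname{Aut}(X)$ preserving a probability measure $\mu$ on $X$. Then it is possible to choose isomorphisms of universal torsors $c_\gamma:\gamma_*\mathcal{U}\to\mathcal{U}$, $\gamma\in\Gamma$, such that, denoting by $\tilde\gamma:\mathcal{U}\to\mathcal{U}$ the composition of the natural map $\mathcal{U}\to\gamma_*\mathcal{U}$ with $c_\gamma$, for all $\gamma_1,\gamma_2\in\Gamma$ with $\gamma_3:=\gamma_1\gamma_2$ we have $$\tilde\gamma_3\cdot\tilde\gamma_2^{-1}\tilde\gamma_1^{-1}\in\mathbb{T}_X^c.$$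
   Context: Since $\operatorname{Pic}^0(X)=0$, $N_{\mathbb{Z}}:=\operatorname{Pic}(X)$ is finitely generated. The Néron--Severi torus $\mathbb{T}_X$ is the algebraic torus with character group $\operatorname{Hom}(\mathbb{T}_X,\mathbb{G}_m)=N_{\mathbb{Z}}$. A universal torsor is a principal $\mathbb{T}_X$-bundle $\mathcal{U}\to X$ such that for every $\chi\in N_{\mathbb{Z}}$, with $L_\chi$ a line bundle of class $\chi$, the $\mathbb{G}_m$-torsor $\mathcal{U}\times_{\mathbb{T}_X,\chi}\mathbb{G}_m$ is isomorphic to $L_\chi^\times$. Here $L^\times$ is the complement of the zero section of $L$. If $L_1,\dots,L_\rho$ give a basis of $N_{\mathbb{Z}}$, then $\mathcal{U}=L_1^\times\times_X\cdots\times_XL_\rho^\times$, a $(\mathbb{C}^\times)^\rho$-torsor, is a universal torsor via the identification $\mathbb{Z}^\rho\cong N_{\mathbb{Z}}$. Any two universal torsors are isomorphic, uniquely up to translation by an element of $\mathbb{T}_X$. For $\gamma\in\operatorname{Aut}(X)$, $\gamma_*\mathcal{U}$ denotes $\mathcal{U}$ pushed forward along $\gamma$ (same total space, with projection to $X$ composed with $\gamma$), with torus action transported via the automorphism $\gamma_*$ of $\mathbb{T}_X$ determined by $\chi(\gamma_*t)=(\gamma^*\chi)(t)$ for all $\chi\in\operatorname{Pic}(X)$; it is again a universal torsor. Concretely, choosing an isomorphism $c_\gamma$ amounts to choosing an algebraic automorphism $\tilde\gamma$ of $\mathcal{U}$ covering $\gamma$ and satisfying $\tilde\gamma(t\cdot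 u)=\gamma_*(t)\cdot\tilde\gamma(u)$ for $t\in\mathbb{T}_X$, $u\in\mathcal{U}$. For $\gamma_3=\gamma_1\gamma_2$, the automorphism $\tilde\gamma_3\tilde\gamma_2^{-1}\tilde\gamma_1^{-1}$ of $\mathcal{U}$ covers the identity of $X$ and acts by an element of $\mathbb{T}_X(\mathbb{C})$, with which it is identified. *)

theory Defs
  imports "HOL-Algebra.Bij" "HOL-Algebra.FiniteProduct" "HOL-Probability.Probability"
begin

section \<open>Spaces with functions\<close>

text \<open>
  Algebraic varieties over the complex numbers are treated as in Serre's FAC: a set of points with
  a Zariski topology and a sheaf of complex-valued functions, locally isomorphic to closed algebraic
  subsets of affine space. Elements of \<open>regular X U\<close> are total HOL functions of which only
  the values on \<open>U\<close> matter.
\<close>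

record 'a fspace =
  zariski :: "'a topology"
  regular :: "'a set \<Rightarrow> ('a \<Rightarrow> complex) set"

abbreviation points :: "'a fspace \<Rightarrow> 'a set" where
  "points X \<equiv> topspace (zariski X)"

definition space_with_functions :: "'a fspace \<Rightarrow> bool" where
  "space_with_functions X \<longleftrightarrow>
     (\<forall>U f. f \<in> regular X U \<longrightarrow> openin (zariski X) U) \<and>
     (\<forall>U c. openin (zariski X) U \<longrightarrow> (\<lambda>_. c) \<in> regular X U) \<and>
     (\<forall>U. \<forall>f\<in>regular X U. \<forall>g\<in>regular X U.
        (\<lambda>x. f x + g x) \<in> regular X U \<and> (\<lambda>x. f x * g x) \<in> regular X U) \<and>
     (\<forall>U V. \<forall>f\<in>regular X U. openin (zariski X) V \<and> V \<subseteq> U \<longrightarrow> f \<in> regular X V) \<and>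
     (\<forall>U f. openin (zariski X) U \<and>
        (\<forall>x\<in>U. \<exists>V. x \<in> V \<and> V \<subseteq> U \<and> (\<exists>g\<in>regular X V. \<forall>y\<in>V. f y = g y)) \<longrightarrow> f \<in> regular X U) \<and>
     (\<forall>U. \<forall>f\<in>regular X U. openin (zariski X) {x\<in>U. f x \<noteq> 0} \<and>
        (\<lambda>x. 1 / f x) \<in> regular X {x\<in>U. f x \<noteq> 0})"

definition morphism :: "'a fspace \<Rightarrow> 'b fspace \<Rightarrow> ('a \<Rightarrow> 'b) \<Rightarrow> bool" where
  "morphism X Y f \<longleftrightarrow> continuous_map (zariski X) (zariski Y) f \<and>
     (\<forall>V. \<forall>g\<in>regular Y V. (\<lambda>x. g (f x)) \<in> regular X {x \<in> points X. f x \<in> V})"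

definition isomorphism :: "'a fspace \<Rightarrow> 'b fspace \<Rightarrow> ('a \<Rightarrow> 'b) \<Rightarrow> bool" where
  "isomorphism X Y f \<longleftrightarrow> bij_betw f (points X) (points Y) \<and> morphism X Y f \<and>
     morphism Y X (inv_into (points X) f)"

text \<open>
  For a set \<open>G\<close> of pairs (domain in \<open>S\<close>, function on that domain), \<open>initial_space S G\<close> is the
  coarsest structure of a space with functions on \<open>S\<close> making the members of \<open>G\<close> regular functions
  on open domains: the open sets are generated by the nonvanishing loci of sums of products of
  members of \<open>G\<close>, and regular functions are locally quotients of such expressions. For
  \<open>S\<close> = affine space and \<open>G\<close> = the coordinates this is the usual definition of the Zariski topology
  and of regular functions; for functions pulled back from the factors it is the usual explicit
  description of the product of varieties; for restrictions of functions to a subset it is the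
  induced structure on that subset.
\<close>

inductive_set generated_algebra ::
    "'a set \<Rightarrow> ('a set \<times> ('a \<Rightarrow> complex)) set \<Rightarrow> ('a set \<times> ('a \<Rightarrow> complex)) set"
  for S :: "'a set" and G :: "('a set \<times> ('a \<Rightarrow> complex)) set" where
  const: "(S, \<lambda>_. c) \<in> generated_algebra S G"
| gen: "(D, f) \<in> G \<Longrightarrow> (D, f) \<in> generated_algebra S G"
| add: "(D, f) \<in> generated_algebra S G \<Longrightarrow> (E, g) \<in> generated_algebra S G \<Longrightarrow>
    (D \<inter> E, \<lambda>x. f x + g x) \<in> generated_algebra S G"
| mult: "(D, f) \<in> generated_algebra S G \<Longrightarrow> (E, g) \<in> generated_algebra S G \<Longrightarrow>
    (D \<inter> E, \<lambda>x. f x * g x) \<in> generated_algebra S G"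

definition initial_topology :: "'a set \<Rightarrow> ('a set \<times> ('a \<Rightarrow> complex)) set \<Rightarrow> 'a topology" where
  "initial_topology S G =
     topology_generated_by {{x\<in>D. f x \<noteq> 0} |D f. (D, f) \<in> generated_algebra S G}"

definition initial_space :: "'a set \<Rightarrow> ('a set \<times> ('a \<Rightarrow> complex)) set \<Rightarrow> 'a fspace" where
  "initial_space S G =
     \<lparr> zariski = initial_topology S G,
       regular = (\<lambda>U. {f. openin (initial_topology S G) U \<and>
         (\<forall>x\<in>U. \<exists>D g E h. (D, g) \<in> generated_algebra S G \<and> (E, h) \<in> generated_algebra S G \<and>
            x \<in> D \<inter> E \<and> h x \<noteq> 0 \<and> (\<forall>y \<in> U \<inter> D \<inter> E. h y \<noteq> 0 \<longrightarrow> f y = g y / h y))}) \<rparr>"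

definition pulled_back :: "'a set \<Rightarrow> ('a \<Rightarrow> 'b) \<Rightarrow> 'b fspace \<Rightarrow> ('a set \<times> ('a \<Rightarrow> complex)) set" where
  "pulled_back S p Y = {({x\<in>S. p x \<in> V}, \<lambda>x. g (p x)) |V g. g \<in> regular Y V}"

definition induced :: "'a fspace \<Rightarrow> 'a set \<Rightarrow> 'a fspace" where
  "induced X Z = initial_space Z (pulled_back Z (\<lambda>x. x) X)"

definition fibre_space :: "'a fspace \<Rightarrow> 'b fspace \<Rightarrow> ('a \<times> 'b) set \<Rightarrow> ('a \<times> 'b) fspace" where
  "fibre_space X Y S = initial_space S (pulled_back S fst X \<union> pulled_back S snd Y)"

definition product_space :: "'a fspace \<Rightarrow> 'b fspace \<Rightarrow> ('a \<times> 'b) fspace" where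
  "product_space X Y = fibre_space X Y (points X \<times> points Y)"

section \<open>Varieties\<close>

text \<open>Points of affine \<open>n\<close>-space are sequences vanishing from index \<open>n\<close> on.\<close>

definition affine_points :: "nat \<Rightarrow> (nat \<Rightarrow> complex) set" where
  "affine_points n = {z. \<forall>i\<ge>n. z i = 0}"

definition coordinates :: "nat \<Rightarrow> ((nat \<Rightarrow> complex) set \<times> ((nat \<Rightarrow> complex) \<Rightarrow> complex)) set" where
  "coordinates n = {(affine_points n, \<lambda>z. z i) |i. i < n}"

definition affine_space :: "nat \<Rightarrow> (nat \<Rightarrow> complex) fspace" where
  "affine_space n = initial_space (affine_points n) (coordinates n)"

definition polynomials :: "nat \<Rightarrow> ((nat \<Rightarrow> complex) \<Rightarrow> complex) set" where
  "polynomials n = {p. (affine_points n, p) \<in> generated_algebra (affine_points n) (coordinates n)}"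

definition affine_line :: "complex fspace" where
  "affine_line = initial_space UNIV {(UNIV, \<lambda>z. z)}"

definition affine_variety :: "'a fspace \<Rightarrow> bool" where
  "affine_variety X \<longleftrightarrow> (\<exists>n Z f. closedin (zariski (affine_space n)) Z \<and>
     isomorphism X (induced (affine_space n) Z) f)"

definition prevariety :: "'a fspace \<Rightarrow> bool" where
  "prevariety X \<longleftrightarrow> space_with_functions X \<and>
     (\<exists>\<U>. finite \<U> \<and> \<Union>\<U> = points X \<and>
        (\<forall>U\<in>\<U>. openin (zariski X) U \<and> affine_variety (induced X U)))"

definition variety :: "'a fspace \<Rightarrow> bool" where
  "variety X \<longleftrightarrow> prevariety X \<and>
     closedin (zariski (product_space X X)) {(x, x) |x. x \<in> points X}"

text \<open>
  Universal closedness. Every complex variety has at most continuum many points, hence is isomorphic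
  to one whose points are of type \<open>nat \<Rightarrow> complex\<close>; so \<open>Y\<close> ranges over all varieties.
\<close>

definition proper :: "'a fspace \<Rightarrow> bool" where
  "proper X \<longleftrightarrow> variety X \<and>
     (\<forall>Y :: (nat \<Rightarrow> complex) fspace. variety Y \<longrightarrow>
        closed_map (zariski (product_space X Y)) (zariski Y) snd)"

text \<open>
  Smoothness by the Jacobian criterion (Mumford, Red Book, III.10): locally \<open>X\<close> is an open part of
  the common zero set of \<open>c\<close> polynomials whose Jacobian matrix has rank \<open>c\<close> at every point of that
  open part.
\<close>

definition jacobian_full_rank ::
    "nat \<Rightarrow> nat \<Rightarrow> (nat \<Rightarrow> (nat \<Rightarrow> complex) \<Rightarrow> complex) \<Rightarrow> (nat \<Rightarrow> complex) \<Rightarrow> bool" where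
  "jacobian_full_rank n c p z \<longleftrightarrow>
     (\<forall>a :: nat \<Rightarrow> complex.
        (\<forall>j<n. (\<Sum>i<c. a i * deriv (\<lambda>t. p i (z(j := t))) (z j)) = 0) \<longrightarrow> (\<forall>i<c. a i = 0))"

definition smooth :: "'a fspace \<Rightarrow> bool" where
  "smooth X \<longleftrightarrow> (\<forall>x \<in> points X. \<exists>U n c p W \<phi>.
     openin (zariski X) U \<and> x \<in> U \<and> (\<forall>i<c. p i \<in> polynomials n) \<and>
     openin (zariski (induced (affine_space n) {z \<in> affine_points n. \<forall>i<c. p i z = 0})) W \<and>
     (\<forall>z\<in>W. jacobian_full_rank n c p z) \<and>
     isomorphism (induced X U) (induced (affine_space n) W) \<phi>)"

definition Aut :: "'a fspace \<Rightarrow> ('a \<Rightarrow> 'a) monoid" where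
  "Aut X = BijGroup (points X) \<lparr> carrier := {f \<in> Bij (points X). isomorphism X X f} \<rparr>"

text \<open>The classical topology on the set of complex points, and its Borel sigma-algebra.\<close>

definition analytic_topology :: "'a fspace \<Rightarrow> 'a topology" where
  "analytic_topology X =
     topology_generated_by {{x\<in>U. f x \<in> W} |U f W. f \<in> regular X U \<and> open W}"

definition analytic_borel :: "'a fspace \<Rightarrow> 'a measure" where
  "analytic_borel X = sigma (points X) {V. openin (analytic_topology X) V}"

section \<open>Line bundles and the Picard group\<close>

text \<open>
  A line bundle is given geometrically by its total space, projection and scalar multiplication in
  the fibres; as fibres are one-dimensional, scalar multiplication determines addition, and
  maps commuting with scalar multiplication are linear. Local triviality makes the total space over a
  variety a variety.
\<close>

record ('a, 'l) line_bundle =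
  bundle_space :: "'l fspace"
  bundle_proj :: "'l \<Rightarrow> 'a"
  scalar :: "complex \<Rightarrow> 'l \<Rightarrow> 'l"

definition line_bundle_on :: "'a fspace \<Rightarrow> ('a, 'l) line_bundle \<Rightarrow> bool" where
  "line_bundle_on X L \<longleftrightarrow>
     space_with_functions (bundle_space L) \<and>
     morphism (bundle_space L) X (bundle_proj L) \<and>
     (\<forall>c. \<forall>l \<in> points (bundle_space L).
        scalar L c l \<in> points (bundle_space L) \<and> bundle_proj L (scalar L c l) = bundle_proj L l) \<and>
     (\<forall>x \<in> points X. \<exists>U \<phi>. openin (zariski X) U \<and> x \<in> U \<and>
        isomorphism (induced (bundle_space L) {l \<in> points (bundle_space L). bundle_proj L l \<in> U})
          (product_space (induced X U) affine_line) \<phi> \<and>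
        (\<forall>l \<in> points (bundle_space L). bundle_proj L l \<in> U \<longrightarrow>
           fst (\<phi> l) = bundle_proj L l \<and>
           (\<forall>c. \<phi> (scalar L c l) = (bundle_proj L l, c * snd (\<phi> l)))))"

definition bundles_isomorphic :: "('a, 'l) line_bundle \<Rightarrow> ('a, 'm) line_bundle \<Rightarrow> bool" where
  "bundles_isomorphic L M \<longleftrightarrow> (\<exists>f. isomorphism (bundle_space L) (bundle_space M) f \<and>
     (\<forall>l \<in> points (bundle_space L). bundle_proj M (f l) = bundle_proj L l \<and>
        (\<forall>c. f (scalar L c l) = scalar M c (f l))))"

text \<open>The complement of the zero section.\<close>

definition nonzero_vectors :: "('a, 'l) line_bundle \<Rightarrow> 'l set" where
  "nonzero_vectors L = {l \<in> points (bundle_space L). l \<noteq> scalar L 0 l}"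

definition trivial_bundle :: "'a fspace \<Rightarrow> ('a, 'a \<times> complex) line_bundle" where
  "trivial_bundle X =
     \<lparr> bundle_space = product_space X affine_line, bundle_proj = fst,
       scalar = (\<lambda>c (x, a). (x, c * a)) \<rparr>"

definition pullback_bundle ::
    "'b fspace \<Rightarrow> ('b \<Rightarrow> 'a) \<Rightarrow> ('a, 'l) line_bundle \<Rightarrow> ('b, 'b \<times> 'l) line_bundle" where
  "pullback_bundle Y \<phi> L =
     \<lparr> bundle_space = fibre_space Y (bundle_space L)
         {(y, l). y \<in> points Y \<and> l \<in> points (bundle_space L) \<and> \<phi> y = bundle_proj L l},
       bundle_proj = fst, scalar = (\<lambda>c (y, l). (y, scalar L c l)) \<rparr>"

text \<open>
  \<open>N\<close> is a tensor product of \<open>L\<close> and \<open>M\<close>: there is a fibrewise bilinear morphism from the fibre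
  product of \<open>L\<close> and \<open>M\<close> to \<open>N\<close> inducing isomorphisms from the tensor products of the
  (one-dimensional) fibres to the fibres of \<open>N\<close>.
\<close>

definition is_tensor_product ::
    "('a, 'l) line_bundle \<Rightarrow> ('a, 'm) line_bundle \<Rightarrow> ('a, 'n) line_bundle \<Rightarrow> bool" where
  "is_tensor_product L M N \<longleftrightarrow>
     (let P = {(l, m). l \<in> points (bundle_space L) \<and> m \<in> points (bundle_space M) \<and>
            bundle_proj L l = bundle_proj M m}
      in \<exists>b. morphism (fibre_space (bundle_space L) (bundle_space M) P) (bundle_space N) b \<and>
        (\<forall>(l, m) \<in> P. bundle_proj N (b (l, m)) = bundle_proj L l \<and>
           (\<forall>c. b (scalar L c l, m) = scalar N c (b (l, m)) \<and>
                b (l, scalar M c m) = scalar N c (b (l, m))) \<and>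
           (l \<in> nonzero_vectors L \<and> m \<in> nonzero_vectors M \<longrightarrow> b (l, m) \<in> nonzero_vectors N)))"

text \<open>
  Choosing a basis vector in each fibre identifies the set underlying any line bundle on \<open>X\<close> with
  \<open>points X \<times> UNIV\<close>. So every line bundle is isomorphic to one with total space of type
  \<open>'a \<times> complex\<close>, and isomorphism classes may be taken among those.
\<close>

definition pic_class :: "'a fspace \<Rightarrow> ('a, 'l) line_bundle \<Rightarrow> ('a, 'a \<times> complex) line_bundle set" where
  "pic_class X L = {M. line_bundle_on X M \<and> bundles_isomorphic L M}"

definition Pic :: "'a fspace \<Rightarrow> ('a, 'a \<times> complex) line_bundle set monoid" where
  "Pic X =
     \<lparr> carrier = {pic_class X L |L :: ('a, 'a \<times> complex) line_bundle. line_bundle_on X L},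
       monoid.mult = (\<lambda>A B. {N. line_bundle_on X N \<and> (\<exists>L\<in>A. \<exists>M\<in>B. is_tensor_product L M N)}),
       one = pic_class X (trivial_bundle X) \<rparr>"

definition pic_pullback ::
    "'a fspace \<Rightarrow> ('a \<Rightarrow> 'a) \<Rightarrow> ('a, 'a \<times> complex) line_bundle set
      \<Rightarrow> ('a, 'a \<times> complex) line_bundle set" where
  "pic_pullback X \<gamma> A = (\<Union>L\<in>A. pic_class X (pullback_bundle X \<gamma> L))"

text \<open>
  \<open>Pic\<^sup>0\<close>: classes of line bundles algebraically equivalent to zero, i.e. occurring together
  with the trivial bundle in an algebraic family of line bundles over a connected base. As for
  \<open>proper\<close>, the base \<open>S\<close> ranges over all connected varieties, and \<open>M\<close> over all line bundles on the
  product.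
\<close>

definition Pic0 :: "'a fspace \<Rightarrow> ('a, 'a \<times> complex) line_bundle set set" where
  "Pic0 X = {\<alpha> \<in> carrier (Pic X).
     \<exists>(S :: (nat \<Rightarrow> complex) fspace)
       (M :: ('a \<times> (nat \<Rightarrow> complex), ('a \<times> (nat \<Rightarrow> complex)) \<times> complex) line_bundle) s t.
       variety S \<and> connected_space (zariski S) \<and> s \<in> points S \<and> t \<in> points S \<and>
       line_bundle_on (product_space X S) M \<and>
       pic_class X (pullback_bundle X (\<lambda>x. (x, s)) M) = \<one>\<^bsub>Pic X\<^esub> \<and>
       pic_class X (pullback_bundle X (\<lambda>x. (x, t)) M) = \<alpha>}"

definition torsion_free :: "('g, 'm) monoid_scheme \<Rightarrow> bool" where
  "torsion_free G \<longleftrightarrow> (\<forall>g \<in> carrier G. \<forall>n::nat. n > 0 \<and> g [^]\<^bsub>G\<^esub> n = \<one>\<^bsub>G\<^esub> \<longrightarrow> g = \<one>\<^bsub>G\<^esub>)"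

definition integral_basis :: "('g, 'm) monoid_scheme \<Rightarrow> nat \<Rightarrow> (nat \<Rightarrow> 'g) \<Rightarrow> bool" where
  "integral_basis G r b \<longleftrightarrow> (\<forall>i<r. b i \<in> carrier G) \<and>
     (\<forall>g \<in> carrier G. \<exists>!a :: nat \<Rightarrow> int. a \<in> extensional {..<r} \<and>
        g = finprod G (\<lambda>i. b i [^]\<^bsub>G\<^esub> a i) {..<r})"

section \<open>The Neron--Severi torus and torsors\<close>

definition Gm :: "complex monoid" where
  "Gm = \<lparr> carrier = UNIV - {0}, monoid.mult = (*), one = 1 \<rparr>"

text \<open>
  The complex points of the torus with character group \<open>Pic X\<close>; the character \<open>\<alpha>\<close> sends the point
  \<open>t\<close> to \<open>t \<alpha>\<close>.
\<close>

definition NS_torus :: "'a fspace \<Rightarrow> (('a, 'a \<times> complex) line_bundle set \<Rightarrow> complex) set" where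
  "NS_torus X = hom (Pic X) Gm \<inter> extensional (carrier (Pic X))"

text \<open>
  A basis of \<open>Pic X\<close> identifies \<open>NS_torus X\<close> with a power of \<open>Gm\<close>, and the following subgroup with
  the corresponding product of unit circles.
\<close>

definition compact_NS_torus ::
    "'a fspace \<Rightarrow> (('a, 'a \<times> complex) line_bundle set \<Rightarrow> complex) set" where
  "compact_NS_torus X = {t \<in> NS_torus X. \<forall>\<alpha> \<in> carrier (Pic X). norm (t \<alpha>) = 1}"

definition torus_pushforward ::
    "'a fspace \<Rightarrow> ('a \<Rightarrow> 'a) \<Rightarrow> (('a, 'a \<times> complex) line_bundle set \<Rightarrow> complex)
      \<Rightarrow> (('a, 'a \<times> complex) line_bundle set \<Rightarrow> complex)" where
  "torus_pushforward X \<gamma> t = (\<lambda>\<alpha> \<in> carrier (Pic X). t (pic_pullback X \<gamma> \<alpha>))"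

record ('a, 'u) NS_torsor =
  torsor_space :: "'u fspace"
  torsor_proj :: "'u \<Rightarrow> 'a"
  torsor_act :: "(('a, 'a \<times> complex) line_bundle set \<Rightarrow> complex) \<Rightarrow> 'u \<Rightarrow> 'u"

text \<open>
  The fibre product over \<open>X\<close> of the complements of the zero sections of \<open>L 0, ..., L (r - 1)\<close>. The
  base point is recorded separately so that the product is \<open>X\<close> itself for \<open>r = 0\<close>. The torus acts on
  the \<open>i\<close>-th factor through the character given by the class of \<open>L i\<close>.
\<close>

definition bundle_torsor ::
    "'a fspace \<Rightarrow> nat \<Rightarrow> (nat \<Rightarrow> ('a, 'l) line_bundle) \<Rightarrow> ('a, 'a \<times> (nat \<Rightarrow> 'l)) NS_torsor" where
  "bundle_torsor X r L =
     (let S = {(x, u). x \<in> points X \<and> u \<in> (\<Pi>\<^sub>E i\<in>{..<r}. nonzero_vectors (L i)) \<and>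
                 (\<forall>i<r. bundle_proj (L i) (u i) = x)}
      in \<lparr> torsor_space = initial_space S (pulled_back S fst X \<union>
             (\<Union>i<r. pulled_back S (\<lambda>p. snd p i) (bundle_space (L i)))),
           torsor_proj = fst,
           torsor_act = (\<lambda>t (x, u). (x, \<lambda>i\<in>{..<r}. scalar (L i) (t (pic_class X (L i))) (u i))) \<rparr>)"

definition torsor_pushforward ::
    "'a fspace \<Rightarrow> ('a \<Rightarrow> 'a) \<Rightarrow> ('a, 'u) NS_torsor \<Rightarrow> ('a, 'u) NS_torsor" where
  "torsor_pushforward X \<gamma> U =
     \<lparr> torsor_space = torsor_space U,
       torsor_proj = (\<lambda>u. \<gamma> (torsor_proj U u)),
       torsor_act = (\<lambda>t. torsor_act U (inv_into (NS_torus X) (torus_pushforward X \<gamma>) t)) \<rparr>"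

text \<open>The natural map from a torsor to its pushforward, which has the same total space.\<close>

definition to_pushforward :: "('a \<Rightarrow> 'a) \<Rightarrow> ('a, 'u) NS_torsor \<Rightarrow> 'u \<Rightarrow> 'u" where
  "to_pushforward \<gamma> U = (\<lambda>u. u)"

text \<open>Isomorphisms of torsors under the Neron--Severi torus: equivariant isomorphisms over \<open>X\<close>.\<close>

definition torsor_isomorphism ::
    "'a fspace \<Rightarrow> ('a, 'u) NS_torsor \<Rightarrow> ('a, 'v) NS_torsor \<Rightarrow> ('u \<Rightarrow> 'v) \<Rightarrow> bool" where
  "torsor_isomorphism X U V f \<longleftrightarrow> isomorphism (torsor_space U) (torsor_space V) f \<and>
     (\<forall>u \<in> points (torsor_space U). torsor_proj V (f u) = torsor_proj U u \<and>
        (\<forall>t \<in> NS_torus X. f (torsor_act U t u) = torsor_act V t (f u)))"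

end

theory Submission
  imports Defs
begin

text \<open>
  An arbitrary choice of a nonzero vector \<open>e i x\<close> in every fibre of every \<open>L i\<close> identifies the
  fibres of the torsor with the torus, and a lift of \<open>\<gamma>\<close> then has the form
  \<open>t \<cdot> e x \<mapsto> F x \<cdot> \<gamma>\<^sub>* t \<cdot> e (\<gamma> x)\<close>, where the torus-valued function \<open>F\<close> is determined by
  regularity up to a factor in the torus. The discrepancy of three such lifts is
  \<open>F\<^sub>3 x / (F\<^sub>1 (\<gamma>\<^sub>2 x) \<cdot> \<gamma>\<^sub>1\<^sub>* (F\<^sub>2 x))\<close>, which does not depend on \<open>x\<close> because invertible regular
  functions on \<open>X\<close> are constant. Since \<open>X\<close> is compact in the classical topology, \<open>e\<close> can be chosen of
  locally bounded norm; then \<open>ln \<bar>\<chi> (F x)\<bar>\<close> is bounded and measurable for all characters \<open>\<chi>\<close>, and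
  rescaling \<open>F\<close> by the torus makes its integral zero. Integrating \<open>ln \<bar>\<chi>\<bar>\<close> of the
  discrepancy against the invariant measure therefore gives zero as well.
\<close>

section \<open>Spaces with functions\<close>

text \<open>The obstacle is that transition cocycles would have to be compared between bundles,
  tensor products and pullbacks that share no common trivialising cover. An arbitrary frame removes
  the covers: a bundle becomes one family \<open>d\<close> of functions, tensor product and pullback
  become multiplication and composition of functions, and isomorphism becomes equality up to units
  and a factor independent of the chart. \<open>F\<close> exists because the pullback of a basis
  class has two descriptions, the pulled back \<open>d i\<close> and a monomial in the
  \<open>d j\<close>; they give the same class, and the factor between them is a coordinate of
  \<open>F\<close>. The normalisation must hold for all characters and not only for a basis, since
  \<open>F\<^sub>2\<close> enters the discrepancy through the character
  \<open>\<gamma>\<^sub>1\<^sup>* \<chi>\<close>. It can be had because the logarithm is additive in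
  \<chi>, so r positive real factors suffice. Compactness of \<open>X\<close> and constancy of
  regular functions rest on one device: closed subsets of the product of \<open>X\<close> with an
  affine space have closed images there. It is applied to reciprocals of chart coordinates and to
  the graph of a function.\<close>

context
  fixes X :: "'a fspace"
  assumes X: "space_with_functions X"
begin

lemma regular_openin: "f \<in> regular X U \<Longrightarrow> openin (zariski X) U"
  using X[unfolded space_with_functions_def, THEN conjunct1, rule_format] .

lemma regular_const: "openin (zariski X) U \<Longrightarrow> (\<lambda>_. c) \<in> regular X U"
  using X[unfolded space_with_functions_def, THEN conjunct2, THEN conjunct1, rule_format] .

lemma regular_add: "f \<in> regular X U \<Longrightarrow> g \<in> regular X U \<Longrightarrow> (\<lambda>x. f x + g x) \<in> regular X U"
  using X[unfolded space_with_functions_def, THEN conjunct2, THEN conjunct2, THEN conjunct1, rule_format, THEN conjunct1] .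

lemma regular_mult: "f \<in> regular X U \<Longrightarrow> g \<in> regular X U \<Longrightarrow> (\<lambda>x. f x * g x) \<in> regular X U"
  using X[unfolded space_with_functions_def, THEN conjunct2, THEN conjunct2, THEN conjunct1, rule_format, THEN conjunct2] .

lemma regular_subset:
  "f \<in> regular X U \<Longrightarrow> openin (zariski X) V \<Longrightarrow> V \<subseteq> U \<Longrightarrow> f \<in> regular X V"
  using X[unfolded space_with_functions_def, THEN conjunct2, THEN conjunct2, THEN conjunct2, THEN conjunct1, rule_format] by blast

lemma regular_glue:
  assumes "openin (zariski X) U"
    and "\<And>x. x \<in> U \<Longrightarrow> \<exists>V. x \<in> V \<and> V \<subseteq> U \<and> (\<exists>g\<in>regular X V. \<forall>y\<in>V. f y = g y)"
  shows "f \<in> regular X U"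
proof -
  show ?thesis
    by (rule X[unfolded space_with_functions_def, THEN conjunct2, THEN conjunct2, THEN conjunct2, THEN conjunct2, THEN conjunct1, rule_format], intro conjI ballI assms)
qed

lemma regular_nonzero_openin: "f \<in> regular X U \<Longrightarrow> openin (zariski X) {x\<in>U. f x \<noteq> 0}"
  using X[unfolded space_with_functions_def, THEN conjunct2, THEN conjunct2, THEN conjunct2, THEN conjunct2, THEN conjunct2, rule_format, THEN conjunct1] .

lemma regular_inverse: "f \<in> regular X U \<Longrightarrow> (\<lambda>x. 1 / f x) \<in> regular X {x\<in>U. f x \<noteq> 0}"
  using X[unfolded space_with_functions_def, THEN conjunct2, THEN conjunct2, THEN conjunct2, THEN conjunct2, THEN conjunct2, rule_format, THEN conjunct2] .

lemma regular_cong: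
  assumes "f \<in> regular X U" "\<And>y. y \<in> U \<Longrightarrow> f y = g y"
  shows "g \<in> regular X U"
  by (rule regular_glue[OF regular_openin[OF assms(1)]]) (metis assms subset_refl)

lemma regular_local:
  assumes U: "openin (zariski X) U" and loc: "\<And>x. x \<in> U \<Longrightarrow> \<exists>V. x \<in> V \<and> f \<in> regular X V"
  shows "f \<in> regular X U"
proof (rule regular_glue[OF U])
  fix x assume x: "x \<in> U"
  obtain V where V: "x \<in> V" "f \<in> regular X V" using loc[OF x] by blast
  have "f \<in> regular X (U \<inter> V)"
    by (rule regular_subset[OF V(2)]) (use U V regular_openin in auto)
  with x V show "\<exists>V. x \<in> V \<and> V \<subseteq> U \<and> (\<exists>g\<in>regular X V. \<forall>y\<in>V. f y = g y)"
    by (intro exI[of _ "U \<inter> V"]) auto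
qed

lemma regular_Int_mult:
  assumes "f \<in> regular X U" "g \<in> regular X V"
  shows "(\<lambda>x. f x + g x) \<in> regular X (U \<inter> V)" "(\<lambda>x. f x * g x) \<in> regular X (U \<inter> V)"
proof -
  have o: "openin (zariski X) (U \<inter> V)"
    using assms regular_openin by blast
  have "f \<in> regular X (U \<inter> V)" "g \<in> regular X (U \<inter> V)"
    using assms o by (auto intro: regular_subset)
  then show "(\<lambda>x. f x + g x) \<in> regular X (U \<inter> V)" "(\<lambda>x. f x * g x) \<in> regular X (U \<inter> V)"
    by (auto intro: regular_add regular_mult)
qed

end

subsection \<open>Initial structures\<close>

text \<open>Closure under binary intersections turns the subbasis into a basis: the pointwise
  statement is stable under each generating rule, and only the intersection rule calls for
  \<open>int\<close>.\<close>

lemma topology_generated_by_basis: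
  assumes int: "\<And>A B. A \<in> \<B> \<Longrightarrow> B \<in> \<B> \<Longrightarrow> A \<inter> B \<in> \<B>"
    and V: "openin (topology_generated_by \<B>) V" and x: "x \<in> V"
  shows "\<exists>W\<in>\<B>. x \<in> W \<and> W \<subseteq> V"
proof -
  have "generate_topology_on \<B> V" using V by (simp add: openin_topology_generated_by_iff)
  then have "\<forall>x\<in>V. \<exists>W\<in>\<B>. x \<in> W \<and> W \<subseteq> V"
  proof induction
    case Empty then show ?case by simp
  next
    case (Int a b)
    show ?case
    proof
      fix x assume "x \<in> a \<inter> b"
      then obtain A B where "A \<in> \<B>" "B \<in> \<B>" "x \<in> A" "x \<in> B" "A \<subseteq> a" "B \<subseteq> b"
        using Int.IH by blast
      then show "\<exists>W\<in>\<B>. x \<in> W \<and> W \<subseteq> a \<inter> b" using int by (intro bexI[of _ "A \<inter> B"]) auto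
    qed
  next
    case (UN K) then show ?case by (meson Union_iff Union_upper order_trans)
  next
    case (Basis s) then show ?case by blast
  qed
  with x show ?thesis by blast
qed

lemma openin_generated_local:
  assumes sub: "\<And>B. B \<in> \<B> \<Longrightarrow> openin T B" and V: "openin (topology_generated_by \<B>) V"
  shows "openin T V"
proof -
  have "generate_topology_on \<B> V" using V by (simp add: openin_topology_generated_by_iff)
  then show ?thesis by induction (use sub in auto)
qed

lemma zariski_initial_space [simp]: "zariski (initial_space S G) = initial_topology S G"
  by (simp add: initial_space_def)

lemma openin_initial_topology:
  "(D, f) \<in> generated_algebra S G \<Longrightarrow> openin (initial_topology S G) {x\<in>D. f x \<noteq> 0}"
  unfolding initial_topology_def by (rule topology_generated_by_Basis) blast

text \<open>Multiplying two members of the algebra intersects their domains and their nonvanishing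
  loci. So a single function, rather than a finite family, describes a basic neighbourhood.\<close>

lemma initial_topology_basis:
  assumes V: "openin (initial_topology S G) V" "x \<in> V"
  shows "\<exists>D q. (D, q) \<in> generated_algebra S G \<and> x \<in> D \<and> q x \<noteq> 0 \<and> {y\<in>D. q y \<noteq> 0} \<subseteq> V"
proof -
  let ?B = "{{x\<in>D. f x \<noteq> 0} |D f. (D, f) \<in> generated_algebra S G}"
  have int: "A \<inter> B \<in> ?B" if A: "A \<in> ?B" and B: "B \<in> ?B" for A B
  proof -
    obtain D f where 1: "A = {x\<in>D. f x \<noteq> 0}" "(D, f) \<in> generated_algebra S G" using A by auto
    obtain E g where 2: "B = {x\<in>E. g x \<noteq> 0}" "(E, g) \<in> generated_algebra S G" using B by auto
    have "A \<inter> B = {x\<in>D \<inter> E. f x * g x \<noteq> 0}" using 1 2 by auto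
    then show ?thesis unfolding mem_Collect_eq
      by (intro exI conjI) (assumption, rule generated_algebra.mult[OF 1(2) 2(2)])
  qed
  have "\<exists>W\<in>?B. x \<in> W \<and> W \<subseteq> V"
    by (rule topology_generated_by_basis[OF int V(1)[unfolded initial_topology_def] V(2)])
  then obtain W where W: "W \<in> ?B" "x \<in> W" "W \<subseteq> V" by (elim bexE conjE)
  then obtain D q where Dq: "W = {x\<in>D. q x \<noteq> 0}" "(D, q) \<in> generated_algebra S G" by auto
  with W show ?thesis by (intro exI[of _ D] exI[of _ q]) simp
qed

text \<open>Multiplying by 0 and adding 1 leaves nothing of \<open>f\<close> but its domain. A
  product with this constant later shrinks a function to a smaller domain without changing its
  values.\<close>

lemma generated_algebra_dom_one:
  assumes "(D, f) \<in> generated_algebra S G" shows "(D \<inter> S, \<lambda>_. 1) \<in> generated_algebra S G"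
proof -
  have "(D \<inter> S \<inter> S, \<lambda>x. f x * 0 + 1) \<in> generated_algebra S G"
    by (intro generated_algebra.add generated_algebra.mult assms generated_algebra.const)
  then show ?thesis by (simp add: Int_assoc)
qed

context
  fixes S :: "'a set" and G :: "('a set \<times> ('a \<Rightarrow> complex)) set"
  assumes dom: "\<And>D f. (D, f) \<in> G \<Longrightarrow> D \<subseteq> S"
begin

lemma generated_algebra_dom: "(D, f) \<in> generated_algebra S G \<Longrightarrow> D \<subseteq> S"
  by (induction rule: generated_algebra.induct) (use dom in auto)

lemma topspace_initial [simp]: "topspace (initial_topology S G) = S"
proof -
  have "S = {x\<in>S. (1::complex) \<noteq> 0}" by simp
  moreover have "(S, \<lambda>_. 1) \<in> generated_algebra S G" by (rule generated_algebra.const)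
  ultimately have "S \<in> {{x\<in>D. f x \<noteq> 0} |D f. (D, f) \<in> generated_algebra S G}"
    unfolding mem_Collect_eq by (intro exI conjI) assumption+
  moreover have "B \<subseteq> S" if "B \<in> {{x\<in>D. f x \<noteq> 0} |D f. (D, f) \<in> generated_algebra S G}" for B
    using that generated_algebra_dom by fastforce
  ultimately show ?thesis
    unfolding initial_topology_def topology_generated_by_topspace by (simp add: Sup_le_iff Union_upper antisym Union_least)
qed

lemma generated_algebra_openin: "(D, f) \<in> generated_algebra S G \<Longrightarrow> openin (initial_topology S G) D"
  using openin_initial_topology[OF generated_algebra_dom_one, of D f S G] generated_algebra_dom[of D f]
  by (simp add: inf.absorb1)

lemma generated_algebra_regular:
  assumes "(D, f) \<in> generated_algebra S G" shows "f \<in> regular (initial_space S G) D"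
proof -
  have "\<exists>D' g E h. (D', g) \<in> generated_algebra S G \<and> (E, h) \<in> generated_algebra S G \<and>
            x \<in> D' \<inter> E \<and> h x \<noteq> 0 \<and> (\<forall>y \<in> D \<inter> D' \<inter> E. h y \<noteq> 0 \<longrightarrow> f y = g y / h y)" if "x \<in> D" for x
    using that assms generated_algebra_dom[OF assms] generated_algebra.const[of S 1 G]
    by (intro exI[of _ D] exI[of _ f] exI[of _ S] exI[of _ "\<lambda>_. 1"]) auto
  then show ?thesis using generated_algebra_openin[OF assms] by (simp add: initial_space_def)
qed

text \<open>The definition gives numerator and denominator on different domains and a formula valid
  only inside \<open>U\<close>. Multiplying both by a \<open>q\<close> whose nonvanishing locus lies
  in \<open>U\<close> brings them to one domain and makes nonvanishing of the denominator imply
  membership in \<open>U\<close>, so that later computations with fractions carry a single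
  condition.\<close>

lemma initial_space_regularD:
  assumes "f \<in> regular (initial_space S G) U" "x \<in> U"
  obtains D g h where "(D, g) \<in> generated_algebra S G" "(D, h) \<in> generated_algebra S G"
    "x \<in> D" "h x \<noteq> 0" "\<And>y. y \<in> D \<Longrightarrow> h y \<noteq> 0 \<Longrightarrow> y \<in> U \<and> f y = g y / h y"
proof -
  have U: "openin (initial_topology S G) U" using assms by (simp add: initial_space_def)
  obtain D g E h where 1: "(D, g) \<in> generated_algebra S G" "(E, h) \<in> generated_algebra S G"
    "x \<in> D \<inter> E" "h x \<noteq> 0" "\<forall>y \<in> U \<inter> D \<inter> E. h y \<noteq> 0 \<longrightarrow> f y = g y / h y"
    using assms by (simp add: initial_space_def) blast
  obtain C q where 2: "(C, q) \<in> generated_algebra S G" "x \<in> C" "q x \<noteq> 0" "{y\<in>C. q y \<noteq> 0} \<subseteq> U"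
    using initial_topology_basis[OF U assms(2)] by blast
  have E1: "(E \<inter> S, \<lambda>_. 1) \<in> generated_algebra S G" by (rule generated_algebra_dom_one[OF 1(2)])
  have D1: "(D \<inter> S, \<lambda>_. 1) \<in> generated_algebra S G" by (rule generated_algebra_dom_one[OF 1(1)])
  have "D \<subseteq> S" "E \<subseteq> S" using generated_algebra_dom 1 by auto
  then have eq: "D \<inter> S = D" "E \<inter> S = E" by auto
  have a: "(D \<inter> E \<inter> C, \<lambda>y. g y * 1 * q y) \<in> generated_algebra S G"
    using E1 eq by (intro generated_algebra.mult 1 2) auto
  have b: "(D \<inter> E \<inter> C, \<lambda>y. 1 * h y * q y) \<in> generated_algebra S G"
    using D1 eq by (intro generated_algebra.mult 1 2) auto
  show thesis
    by (rule that[OF a b]) (use 1 2 in auto)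
qed

lemma initial_space_regularI:
  assumes "\<And>x. x \<in> U \<Longrightarrow> \<exists>D g h. (D, g) \<in> generated_algebra S G \<and> (D, h) \<in> generated_algebra S G \<and>
    x \<in> D \<and> h x \<noteq> 0 \<and> (\<forall>y\<in>D. h y \<noteq> 0 \<longrightarrow> y \<in> U \<and> f y = g y / h y)"
  shows "f \<in> regular (initial_space S G) U"
proof -
  have "openin (initial_topology S G) U"
  proof (subst openin_subopen, intro ballI)
    fix x assume "x \<in> U"
    then obtain D g h where 1: "(D, h) \<in> generated_algebra S G"
      "x \<in> D" "h x \<noteq> 0" "\<forall>y\<in>D. h y \<noteq> 0 \<longrightarrow> y \<in> U \<and> f y = g y / h y" using assms by blast
    show "\<exists>T. openin (initial_topology S G) T \<and> x \<in> T \<and> T \<subseteq> U"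
      by (intro exI[of _ "{y\<in>D. h y \<noteq> 0}"] conjI openin_initial_topology 1) (use 1 in auto)
  qed
  moreover have "\<exists>D g E h. (D, g) \<in> generated_algebra S G \<and> (E, h) \<in> generated_algebra S G \<and>
     x \<in> D \<inter> E \<and> h x \<noteq> 0 \<and> (\<forall>y \<in> U \<inter> D \<inter> E. h y \<noteq> 0 \<longrightarrow> f y = g y / h y)" if "x \<in> U" for x
    using assms[OF that] by blast
  ultimately show ?thesis by (simp add: initial_space_def)
qed

lemma swf_initial_space: "space_with_functions (initial_space S G)"
  unfolding space_with_functions_def
proof (intro conjI allI impI ballI)
  let ?I = "initial_space S G"
  show "f \<in> regular ?I U \<Longrightarrow> openin (zariski ?I) U" for U f
    by (simp add: initial_space_def)
  show const: "(\<lambda>_. c) \<in> regular ?I U" if U: "openin (zariski ?I) U" for U c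
  proof (rule initial_space_regularI)
    fix x assume "x \<in> U"
    obtain D q where 1: "(D, q) \<in> generated_algebra S G" "x \<in> D" "q x \<noteq> 0" "{y\<in>D. q y \<noteq> 0} \<subseteq> U"
      using initial_topology_basis[of S G U x] U \<open>x \<in> U\<close> by auto
    \<comment> \<open>The constant is written as \<open>q * c / q\<close>, so that its denominator
      confines the fraction to \<open>U\<close>.\<close>
    have "(D \<inter> S, \<lambda>y. q y * c) \<in> generated_algebra S G"
      by (intro generated_algebra.mult 1 generated_algebra.const)
    with generated_algebra_dom[OF 1(1)] have "(D, \<lambda>y. q y * c) \<in> generated_algebra S G"
      by (simp add: inf.absorb1)
    with 1 show "\<exists>D g h. (D, g) \<in> generated_algebra S G \<and> (D, h) \<in> generated_algebra S G \<and>
      x \<in> D \<and> h x \<noteq> 0 \<and> (\<forall>y\<in>D. h y \<noteq> 0 \<longrightarrow> y \<in> U \<and> c = g y / h y)"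
      by (intro exI[of _ D] exI[of _ "\<lambda>y. q y * c"] exI[of _ q]) auto
  qed
  show "(\<lambda>x. f x + g x) \<in> regular ?I U" "(\<lambda>x. f x * g x) \<in> regular ?I U"
    if f: "f \<in> regular ?I U" and g: "g \<in> regular ?I U" for U f g
  proof -
    have "\<exists>D q p h. (D, q) \<in> generated_algebra S G \<and> (D, p) \<in> generated_algebra S G \<and>
      (D, h) \<in> generated_algebra S G \<and> x \<in> D \<and> h x \<noteq> 0 \<and>
      (\<forall>y\<in>D. h y \<noteq> 0 \<longrightarrow> y \<in> U \<and> f y + g y = q y / h y \<and> f y * g y = p y / h y)" if xU: "x \<in> U" for x
    proof -
      obtain D a b where 1: "(D, a) \<in> generated_algebra S G" "(D, b) \<in> generated_algebra S G"
        "x \<in> D" "b x \<noteq> 0" "\<And>y. y \<in> D \<Longrightarrow> b y \<noteq> 0 \<Longrightarrow> y \<in> U \<and> f y = a y / b y"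
        using initial_space_regularD[OF f xU] by blast
      obtain E c d where 2: "(E, c) \<in> generated_algebra S G" "(E, d) \<in> generated_algebra S G"
        "x \<in> E" "d x \<noteq> 0" "\<And>y. y \<in> E \<Longrightarrow> d y \<noteq> 0 \<Longrightarrow> y \<in> U \<and> g y = c y / d y"
        using initial_space_regularD[OF g xU] by blast
      have "(D \<inter> E \<inter> (D \<inter> E), \<lambda>y. a y * d y + b y * c y) \<in> generated_algebra S G"
        "(D \<inter> E, \<lambda>y. a y * c y) \<in> generated_algebra S G"
        "(D \<inter> E, \<lambda>y. b y * d y) \<in> generated_algebra S G"
        by (intro generated_algebra.mult generated_algebra.add 1 2)+
      with 1 2 show ?thesis
        by (intro exI[of _ "D \<inter> E"] exI[of _ "\<lambda>y. a y * d y + b y * c y"] exI[of _ "\<lambda>y. a y * c y"]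
            exI[of _ "\<lambda>y. b y * d y"]) (auto simp: field_simps)
    qed
    note * = this
    show "(\<lambda>x. f x + g x) \<in> regular ?I U"
    proof (rule initial_space_regularI)
      fix x assume "x \<in> U"
      then obtain D q h where "(D, q) \<in> generated_algebra S G" "(D, h) \<in> generated_algebra S G"
        "x \<in> D" "h x \<noteq> 0" "\<forall>y\<in>D. h y \<noteq> 0 \<longrightarrow> y \<in> U \<and> f y + g y = q y / h y"
        using * by metis
      then show "\<exists>D q h. (D, q) \<in> generated_algebra S G \<and> (D, h) \<in> generated_algebra S G \<and>
        x \<in> D \<and> h x \<noteq> 0 \<and> (\<forall>y\<in>D. h y \<noteq> 0 \<longrightarrow> y \<in> U \<and> f y + g y = q y / h y)"
        by (intro exI conjI)
    qed
    show "(\<lambda>x. f x * g x) \<in> regular ?I U"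
    proof (rule initial_space_regularI)
      fix x assume "x \<in> U"
      then obtain D q h where "(D, q) \<in> generated_algebra S G" "(D, h) \<in> generated_algebra S G"
        "x \<in> D" "h x \<noteq> 0" "\<forall>y\<in>D. h y \<noteq> 0 \<longrightarrow> y \<in> U \<and> f y * g y = q y / h y"
        using * by metis
      then show "\<exists>D q h. (D, q) \<in> generated_algebra S G \<and> (D, h) \<in> generated_algebra S G \<and>
        x \<in> D \<and> h x \<noteq> 0 \<and> (\<forall>y\<in>D. h y \<noteq> 0 \<longrightarrow> y \<in> U \<and> f y * g y = q y / h y)"
        by (intro exI conjI)
    qed
  qed
  show restr: "f \<in> regular ?I V" if f: "f \<in> regular ?I U" and V: "openin (zariski ?I) V \<and> V \<subseteq> U" for U V f
  proof -
    have A: "\<forall>x\<in>U. \<exists>D g E h. (D, g) \<in> generated_algebra S G \<and> (E, h) \<in> generated_algebra S G \<and>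
            x \<in> D \<inter> E \<and> h x \<noteq> 0 \<and> (\<forall>y \<in> U \<inter> D \<inter> E. h y \<noteq> 0 \<longrightarrow> f y = g y / h y)"
      using f unfolding initial_space_def fspace.simps mem_Collect_eq by (elim conjE)
    have "\<exists>D g E h. (D, g) \<in> generated_algebra S G \<and> (E, h) \<in> generated_algebra S G \<and>
            x \<in> D \<inter> E \<and> h x \<noteq> 0 \<and> (\<forall>y \<in> V \<inter> D \<inter> E. h y \<noteq> 0 \<longrightarrow> f y = g y / h y)" if x: "x \<in> V" for x
    proof -
      have "x \<in> U" using x V by blast
      from A[rule_format, OF this] obtain D g E h where "(D, g) \<in> generated_algebra S G \<and>
        (E, h) \<in> generated_algebra S G \<and> x \<in> D \<inter> E \<and> h x \<noteq> 0 \<and>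
        (\<forall>y \<in> U \<inter> D \<inter> E. h y \<noteq> 0 \<longrightarrow> f y = g y / h y)"
        by (elim exE)
      note * = this[THEN conjunct1] this[THEN conjunct2, THEN conjunct1]
        this[THEN conjunct2, THEN conjunct2, THEN conjunct1]
        this[THEN conjunct2, THEN conjunct2, THEN conjunct2, THEN conjunct1]
        this[THEN conjunct2, THEN conjunct2, THEN conjunct2, THEN conjunct2]
      then have "\<forall>y \<in> V \<inter> D \<inter> E. h y \<noteq> 0 \<longrightarrow> f y = g y / h y" using V *(5) by blast
      with *(1-4) show ?thesis by (intro exI conjI)
    qed
    then show ?thesis using V unfolding initial_space_def by simp
  qed
  show "f \<in> regular ?I U" if A: "openin (zariski ?I) U \<and>
     (\<forall>x\<in>U. \<exists>V. x \<in> V \<and> V \<subseteq> U \<and> (\<exists>g\<in>regular ?I V. \<forall>y\<in>V. f y = g y))" for U f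
  proof (rule initial_space_regularI)
    fix x assume "x \<in> U"
    then obtain V g where V: "x \<in> V" "V \<subseteq> U" "g \<in> regular ?I V" "\<forall>y\<in>V. f y = g y" using A by blast
    obtain D a b where 1: "(D, a) \<in> generated_algebra S G" "(D, b) \<in> generated_algebra S G"
        "x \<in> D" "b x \<noteq> 0" "\<And>y. y \<in> D \<Longrightarrow> b y \<noteq> 0 \<Longrightarrow> y \<in> V \<and> g y = a y / b y"
      using initial_space_regularD[OF V(3) V(1)] by blast
    have "\<forall>y\<in>D. b y \<noteq> 0 \<longrightarrow> y \<in> U \<and> f y = a y / b y" using 1(5) V(2,4) by auto
    with 1(1-4) show "\<exists>D g h. (D, g) \<in> generated_algebra S G \<and> (D, h) \<in> generated_algebra S G \<and>
      x \<in> D \<and> h x \<noteq> 0 \<and> (\<forall>y\<in>D. h y \<noteq> 0 \<longrightarrow> y \<in> U \<and> f y = g y / h y)"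
      by (intro exI conjI)
  qed
  have inv: "(\<lambda>x. 1 / f x) \<in> regular ?I {x\<in>U. f x \<noteq> 0}" if f: "f \<in> regular ?I U" for U f
  proof (rule initial_space_regularI)
    fix x assume x: "x \<in> {x\<in>U. f x \<noteq> 0}"
    then obtain D a b where 1: "(D, a) \<in> generated_algebra S G" "(D, b) \<in> generated_algebra S G"
        "x \<in> D" "b x \<noteq> 0" "\<And>y. y \<in> D \<Longrightarrow> b y \<noteq> 0 \<Longrightarrow> y \<in> U \<and> f y = a y / b y"
      using initial_space_regularD[OF f] by blast
    have ax: "a x \<noteq> 0" using 1 x by auto
    \<comment> \<open>The reciprocal \<open>b / a\<close> is expanded by \<open>b\<close>:
      nonvanishing of the denominator \<open>a * b\<close> then includes that of \<open>b\<close>,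
      which is where the formula for \<open>f\<close> is valid.\<close>
    have "(D \<inter> D, \<lambda>y. b y * b y) \<in> generated_algebra S G" "(D \<inter> D, \<lambda>y. a y * b y) \<in> generated_algebra S G"
      by (intro generated_algebra.mult 1)+
    with 1 ax show "\<exists>D g h. (D, g) \<in> generated_algebra S G \<and> (D, h) \<in> generated_algebra S G \<and>
      x \<in> D \<and> h x \<noteq> 0 \<and> (\<forall>y\<in>D. h y \<noteq> 0 \<longrightarrow> y \<in> {x\<in>U. f x \<noteq> 0} \<and> 1 / f y = g y / h y)"
      by (intro exI[of _ D] exI[of _ "\<lambda>y. b y * b y"] exI[of _ "\<lambda>y. a y * b y"]) auto
  qed
  show "(\<lambda>x. 1 / f x) \<in> regular ?I {x\<in>U. f x \<noteq> 0}" if f: "f \<in> regular ?I U" for U f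
    by (rule inv[OF f])
  show "openin (zariski ?I) {x\<in>U. f x \<noteq> 0}" if f: "f \<in> regular ?I U" for U f
    using inv[OF f] by (simp add: initial_space_def)
qed

text \<open>This is the universal property of the initial structure. Testing generators is enough
  because regularity of pulled back functions survives sums, products and quotients. The
  descriptions of morphisms into subspaces, fibre products, the affine line, bundles built from
  gauges and the torsor are all instances.\<close>

lemma morphism_initial_space_iff:
  assumes Z: "space_with_functions Z"
  shows "morphism Z (initial_space S G) F \<longleftrightarrow> F \<in> points Z \<rightarrow> S \<and>
    (\<forall>(D, g)\<in>G. (\<lambda>z. g (F z)) \<in> regular Z {z\<in>points Z. F z \<in> D})"
proof (intro iffI conjI)
  assume m: "morphism Z (initial_space S G) F"
  then show "F \<in> points Z \<rightarrow> S" unfolding morphism_def continuous_map_def by simp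
  show "\<forall>(D, g)\<in>G. (\<lambda>z. g (F z)) \<in> regular Z {z\<in>points Z. F z \<in> D}"
    using m generated_algebra_regular[OF generated_algebra.gen] unfolding morphism_def by blast
next
  assume A: "F \<in> points Z \<rightarrow> S \<and> (\<forall>(D, g)\<in>G. (\<lambda>z. g (F z)) \<in> regular Z {z\<in>points Z. F z \<in> D})"
  have gen: "(\<lambda>z. g (F z)) \<in> regular Z {z\<in>points Z. F z \<in> D}" if "(D, g) \<in> generated_algebra S G" for D g
    using that
  proof induction
    case (const c)
    have "{z\<in>points Z. F z \<in> S} = points Z" using A by auto
    then show ?case using regular_const[OF Z] by simp
  next
    case (gen D f) then show ?case using A by blast
  next
    case (add D f E g)
    have "{z\<in>points Z. F z \<in> D \<inter> E} = {z\<in>points Z. F z \<in> D} \<inter> {z\<in>points Z. F z \<in> E}" by auto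
    then show ?case using regular_Int_mult(1)[OF Z add.IH] by simp
  next
    case (mult D f E g)
    have "{z\<in>points Z. F z \<in> D \<inter> E} = {z\<in>points Z. F z \<in> D} \<inter> {z\<in>points Z. F z \<in> E}" by auto
    then show ?case using regular_Int_mult(2)[OF Z mult.IH] by simp
  qed
  show "morphism Z (initial_space S G) F" unfolding morphism_def
  proof (intro conjI allI ballI)
    show "continuous_map (zariski Z) (zariski (initial_space S G)) F"
      unfolding zariski_initial_space initial_topology_def
    proof (rule continuous_on_generated_topo)
      fix U assume "U \<in> {{x \<in> D. f x \<noteq> 0} |D f. (D, f) \<in> generated_algebra S G}"
      then obtain D f where U: "U = {x\<in>D. f x \<noteq> 0}" "(D, f) \<in> generated_algebra S G" by auto
      have "F -` U \<inter> points Z = {z\<in>{z\<in>points Z. F z \<in> D}. f (F z) \<noteq> 0}" using U by auto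
      then show "openin (zariski Z) (F -` U \<inter> points Z)"
        using regular_nonzero_openin[OF Z gen[OF U(2)]] by simp
    next
      show "F ` points Z \<subseteq> \<Union> {{x \<in> D. f x \<noteq> 0} |D f. (D, f) \<in> generated_algebra S G}"
        using A topspace_initial unfolding initial_topology_def topology_generated_by_topspace by auto
    qed
    then have cont: "openin (zariski Z) {z \<in> points Z. F z \<in> V}" if "openin (initial_topology S G) V" for V
      using that by (simp add: continuous_map_def)
    fix V g assume g: "g \<in> regular (initial_space S G) V"
    then have V: "openin (initial_topology S G) V" by (simp add: initial_space_def)
    show "(\<lambda>x. g (F x)) \<in> regular Z {x \<in> points Z. F x \<in> V}"
    proof (rule regular_glue[OF Z cont[OF V]])
      fix z assume z: "z \<in> {x \<in> points Z. F x \<in> V}"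
      then obtain D a b where 1: "(D, a) \<in> generated_algebra S G" "(D, b) \<in> generated_algebra S G"
        "F z \<in> D" "b (F z) \<noteq> 0" "\<And>y. y \<in> D \<Longrightarrow> b y \<noteq> 0 \<Longrightarrow> y \<in> V \<and> g y = a y / b y"
        using initial_space_regularD[OF g] by blast
      let ?D = "{z\<in>points Z. F z \<in> D}" and ?E = "{z\<in>{z\<in>points Z. F z \<in> D}. b (F z) \<noteq> 0}"
      have "(\<lambda>z. 1 / b (F z)) \<in> regular Z ?E" by (rule regular_inverse[OF Z gen[OF 1(2)]])
      from regular_Int_mult(2)[OF Z gen[OF 1(1)] this]
      have "(\<lambda>z. a (F z) * (1 / b (F z))) \<in> regular Z (?D \<inter> ?E)" .
      moreover have "?D \<inter> ?E = ?E" by auto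
      ultimately have "(\<lambda>z. a (F z) * (1 / b (F z))) \<in> regular Z ?E" by simp
      then show "\<exists>W. z \<in> W \<and> W \<subseteq> {x \<in> points Z. F x \<in> V} \<and> (\<exists>h\<in>regular Z W. \<forall>y\<in>W. g (F y) = h y)"
        using 1 z by (intro exI[of _ ?E]) auto
    qed
  qed
qed

end

subsection \<open>Morphisms\<close>

lemma morphism_points: "morphism X Y f \<Longrightarrow> x \<in> points X \<Longrightarrow> f x \<in> points Y"
  unfolding morphism_def continuous_map_def by auto

lemma morphism_regular:
  "morphism X Y f \<Longrightarrow> g \<in> regular Y V \<Longrightarrow> (\<lambda>x. g (f x)) \<in> regular X {x\<in>points X. f x \<in> V}"
  unfolding morphism_def by blast

lemma morphism_openin:
  "morphism X Y f \<Longrightarrow> openin (zariski Y) V \<Longrightarrow> openin (zariski X) {x\<in>points X. f x \<in> V}"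
  unfolding morphism_def continuous_map_def by blast

lemma morphismI:
  assumes "\<And>x. x \<in> points X \<Longrightarrow> f x \<in> points Y"
    and "\<And>V. openin (zariski Y) V \<Longrightarrow> openin (zariski X) {x\<in>points X. f x \<in> V}"
    and "\<And>V g. g \<in> regular Y V \<Longrightarrow> (\<lambda>x. g (f x)) \<in> regular X {x\<in>points X. f x \<in> V}"
  shows "morphism X Y f"
  using assms unfolding morphism_def continuous_map_def by auto

lemma morphism_compose:
  assumes f: "morphism X Y f" and g: "morphism Y Z g"
  shows "morphism X Z (\<lambda>x. g (f x))"
proof (rule morphismI)
  have eq: "{x \<in> points X. f x \<in> {y \<in> points Y. g y \<in> V}} = {x \<in> points X. g (f x) \<in> V}" for V
    using morphism_points[OF f] by auto
  show "g (f x) \<in> points Z" if "x \<in> points X" for x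
    using that f g by (blast intro: morphism_points)
  show "openin (zariski X) {x \<in> points X. g (f x) \<in> V}" if "openin (zariski Z) V" for V
    using morphism_openin[OF f morphism_openin[OF g that]] by (simp only: eq)
  show "(\<lambda>x. h (g (f x))) \<in> regular X {x \<in> points X. g (f x) \<in> V}" if "h \<in> regular Z V" for h V
    using morphism_regular[OF f morphism_regular[OF g that]] by (simp only: eq)
qed

lemma morphism_cong:
  assumes X: "space_with_functions X" and f: "morphism X Y f" and eq: "\<And>x. x \<in> points X \<Longrightarrow> f x = g x"
  shows "morphism X Y g"
proof (rule morphismI)
  have e: "{x \<in> points X. g x \<in> V} = {x \<in> points X. f x \<in> V}" for V using eq by auto
  show "g x \<in> points Y" if "x \<in> points X" for x
    using that f eq morphism_points by metis
  show "openin (zariski X) {x \<in> points X. g x \<in> V}" if "openin (zariski Y) V" for V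
    using morphism_openin[OF f that] by (simp only: e)
  show "(\<lambda>x. h (g x)) \<in> regular X {x \<in> points X. g x \<in> V}" if "h \<in> regular Y V" for h V
    using regular_cong[OF X morphism_regular[OF f that]] eq by (simp add: e)
qed

lemma isomorphismI:
  assumes f: "morphism X Y f" and g: "morphism Y X g" and Y: "space_with_functions Y"
    and gf: "\<And>x. x \<in> points X \<Longrightarrow> g (f x) = x" and fg: "\<And>y. y \<in> points Y \<Longrightarrow> f (g y) = y"
  shows "isomorphism X Y f"
proof -
  have b: "bij_betw f (points X) (points Y)"
    using gf fg morphism_points[OF f] morphism_points[OF g] by (intro bij_betw_byWitness[where f'=g]) auto
  have "g y = inv_into (points X) f y" if "y \<in> points Y" for y
    using that gf fg morphism_points[OF g that] b
    by (metis bij_betw_imp_inj_on inv_into_f_f)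
  then have "morphism Y X (inv_into (points X) f)" by (rule morphism_cong[OF Y g])
  with b f show ?thesis unfolding isomorphism_def by blast
qed

lemma morphism_id: "space_with_functions X \<Longrightarrow> morphism X X (\<lambda>x. x)"
proof (rule morphismI)
  assume X: "space_with_functions X"
  have e: "{x \<in> points X. x \<in> V} = V" if "openin (zariski X) V" for V
    using openin_subset[OF that] by auto
  show "openin (zariski X) {x \<in> points X. x \<in> V}" if "openin (zariski X) V" for V
    using e[OF that] that by simp
  show "(\<lambda>x. h x) \<in> regular X {x \<in> points X. x \<in> V}" if "h \<in> regular X V" for h V
    using e[OF regular_openin[OF X that]] that by simp
qed

subsection \<open>Subspaces and products\<close>

lemma pulled_back_dom: "(D, f) \<in> pulled_back S p Y \<Longrightarrow> D \<subseteq> S"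
  unfolding pulled_back_def by auto

lemma pulled_back_ball:
  "(\<forall>(D, f)\<in>pulled_back S p Y. P D f) \<longleftrightarrow> (\<forall>V. \<forall>g\<in>regular Y V. P {x\<in>S. p x \<in> V} (\<lambda>x. g (p x)))"
  unfolding pulled_back_def by auto

lemma swf_induced: "space_with_functions (induced X V)"
  unfolding induced_def using pulled_back_dom by (rule swf_initial_space)

lemma points_induced [simp]: "points (induced X V) = V"
  unfolding induced_def zariski_initial_space using pulled_back_dom by (rule topspace_initial)

lemma morphism_induced_iff:
  assumes Z: "space_with_functions Z" and X: "space_with_functions X" and V: "V \<subseteq> points X"
  shows "morphism Z (induced X V) F \<longleftrightarrow> F \<in> points Z \<rightarrow> V \<and> morphism Z X F"
proof -
  have "morphism Z (induced X V) F \<longleftrightarrow> F \<in> points Z \<rightarrow> V \<and>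
    (\<forall>U. \<forall>g\<in>regular X U. (\<lambda>z. g (F z)) \<in> regular Z {z\<in>points Z. F z \<in> {x\<in>V. x \<in> U}})"
  proof -
    have "morphism Z (initial_space V (pulled_back V (\<lambda>x. x) X)) F \<longleftrightarrow> F \<in> points Z \<rightarrow> V \<and>
      (\<forall>(D, g)\<in>pulled_back V (\<lambda>x. x) X. (\<lambda>z. g (F z)) \<in> regular Z {z\<in>points Z. F z \<in> D})"
      by (rule morphism_initial_space_iff[OF _ Z]) (rule pulled_back_dom)
    then show ?thesis unfolding induced_def pulled_back_ball .
  qed
  also have "\<dots> \<longleftrightarrow> F \<in> points Z \<rightarrow> V \<and> morphism Z X F"
  proof (intro conj_cong refl iffI)
    assume F: "F \<in> points Z \<rightarrow> V"
    then have e: "{z\<in>points Z. F z \<in> {x\<in>V. x \<in> U}} = {z\<in>points Z. F z \<in> U}" for U by auto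
    { assume m: "morphism Z X F"
      show "\<forall>U. \<forall>g\<in>regular X U. (\<lambda>z. g (F z)) \<in> regular Z {z\<in>points Z. F z \<in> {x\<in>V. x \<in> U}}"
        unfolding e using morphism_regular[OF m] by blast }
    assume A: "\<forall>U. \<forall>g\<in>regular X U. (\<lambda>z. g (F z)) \<in> regular Z {z\<in>points Z. F z \<in> {x\<in>V. x \<in> U}}"
    show "morphism Z X F"
    proof (rule morphismI)
      show "F x \<in> points X" if "x \<in> points Z" for x using F V that by auto
      show "(\<lambda>x. g (F x)) \<in> regular Z {x \<in> points Z. F x \<in> U}" if "g \<in> regular X U" for U g
        using A that unfolding e by blast
      \<comment> \<open>Continuity costs nothing extra: the pullback of the constant 1 is regular on
        the preimage, and regular functions live on open sets only.\<close>
      show "openin (zariski Z) {x \<in> points Z. F x \<in> U}" if "openin (zariski X) U" for U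
        using A[unfolded e] regular_const[OF X that, of 1] regular_openin[OF Z] by blast
    qed
  qed
  finally show ?thesis .
qed

lemma morphism_inclusion:
  assumes "space_with_functions X" "V \<subseteq> points X" shows "morphism (induced X V) X (\<lambda>x. x)"
  using morphism_induced_iff[OF swf_induced assms] morphism_id[OF swf_induced]
  by blast

context
  fixes X :: "'a fspace" and V :: "'a set"
  assumes X: "space_with_functions X" and V: "openin (zariski X) V"
begin

text \<open>For open \<open>V\<close> the traces of domains on \<open>V\<close> are again open in
  \<open>X\<close>, so the induced structure generates nothing new. The next two lemmas draw from
  this that open sets and regular functions inside \<open>V\<close> are those of
  \<open>X\<close>.\<close>

lemma generated_algebra_induced_open:
  "(D, f) \<in> generated_algebra V (pulled_back V (\<lambda>x. x) X) \<Longrightarrow> f \<in> regular X D \<and> D \<subseteq> V"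
proof (induction rule: generated_algebra.induct)
  case (const c) then show ?case using regular_const[OF X V] by simp
next
  case (gen D f)
  then obtain U where U: "f \<in> regular X U" "D = V \<inter> U" unfolding pulled_back_def by auto
  then show ?case using regular_subset[OF X U(1)] V regular_openin[OF X U(1)] by auto
next
  case (add D f E g) then show ?case using regular_Int_mult[OF X] by blast
next
  case (mult D f E g) then show ?case using regular_Int_mult[OF X] by blast
qed

lemma openin_induced_open:
  "openin (zariski (induced X V)) U \<longleftrightarrow> openin (zariski X) U \<and> U \<subseteq> V"
proof (intro iffI conjI)
  assume U: "openin (zariski (induced X V)) U"
  then show "U \<subseteq> V" using openin_subset by fastforce
  show "openin (zariski X) U"
  proof (rule openin_generated_local)
    show "openin (topology_generated_by
      {{x\<in>D. f x \<noteq> 0} |D f. (D, f) \<in> generated_algebra V (pulled_back V (\<lambda>x. x) X)}) U"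
      using U by (simp add: induced_def initial_topology_def)
    show "\<And>B. B \<in> {{x\<in>D. f x \<noteq> 0} |D f. (D, f) \<in> generated_algebra V (pulled_back V (\<lambda>x. x) X)} \<Longrightarrow>
      openin (zariski X) B"
      using generated_algebra_induced_open regular_nonzero_openin[OF X] by blast
  qed
next
  assume U: "openin (zariski X) U \<and> U \<subseteq> V"
  have "morphism (induced X V) X (\<lambda>x. x)"
    using morphism_inclusion[OF X] openin_subset[OF V] by blast
  from morphism_openin[OF this, of U] U have "openin (zariski (induced X V)) {x \<in> V. x \<in> U}" by simp
  moreover have "{x \<in> V. x \<in> U} = U" using U by auto
  ultimately show "openin (zariski (induced X V)) U" by simp
qed

lemma regular_induced_open:
  assumes "U \<subseteq> V" shows "regular (induced X V) U = regular X U"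
proof (intro Set.set_eqI iffI)
  fix f assume f: "f \<in> regular X U"
  have "morphism (induced X V) X (\<lambda>x. x)"
    using morphism_inclusion[OF X] openin_subset[OF V] by blast
  from morphism_regular[OF this f] have "f \<in> regular (induced X V) {x \<in> V. x \<in> U}" by simp
  also have "{x \<in> V. x \<in> U} = U" using assms by auto
  finally show "f \<in> regular (induced X V) U" .
next
  fix f assume f: "f \<in> regular (induced X V) U"
  have dom: "\<And>D f. (D, f) \<in> pulled_back V (\<lambda>x. x) X \<Longrightarrow> D \<subseteq> V" by (rule pulled_back_dom)
  have U: "openin (zariski X) U"
    using openin_induced_open regular_openin[OF swf_induced f] by blast
  show "f \<in> regular X U"
  proof (rule regular_glue[OF X U])
    fix x assume x: "x \<in> U"
    obtain D g h where 1: "(D, g) \<in> generated_algebra V (pulled_back V (\<lambda>x. x) X)"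
      "(D, h) \<in> generated_algebra V (pulled_back V (\<lambda>x. x) X)"
      "x \<in> D" "h x \<noteq> 0" "\<And>y. y \<in> D \<Longrightarrow> h y \<noteq> 0 \<Longrightarrow> y \<in> U \<and> f y = g y / h y"
      by (rule initial_space_regularD[OF _ f[unfolded induced_def] x]) (erule dom, rule that)
    let ?E = "{y\<in>D. h y \<noteq> 0}"
    have "(\<lambda>y. 1 / h y) \<in> regular X ?E" "g \<in> regular X D"
      using generated_algebra_induced_open 1 regular_inverse[OF X] by blast+
    then have "(\<lambda>y. g y * (1 / h y)) \<in> regular X (D \<inter> ?E)"
      by (intro regular_Int_mult[OF X])
    moreover have "D \<inter> ?E = ?E" by auto
    ultimately have "(\<lambda>y. g y * (1 / h y)) \<in> regular X ?E" by simp
    then show "\<exists>W. x \<in> W \<and> W \<subseteq> U \<and> (\<exists>g\<in>regular X W. \<forall>y\<in>W. f y = g y)"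
      using 1 by (intro exI[of _ ?E]) auto
  qed
qed

end

lemma morphism_restrict:
  assumes X: "space_with_functions X" and V: "V \<subseteq> points X" and f: "morphism X Y f"
  shows "morphism (induced X V) Y f"
  using morphism_compose[OF morphism_inclusion[OF X V] f] .

lemma morphism_local:
  assumes X: "space_with_functions X"
    and loc: "\<And>x. x \<in> points X \<Longrightarrow> \<exists>V. openin (zariski X) V \<and> x \<in> V \<and> morphism (induced X V) Y f"
  shows "morphism X Y f"
proof (rule morphismI)
  show "f x \<in> points Y" if "x \<in> points X" for x
    using loc[OF that] morphism_points by fastforce
  show op: "openin (zariski X) {x \<in> points X. f x \<in> W}" if "openin (zariski Y) W" for W
  proof (subst openin_subopen, intro ballI)
    fix x assume x: "x \<in> {x \<in> points X. f x \<in> W}"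
    then obtain V where V: "openin (zariski X) V" "x \<in> V" "morphism (induced X V) Y f" using loc by blast
    have "openin (zariski X) {x \<in> V. f x \<in> W}"
      using morphism_openin[OF V(3) that] openin_induced_open[OF X V(1)] by simp
    with x V openin_subset[OF V(1)]
    show "\<exists>T. openin (zariski X) T \<and> x \<in> T \<and> T \<subseteq> {x \<in> points X. f x \<in> W}"
      by (intro exI[of _ "{x \<in> V. f x \<in> W}"]) auto
  qed
  show "(\<lambda>x. g (f x)) \<in> regular X {x \<in> points X. f x \<in> W}" if g: "g \<in> regular Y W" for g W
  proof -
    have "openin (zariski X) {x \<in> points X. f x \<in> W}"
    proof (subst openin_subopen, intro ballI)
      fix x assume x: "x \<in> {x \<in> points X. f x \<in> W}"
      then obtain V where V: "openin (zariski X) V" "x \<in> V" "morphism (induced X V) Y f" using loc by blast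
      have "openin (zariski X) {x \<in> V. f x \<in> W}"
        using regular_openin[OF swf_induced morphism_regular[OF V(3) g]]
          openin_induced_open[OF X V(1)] by simp
      with x V openin_subset[OF V(1)]
      show "\<exists>T. openin (zariski X) T \<and> x \<in> T \<and> T \<subseteq> {x \<in> points X. f x \<in> W}"
        by (intro exI[of _ "{x \<in> V. f x \<in> W}"]) auto
    qed
    then show ?thesis
    proof (rule regular_local[OF X])
      fix x assume x: "x \<in> {x \<in> points X. f x \<in> W}"
      then obtain V where V: "openin (zariski X) V" "x \<in> V" "morphism (induced X V) Y f" using loc by blast
      have "(\<lambda>x. g (f x)) \<in> regular X {x \<in> V. f x \<in> W}"
        using morphism_regular[OF V(3) g] regular_induced_open[OF X V(1), of "{x \<in> V. f x \<in> W}"] by auto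
      with x V show "\<exists>V. x \<in> V \<and> (\<lambda>x. g (f x)) \<in> regular X V" by (intro exI[of _ "{x \<in> V. f x \<in> W}"]) auto
    qed
  qed
qed

lemma morphism_pulled_back_iff:
  assumes Z: "space_with_functions Z" and Y: "space_with_functions Y" and F: "F \<in> points Z \<rightarrow> S"
    and p: "p \<in> S \<rightarrow> points Y"
  shows "(\<forall>(D, g)\<in>pulled_back S p Y. (\<lambda>z. g (F z)) \<in> regular Z {z\<in>points Z. F z \<in> D}) \<longleftrightarrow>
    morphism Z Y (\<lambda>z. p (F z))" (is "?A \<longleftrightarrow> ?B")
proof -
  have e: "{z\<in>points Z. F z \<in> {x\<in>S. p x \<in> U}} = {z\<in>points Z. p (F z) \<in> U}" for U using F by auto
  have A: "?A \<longleftrightarrow> (\<forall>U. \<forall>g\<in>regular Y U. (\<lambda>z. g (p (F z))) \<in> regular Z {z\<in>points Z. p (F z) \<in> U})"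
    unfolding pulled_back_ball e ..
  show ?thesis unfolding A
  proof
    assume A: "\<forall>U. \<forall>g\<in>regular Y U. (\<lambda>z. g (p (F z))) \<in> regular Z {z\<in>points Z. p (F z) \<in> U}"
    show ?B
    proof (rule morphismI)
      show "p (F x) \<in> points Y" if "x \<in> points Z" for x using F p that by auto
      show "openin (zariski Z) {x \<in> points Z. p (F x) \<in> U}" if "openin (zariski Y) U" for U
        using A regular_const[OF Y that, of 1] regular_openin[OF Z] by blast
    qed (use A in blast)
  qed (blast dest: morphism_regular)
qed

lemma swf_fibre_space: "space_with_functions (fibre_space X Y S)"
  unfolding fibre_space_def by (rule swf_initial_space) (auto dest: pulled_back_dom)

lemma points_fibre_space [simp]: "points (fibre_space X Y S) = S"
  unfolding fibre_space_def zariski_initial_space by (rule topspace_initial) (auto dest: pulled_back_dom)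

lemma morphism_fibre_space_iff:
  assumes Z: "space_with_functions Z" and X: "space_with_functions X" and Y: "space_with_functions Y"
    and S: "S \<subseteq> points X \<times> points Y"
  shows "morphism Z (fibre_space X Y S) F \<longleftrightarrow> F \<in> points Z \<rightarrow> S \<and>
    morphism Z X (\<lambda>z. fst (F z)) \<and> morphism Z Y (\<lambda>z. snd (F z))"
proof -
  have dom: "D \<subseteq> S" if "(D, f) \<in> pulled_back S fst X \<union> pulled_back S snd Y" for D f
    using that by (auto dest: pulled_back_dom)
  have "morphism Z (fibre_space X Y S) F \<longleftrightarrow> F \<in> points Z \<rightarrow> S \<and>
    (\<forall>(D, g)\<in>pulled_back S fst X \<union> pulled_back S snd Y.
      (\<lambda>z. g (F z)) \<in> regular Z {z\<in>points Z. F z \<in> D})"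
    unfolding fibre_space_def by (rule morphism_initial_space_iff[OF dom Z])
  also have "\<dots> \<longleftrightarrow> F \<in> points Z \<rightarrow> S \<and>
    morphism Z X (\<lambda>z. fst (F z)) \<and> morphism Z Y (\<lambda>z. snd (F z))"
  proof (rule conj_cong[OF refl])
    assume F: "F \<in> points Z \<rightarrow> S"
    have "fst \<in> S \<rightarrow> points X" "snd \<in> S \<rightarrow> points Y" using S by auto
    from morphism_pulled_back_iff[OF Z X F this(1)] morphism_pulled_back_iff[OF Z Y F this(2)]
    show "(\<forall>(D, g)\<in>pulled_back S fst X \<union> pulled_back S snd Y.
      (\<lambda>z. g (F z)) \<in> regular Z {z\<in>points Z. F z \<in> D}) \<longleftrightarrow>
      morphism Z X (\<lambda>z. fst (F z)) \<and> morphism Z Y (\<lambda>z. snd (F z))"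
      unfolding ball_Un by simp
  qed
  finally show ?thesis .
qed

lemma swf_product_space: "space_with_functions (product_space X Y)"
  unfolding product_space_def by (rule swf_fibre_space)

lemma points_product_space [simp]: "points (product_space X Y) = points X \<times> points Y"
  unfolding product_space_def by simp

lemma morphism_product_space_iff:
  assumes "space_with_functions Z" "space_with_functions X" "space_with_functions Y"
  shows "morphism Z (product_space X Y) F \<longleftrightarrow>
    morphism Z X (\<lambda>z. fst (F z)) \<and> morphism Z Y (\<lambda>z. snd (F z))"
  unfolding product_space_def morphism_fibre_space_iff[OF assms order_refl]
  by (auto simp: mem_Times_iff dest: morphism_points)

lemma morphism_fst_snd:
  assumes "space_with_functions X" "space_with_functions Y" "S \<subseteq> points X \<times> points Y"
  shows "morphism (fibre_space X Y S) X fst" "morphism (fibre_space X Y S) Y snd"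
proof -
  have "morphism (fibre_space X Y S) (fibre_space X Y S) (\<lambda>x. x)"
    by (rule morphism_id[OF swf_fibre_space])
  then show "morphism (fibre_space X Y S) X fst" "morphism (fibre_space X Y S) Y snd"
    unfolding morphism_fibre_space_iff[OF swf_fibre_space assms] by simp_all
qed

lemma swf_affine_line: "space_with_functions affine_line"
  unfolding affine_line_def by (rule swf_initial_space) auto

lemma points_affine_line [simp]: "points affine_line = UNIV"
  unfolding affine_line_def zariski_initial_space by (rule topspace_initial) auto

lemma morphism_affine_line_iff:
  assumes Z: "space_with_functions Z"
  shows "morphism Z affine_line f \<longleftrightarrow> f \<in> regular Z (points Z)"
proof -
  have "morphism Z affine_line f \<longleftrightarrow> f \<in> points Z \<rightarrow> UNIV \<and>
    (\<forall>(D, g)\<in>{(UNIV, \<lambda>z. z)}. (\<lambda>z. g (f z)) \<in> regular Z {z\<in>points Z. f z \<in> D})"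
    unfolding affine_line_def by (rule morphism_initial_space_iff[OF _ Z]) auto
  then show ?thesis by simp
qed

section \<open>Units\<close>

text \<open>Invertibility of the germ at \<open>x\<close>. Leaving the neighbourhood existential
  lets such germs be multiplied, divided and composed without tracking domains;
  \<open>unit_at_regularI\<close> returns to functions on an open set.\<close>

definition unit_at :: "'a fspace \<Rightarrow> 'a \<Rightarrow> ('a \<Rightarrow> complex) \<Rightarrow> bool" where
  "unit_at X x f \<longleftrightarrow> (\<exists>V. x \<in> V \<and> f \<in> regular X V \<and> (\<forall>y\<in>V. f y \<noteq> 0))"

context
  fixes X :: "'a fspace"
  assumes X: "space_with_functions X"
begin

lemma unit_atI:
  assumes f: "f \<in> regular X V" and x: "x \<in> V" "f x \<noteq> 0" shows "unit_at X x f"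
proof -
  have "f \<in> regular X {y\<in>V. f y \<noteq> 0}"
    by (rule regular_subset[OF X f regular_nonzero_openin[OF X f]]) auto
  with x show ?thesis unfolding unit_at_def by (intro exI[of _ "{y\<in>V. f y \<noteq> 0}"]) simp
qed

lemma unit_atE:
  assumes "unit_at X x f"
  obtains V where "openin (zariski X) V" "x \<in> V" "f \<in> regular X V" "\<forall>y\<in>V. f y \<noteq> 0"
  using assms regular_openin[OF X] unfolding unit_at_def by blast

lemma unit_at_cong:
  assumes f: "unit_at X x f" and U: "openin (zariski X) U" "x \<in> U" and eq: "\<And>z. z \<in> U \<Longrightarrow> f z = g z"
  shows "unit_at X x g"
proof -
  obtain V where V: "openin (zariski X) V" "x \<in> V" "f \<in> regular X V" "\<forall>y\<in>V. f y \<noteq> 0"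
    by (rule unit_atE[OF f])
  have "f \<in> regular X (V \<inter> U)" using regular_subset[OF X V(3)] V U by auto
  then have "g \<in> regular X (V \<inter> U)" by (rule regular_cong[OF X]) (use eq in auto)
  then show ?thesis by (rule unit_atI) (use V U eq in auto)
qed

lemma unit_at_point: "unit_at X x f \<Longrightarrow> x \<in> points X"
  by (erule unit_atE) (use openin_subset in blast)

lemma unit_at_const: "x \<in> points X \<Longrightarrow> c \<noteq> 0 \<Longrightarrow> unit_at X x (\<lambda>_. c)"
  by (rule unit_atI[OF regular_const[OF X openin_topspace]])

lemma unit_at_mult:
  assumes "unit_at X x f" "unit_at X x g" shows "unit_at X x (\<lambda>z. f z * g z)"
proof -
  obtain V where V: "openin (zariski X) V" "x \<in> V" "f \<in> regular X V" "\<forall>y\<in>V. f y \<noteq> 0"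
    by (rule unit_atE[OF assms(1)])
  obtain W where W: "openin (zariski X) W" "x \<in> W" "g \<in> regular X W" "\<forall>y\<in>W. g y \<noteq> 0"
    by (rule unit_atE[OF assms(2)])
  show ?thesis by (rule unit_atI[OF regular_Int_mult(2)[OF X V(3) W(3)]]) (use V W in auto)
qed

lemma unit_at_inverse:
  assumes "unit_at X x f" shows "unit_at X x (\<lambda>z. 1 / f z)"
proof -
  obtain V where V: "openin (zariski X) V" "x \<in> V" "f \<in> regular X V" "\<forall>y\<in>V. f y \<noteq> 0"
    by (rule unit_atE[OF assms(1)])
  show ?thesis by (rule unit_atI[OF regular_inverse[OF X V(3)]]) (use V in auto)
qed

lemma unit_at_divide: "unit_at X x f \<Longrightarrow> unit_at X x g \<Longrightarrow> unit_at X x (\<lambda>z. f z / g z)"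
  using unit_at_mult[OF _ unit_at_inverse, of x f g] by simp

lemma unit_at_power:
  assumes f: "unit_at X x f" shows "unit_at X x (\<lambda>z. f z ^ n)"
  by (induction n) (auto intro: unit_at_mult[OF f] unit_at_const unit_at_point[OF f])

lemma unit_at_power_int:
  assumes f: "unit_at X x f" shows "unit_at X x (\<lambda>z. f z powi n)"
  using unit_at_power[OF f, of "nat n"] unit_at_inverse[OF unit_at_power[OF f, of "nat (- n)"]]
  by (cases "n \<ge> 0") (simp_all add: power_int_def inverse_eq_divide power_divide)

lemma unit_at_prod:
  fixes r :: nat
  assumes "x \<in> points X" "\<And>i. i < r \<Longrightarrow> unit_at X x (f i)"
  shows "unit_at X x (\<lambda>z. \<Prod>i<r. f i z)"
  using assms(2) by (induction r) (auto intro!: unit_at_mult unit_at_const assms(1))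

lemma unit_at_compose:
  assumes Z: "space_with_functions Z" and F: "morphism Z X F" and f: "unit_at X (F z) f" and z: "z \<in> points Z"
  shows "unit_at Z z (\<lambda>w. f (F w))"
proof -
  obtain V where V: "F z \<in> V" "f \<in> regular X V" "\<forall>y\<in>V. f y \<noteq> 0"
    by (rule unit_atE[OF f])
  show ?thesis unfolding unit_at_def
    using morphism_regular[OF F V(2)] V z by (intro exI[of _ "{w \<in> points Z. F w \<in> V}"]) auto
qed

lemma unit_at_regularI:
  assumes "openin (zariski X) U" "\<And>x. x \<in> U \<Longrightarrow> unit_at X x f" shows "f \<in> regular X U"
  using assms unfolding unit_at_def by (intro regular_local[OF X]) blast+

end

text \<open>
  A gauge describes a section of the quotient of the sheaf of all nowhere vanishing functions by the
  subsheaf of regular ones: \<open>d x\<close> represents it near \<open>x\<close>. Every bundle arises from a gauge, and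
  the bundle is trivial if and only if the gauge is principal.
\<close>

definition gauge_on :: "'a fspace \<Rightarrow> ('a \<Rightarrow> 'a \<Rightarrow> complex) \<Rightarrow> bool" where
  "gauge_on X d \<longleftrightarrow> (\<forall>x z. d x z \<noteq> 0) \<and>
     (\<forall>x\<in>points X. \<exists>V. openin (zariski X) V \<and> x \<in> V \<and> (\<forall>y\<in>V. unit_at X y (\<lambda>z. d x z / d y z)))"

definition principal :: "'a fspace \<Rightarrow> ('a \<Rightarrow> 'a \<Rightarrow> complex) \<Rightarrow> bool" where
  "principal X d \<longleftrightarrow> (\<exists>h. (\<forall>z. h z \<noteq> 0) \<and> (\<forall>x\<in>points X. unit_at X x (\<lambda>z. h z * d x z)))"

context
  fixes X :: "'a fspace"
  assumes X: "space_with_functions X"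
begin

lemma gauge_on_mult:
  assumes "gauge_on X d" "gauge_on X d'" shows "gauge_on X (\<lambda>x z. d x z * d' x z)"
  unfolding gauge_on_def
proof (intro conjI allI ballI)
  show "d x z * d' x z \<noteq> 0" for x z using assms unfolding gauge_on_def by simp
  fix x assume x: "x \<in> points X"
  obtain V where V: "openin (zariski X) V" "x \<in> V" "\<forall>y\<in>V. unit_at X y (\<lambda>z. d x z / d y z)"
    using assms(1) x unfolding gauge_on_def by blast
  obtain W where W: "openin (zariski X) W" "x \<in> W" "\<forall>y\<in>W. unit_at X y (\<lambda>z. d' x z / d' y z)"
    using assms(2) x unfolding gauge_on_def by blast
  have "unit_at X y (\<lambda>z. d x z * d' x z / (d y z * d' y z))" if "y \<in> V \<inter> W" for y
  proof -
    have "unit_at X y (\<lambda>z. (d x z / d y z) * (d' x z / d' y z))"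
      by (rule unit_at_mult[OF X]) (use V W that in auto)
    then show ?thesis by simp
  qed
  then show "\<exists>V. openin (zariski X) V \<and> x \<in> V \<and> (\<forall>y\<in>V. unit_at X y (\<lambda>z. d x z * d' x z / (d y z * d' y z)))"
    using V W by (intro exI[of _ "V \<inter> W"]) auto
qed

lemma gauge_on_one: "gauge_on X (\<lambda>_ _. 1)"
  unfolding gauge_on_def using unit_at_const[OF X, of _ 1]
  by (auto intro!: exI[of _ "points X"])

lemma gauge_on_inverse:
  assumes "gauge_on X d" shows "gauge_on X (\<lambda>x z. 1 / d x z)"
  unfolding gauge_on_def
proof (intro conjI allI ballI)
  show "1 / d x z \<noteq> 0" for x z using assms unfolding gauge_on_def by simp
  fix x assume x: "x \<in> points X"
  obtain V where V: "openin (zariski X) V" "x \<in> V" "\<forall>y\<in>V. unit_at X y (\<lambda>z. d x z / d y z)"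
    using assms(1) x unfolding gauge_on_def by blast
  have "unit_at X y (\<lambda>z. 1 / d x z / (1 / d y z))" if "y \<in> V" for y
    using unit_at_inverse[OF X V(3)[rule_format, OF that]] by simp
  then show "\<exists>V. openin (zariski X) V \<and> x \<in> V \<and> (\<forall>y\<in>V. unit_at X y (\<lambda>z. 1 / d x z / (1 / d y z)))"
    using V by blast
qed

lemma principal_mult:
  assumes "principal X d" "principal X d'" shows "principal X (\<lambda>x z. d x z * d' x z)"
proof -
  obtain h h' where h: "\<forall>z. h z \<noteq> 0" "\<forall>x\<in>points X. unit_at X x (\<lambda>z. h z * d x z)"
    and h': "\<forall>z. h' z \<noteq> 0" "\<forall>x\<in>points X. unit_at X x (\<lambda>z. h' z * d' x z)"
    using assms unfolding principal_def by blast
  have "unit_at X x (\<lambda>z. h z * h' z * (d x z * d' x z))" if "x \<in> points X" for x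
    using unit_at_mult[OF X h(2)[rule_format, OF that] h'(2)[rule_format, OF that]] by (simp add: mult_ac)
  with h h' show ?thesis unfolding principal_def by (intro exI[of _ "\<lambda>z. h z * h' z"]) auto
qed

lemma principal_inverse:
  assumes "principal X d" shows "principal X (\<lambda>x z. 1 / d x z)"
proof -
  obtain h where h: "\<forall>z. h z \<noteq> 0" "\<forall>x\<in>points X. unit_at X x (\<lambda>z. h z * d x z)"
    using assms unfolding principal_def by blast
  have "unit_at X x (\<lambda>z. (1 / h z) * (1 / d x z))" if "x \<in> points X" for x
    using unit_at_inverse[OF X h(2)[rule_format, OF that]] by simp
  with h show ?thesis unfolding principal_def by (intro exI[of _ "\<lambda>z. 1 / h z"]) auto
qed

lemma principal_quotient_refl: "gauge_on X d \<Longrightarrow> principal X (\<lambda>x z. d x z / d x z)"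
  unfolding principal_def gauge_on_def
  by (intro exI[of _ "\<lambda>_. 1"]) (auto intro: unit_at_const[OF X])

end

section \<open>Line bundles with a set-theoretic frame\<close>

text \<open>
  The frame \<open>e\<close> picks an arbitrary nonzero vector in each fibre; \<open>k\<close> is the coefficient of a vector
  with respect to it, and \<open>\<lambda>l. k l * d x (bundle_proj L l)\<close> is a local trivialisation near \<open>x\<close>.
\<close>

locale framed =
  fixes X :: "'a fspace" and L :: "('a, 'l) line_bundle" and e :: "'a \<Rightarrow> 'l"
    and d :: "'a \<Rightarrow> 'a \<Rightarrow> complex" and k :: "'l \<Rightarrow> complex"
  assumes base: "space_with_functions X"
    and total: "space_with_functions (bundle_space L)"
    and proj: "morphism (bundle_space L) X (bundle_proj L)"
    and scalar: "l \<in> points (bundle_space L) \<Longrightarrow> scalar L c l \<in> points (bundle_space L)"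
      "l \<in> points (bundle_space L) \<Longrightarrow> bundle_proj L (scalar L c l) = bundle_proj L l"
    and frame: "x \<in> points X \<Longrightarrow> e x \<in> points (bundle_space L)" "x \<in> points X \<Longrightarrow> bundle_proj L (e x) = x"
    and coeff: "l \<in> points (bundle_space L) \<Longrightarrow> scalar L (k l) (e (bundle_proj L l)) = l"
    and coeff_frame: "x \<in> points X \<Longrightarrow> k (scalar L c (e x)) = c"
    and scalar_frame: "x \<in> points X \<Longrightarrow> scalar L a (scalar L c (e x)) = scalar L (a * c) (e x)"
    and nonzero: "d x z \<noteq> 0"
    and chart: "x \<in> points X \<Longrightarrow> \<exists>V. openin (zariski X) V \<and> x \<in> V \<and>
      (\<lambda>l. k l * d x (bundle_proj L l)) \<in> regular (bundle_space L) {l \<in> points (bundle_space L). bundle_proj L l \<in> V} \<and>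
      morphism (product_space (induced X V) affine_line) (bundle_space L) (\<lambda>p. scalar L (snd p / d x (fst p)) (e (fst p)))"
begin

abbreviation "E \<equiv> points (bundle_space L)"
abbreviation "\<pi> \<equiv> bundle_proj L"

lemma proj_point: "l \<in> E \<Longrightarrow> \<pi> l \<in> points X"
  by (rule morphism_points[OF proj])

lemma scalar_scalar: "l \<in> E \<Longrightarrow> scalar L a (scalar L c l) = scalar L (a * c) l"
proof -
  assume l: "l \<in> E"
  have "scalar L a (scalar L c (scalar L (k l) (e (\<pi> l)))) = scalar L (a * c) (scalar L (k l) (e (\<pi> l)))"
    by (simp add: scalar_frame[OF proj_point[OF l]] mult_ac)
  then show "scalar L a (scalar L c l) = scalar L (a * c) l" by (simp add: coeff[OF l])
qed

lemma coeff_scalar: "l \<in> E \<Longrightarrow> k (scalar L c l) = c * k l"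
  using scalar_frame[OF proj_point] coeff coeff_frame[OF proj_point] by metis

lemma vector_eqI: "l \<in> E \<Longrightarrow> m \<in> E \<Longrightarrow> \<pi> l = \<pi> m \<Longrightarrow> k l = k m \<Longrightarrow> l = m"
  using coeff by metis

text \<open>That the scalar 1 acts as the identity is not demanded of a line bundle. It follows
  because \<open>e x\<close> is some multiple of itself and multiples of the frame compose.\<close>

lemma coeff_e: "x \<in> points X \<Longrightarrow> k (e x) = 1"
proof -
  assume x: "x \<in> points X"
  have "scalar L (k (e x)) (e x) = e x" using coeff[OF frame(1)[OF x]] frame(2)[OF x] by simp
  then have "scalar L 1 (e x) = e x" using scalar_frame[OF x, of 1 "k (e x)"] by simp
  then show "k (e x) = 1" using coeff_frame[OF x, of 1] by simp
qed

lemma nonzero_vectors: "nonzero_vectors L = {l \<in> E. k l \<noteq> 0}"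
proof -
  have "l = scalar L 0 l \<longleftrightarrow> k l = 0" if "l \<in> E" for l
    using that vector_eqI[of l "scalar L 0 l"] coeff_scalar[of l 0] scalar[of l 0] by auto
  then show ?thesis unfolding nonzero_vectors_def by auto
qed

text \<open>Putting the fibre coordinate equal to 1 in the inverse chart produces the section
  \<open>e z / d x z\<close>. It is a morphism although \<open>e\<close> and \<open>d\<close>
  separately are arbitrary functions.\<close>

lemma local_section:
  assumes x: "x \<in> points X"
  obtains V where "openin (zariski X) V" "x \<in> V"
    "(\<lambda>l. k l * d x (\<pi> l)) \<in> regular (bundle_space L) {l \<in> E. \<pi> l \<in> V}"
    "morphism (product_space (induced X V) affine_line) (bundle_space L) (\<lambda>p. scalar L (snd p / d x (fst p)) (e (fst p)))"
    "morphism (induced X V) (bundle_space L) (\<lambda>z. scalar L (1 / d x z) (e z))"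
proof -
  obtain V where V: "openin (zariski X) V" "x \<in> V"
    "(\<lambda>l. k l * d x (\<pi> l)) \<in> regular (bundle_space L) {l \<in> E. \<pi> l \<in> V}"
    "morphism (product_space (induced X V) affine_line) (bundle_space L) (\<lambda>p. scalar L (snd p / d x (fst p)) (e (fst p)))"
    using chart[OF x] by (elim exE conjE) (rule that)
  have "morphism (induced X V) (product_space (induced X V) affine_line) (\<lambda>z. (z, 1))"
    unfolding morphism_product_space_iff[OF swf_induced swf_induced swf_affine_line]
      fst_conv snd_conv morphism_affine_line_iff[OF swf_induced]
    by (intro conjI morphism_id swf_induced regular_const openin_topspace)
  from morphism_compose[OF this V(4)]
  have "morphism (induced X V) (bundle_space L) (\<lambda>z. scalar L (1 / d x z) (e z))" by simp
  with V show thesis by (rule that)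
qed

text \<open>Evaluation along a local section is the passage from regular functions on the total
  space to regular functions on the base, and thereby from the charts of a bundle to its
  gauge.\<close>

lemma regular_along_section:
  assumes x: "x \<in> points X"
  obtains V where "openin (zariski X) V" "x \<in> V"
    "morphism (induced X V) (bundle_space L) (\<lambda>z. scalar L (1 / d x z) (e z))"
    "\<forall>g W. g \<in> regular (bundle_space L) {l \<in> E. \<pi> l \<in> W} \<longrightarrow>
      (\<lambda>z. g (scalar L (1 / d x z) (e z))) \<in> regular X (V \<inter> W)"
proof -
  obtain V where V: "openin (zariski X) V" "x \<in> V"
    "morphism (induced X V) (bundle_space L) (\<lambda>z. scalar L (1 / d x z) (e z))"
    by (rule local_section[OF x])
  have "(\<lambda>z. g (scalar L (1 / d x z) (e z))) \<in> regular X (V \<inter> W)"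
    if g: "g \<in> regular (bundle_space L) {l \<in> E. \<pi> l \<in> W}" for g W
  proof -
    have "{z \<in> V. scalar L (1 / d x z) (e z) \<in> {l \<in> E. \<pi> l \<in> W}} = V \<inter> W"
      using openin_subset[OF V(1)] scalar frame by auto
    with morphism_regular[OF V(3) g] have "(\<lambda>z. g (scalar L (1 / d x z) (e z))) \<in> regular (induced X V) (V \<inter> W)"
      by simp
    then show ?thesis using regular_induced_open[OF base V(1), of "V \<inter> W"] by simp
  qed
  with V show thesis by (intro that allI impI)
qed

text \<open>The chart at \<open>y\<close>, evaluated along the section that belongs to
  \<open>x\<close>, is \<open>d y / d x\<close>. So this quotient is regular and, having no zeros, a
  unit; its inverse is what the gauge condition asks for.\<close>

lemma gauge: "gauge_on X d"
  unfolding gauge_on_def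
proof (intro conjI allI ballI)
  show "d x z \<noteq> 0" for x z by (rule nonzero)
  fix x assume x: "x \<in> points X"
  obtain V where V: "openin (zariski X) V" "x \<in> V"
    "\<forall>g W. g \<in> regular (bundle_space L) {l \<in> E. \<pi> l \<in> W} \<longrightarrow>
      (\<lambda>z. g (scalar L (1 / d x z) (e z))) \<in> regular X (V \<inter> W)"
    by (rule regular_along_section[OF x])
  have "unit_at X y (\<lambda>z. d x z / d y z)" if y: "y \<in> V" for y
  proof -
    have yX: "y \<in> points X" using y openin_subset[OF V(1)] by auto
    obtain W where W: "openin (zariski X) W" "y \<in> W"
      "(\<lambda>l. k l * d y (\<pi> l)) \<in> regular (bundle_space L) {l \<in> E. \<pi> l \<in> W}"
      by (rule local_section[OF yX])
    have "(\<lambda>z. d y z / d x z) \<in> regular X (V \<inter> W)"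
      by (rule regular_cong[OF base V(3)[rule_format, OF W(3)]])
         (use openin_subset[OF V(1)] coeff_frame scalar frame in auto)
    then have "unit_at X y (\<lambda>z. d y z / d x z)"
      by (rule unit_atI[OF base]) (use y W nonzero in auto)
    from unit_at_inverse[OF base this] show ?thesis by simp
  qed
  with V show "\<exists>V. openin (zariski X) V \<and> x \<in> V \<and> (\<forall>y\<in>V. unit_at X y (\<lambda>z. d x z / d y z))" by blast
qed

text \<open>Near a point \<open>z\<close> the map factors through the inverse chart at the base
  point of \<open>F z\<close>; its two components are the projection and the coefficient corrected
  by \<open>d\<close>. Isomorphisms, tensor products and lifts are shown to be morphisms in this
  way, since their coefficients alone are in general not regular.\<close>

lemma morphism_into:
  assumes Z: "space_with_functions Z" and F: "\<And>z. z \<in> points Z \<Longrightarrow> F z \<in> E"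
    and p: "morphism Z X (\<lambda>z. \<pi> (F z))"
    and loc: "\<And>z. z \<in> points Z \<Longrightarrow> \<exists>N. z \<in> N \<and> (\<lambda>w. k (F w) * d (\<pi> (F z)) (\<pi> (F w))) \<in> regular Z N"
  shows "morphism Z (bundle_space L) F"
proof (rule morphism_local[OF Z])
  fix z assume z: "z \<in> points Z"
  let ?x = "\<pi> (F z)"
  have x: "?x \<in> points X" by (rule morphism_points[OF p z])
  obtain V where V: "openin (zariski X) V" "?x \<in> V"
    "morphism (product_space (induced X V) affine_line) (bundle_space L) (\<lambda>p. scalar L (snd p / d ?x (fst p)) (e (fst p)))"
    by (rule local_section[OF x])
  obtain O1 where O1: "z \<in> O1" "(\<lambda>w. k (F w) * d ?x (\<pi> (F w))) \<in> regular Z O1" using loc[OF z] by blast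
  define O' where "O' = O1 \<inter> {w \<in> points Z. \<pi> (F w) \<in> V}"
  have O': "openin (zariski Z) O'" "z \<in> O'" "O' \<subseteq> points Z" "\<And>w. w \<in> O' \<Longrightarrow> \<pi> (F w) \<in> V"
    using morphism_openin[OF p V(1)] regular_openin[OF Z O1(2)] O1(1) z V(2) unfolding O'_def by auto
  let ?G = "\<lambda>w. (\<pi> (F w), k (F w) * d ?x (\<pi> (F w)))"
  have "morphism (induced Z O') (product_space (induced X V) affine_line) ?G"
    unfolding morphism_product_space_iff[OF swf_induced swf_induced swf_affine_line]
      fst_conv snd_conv morphism_affine_line_iff[OF swf_induced]
      morphism_induced_iff[OF swf_induced base openin_subset[OF V(1)]]
  proof (intro conjI)
    show "(\<lambda>z. \<pi> (F z)) \<in> points (induced Z O') \<rightarrow> V" using O' by simp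
    show "morphism (induced Z O') X (\<lambda>z. \<pi> (F z))" by (rule morphism_restrict[OF Z O'(3) p])
    have "(\<lambda>w. k (F w) * d ?x (\<pi> (F w))) \<in> regular Z O'"
      by (rule regular_subset[OF Z O1(2) O'(1)]) (auto simp: O'_def)
    then show "(\<lambda>w. k (F w) * d ?x (\<pi> (F w))) \<in> regular (induced Z O') (points (induced Z O'))"
      using regular_induced_open[OF Z O'(1), of O'] by simp
  qed
  from morphism_compose[OF this V(3)]
  have "morphism (induced Z O') (bundle_space L) F"
  proof (rule morphism_cong[OF swf_induced])
    fix w assume "w \<in> points (induced Z O')"
    then have "F w \<in> E" using F O'(3) by auto
    then show "scalar L (snd (?G w) / d ?x (fst (?G w))) (e (fst (?G w))) = F w"
      using coeff[of "F w"] nonzero by simp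
  qed
  with O' show "\<exists>V. openin (zariski Z) V \<and> z \<in> V \<and> morphism (induced Z V) (bundle_space L) F" by blast
qed

text \<open>The chart data of the locale contain both directions of a local trivialisation, so this
  is the converse of \<open>line_bundle_on_framed\<close> below.\<close>

lemma line_bundle: "line_bundle_on X L"
  unfolding line_bundle_on_def
proof (intro conjI allI ballI)
  show "space_with_functions (bundle_space L)" by (rule total)
  show "morphism (bundle_space L) X (bundle_proj L)" by (rule proj)
  show "scalar L c l \<in> E" "\<pi> (scalar L c l) = \<pi> l" if "l \<in> E" for c l
    using that scalar by auto
  fix x assume x: "x \<in> points X"
  obtain V where V: "openin (zariski X) V" "x \<in> V"
    "(\<lambda>l. k l * d x (\<pi> l)) \<in> regular (bundle_space L) {l \<in> E. \<pi> l \<in> V}"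
    "morphism (product_space (induced X V) affine_line) (bundle_space L) (\<lambda>p. scalar L (snd p / d x (fst p)) (e (fst p)))"
    by (rule local_section[OF x])
  have VX: "V \<subseteq> points X" by (rule openin_subset[OF V(1)])
  let ?P = "{l \<in> E. \<pi> l \<in> V}" and ?f = "\<lambda>l. (\<pi> l, k l * d x (\<pi> l))"
  have P: "openin (zariski (bundle_space L)) ?P" by (rule regular_openin[OF total V(3)])
  have "isomorphism (induced (bundle_space L) ?P) (product_space (induced X V) affine_line) ?f"
  proof (rule isomorphismI)
    show "morphism (induced (bundle_space L) ?P) (product_space (induced X V) affine_line) ?f"
      unfolding morphism_product_space_iff[OF swf_induced swf_induced swf_affine_line]
        fst_conv snd_conv morphism_affine_line_iff[OF swf_induced]
        morphism_induced_iff[OF swf_induced base VX]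
    proof (intro conjI)
      show "morphism (induced (bundle_space L) ?P) X \<pi>"
        by (rule morphism_restrict[OF total _ proj]) auto
      show "(\<lambda>l. k l * d x (\<pi> l)) \<in> regular (induced (bundle_space L) ?P) (points (induced (bundle_space L) ?P))"
        using V(3) regular_induced_open[OF total P, of ?P] by simp
    qed simp
    show "morphism (product_space (induced X V) affine_line) (induced (bundle_space L) ?P)
      (\<lambda>p. scalar L (snd p / d x (fst p)) (e (fst p)))"
      unfolding morphism_induced_iff[OF swf_product_space total openin_subset[OF P]]
      using V(4) scalar frame VX by auto
    show "space_with_functions (product_space (induced X V) affine_line)"
      by (rule swf_product_space)
    show "scalar L (snd (?f l) / d x (fst (?f l))) (e (fst (?f l))) = l" if "l \<in> points (induced (bundle_space L) ?P)" for l
      using that coeff nonzero by simp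
    show "?f (scalar L (snd p / d x (fst p)) (e (fst p))) = p" if "p \<in> points (product_space (induced X V) affine_line)" for p
      using that scalar frame VX coeff_frame nonzero by (auto simp: subset_iff)
  qed
  then show "\<exists>U \<phi>. openin (zariski X) U \<and> x \<in> U \<and>
        isomorphism (induced (bundle_space L) {l \<in> E. \<pi> l \<in> U}) (product_space (induced X U) affine_line) \<phi> \<and>
        (\<forall>l \<in> E. \<pi> l \<in> U \<longrightarrow> fst (\<phi> l) = \<pi> l \<and> (\<forall>c. \<phi> (scalar L c l) = (\<pi> l, c * snd (\<phi> l))))"
    using V(1,2) by (intro exI[of _ V] exI[of _ ?f]) (simp add: scalar coeff_scalar)
qed

text \<open>The product of \<open>k\<close> and \<open>d\<close> that forms a chart does not see the
  factor \<open>h\<close>, which need not even be continuous. The gauge itself changes to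
  \<open>h * d\<close>; this freedom will make its logarithm locally bounded.\<close>

lemma reframe:
  assumes h: "\<And>z. h z \<noteq> 0"
  shows "framed X L (\<lambda>z. scalar L (h z) (e z)) (\<lambda>x z. h z * d x z) (\<lambda>l. k l / h (\<pi> l))"
proof
  show "space_with_functions X" by (rule base)
  show "space_with_functions (bundle_space L)" by (rule total)
  show "morphism (bundle_space L) X (bundle_proj L)" by (rule proj)
  show "scalar L c l \<in> E" "\<pi> (scalar L c l) = \<pi> l" if "l \<in> E" for c l
    using that scalar by auto
  show "scalar L (h x) (e x) \<in> E" "\<pi> (scalar L (h x) (e x)) = x" if "x \<in> points X" for x
    using that scalar frame by auto
  show "scalar L (k l / h (\<pi> l)) (scalar L (h (\<pi> l)) (e (\<pi> l))) = l" if "l \<in> E" for l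
    using that scalar_frame[OF proj_point[OF that]] h coeff by simp
  show "k (scalar L c (scalar L (h x) (e x))) / h (\<pi> (scalar L c (scalar L (h x) (e x)))) = c" if "x \<in> points X" for c x
    using that h by (simp add: scalar_frame coeff_frame scalar frame)
  show "scalar L a (scalar L c (scalar L (h x) (e x))) = scalar L (a * c) (scalar L (h x) (e x))" if "x \<in> points X" for a c x
    using that by (simp add: scalar_frame mult_ac)
  show "h z * d x z \<noteq> 0" for x z using h nonzero by simp
  fix x assume x: "x \<in> points X"
  obtain V where V: "openin (zariski X) V" "x \<in> V"
    "(\<lambda>l. k l * d x (\<pi> l)) \<in> regular (bundle_space L) {l \<in> E. \<pi> l \<in> V}"
    "morphism (product_space (induced X V) affine_line) (bundle_space L) (\<lambda>p. scalar L (snd p / d x (fst p)) (e (fst p)))"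
    by (rule local_section[OF x])
  have 1: "(\<lambda>l. k l / h (\<pi> l) * (h (\<pi> l) * d x (\<pi> l))) = (\<lambda>l. k l * d x (\<pi> l))" using h by simp
  have 2: "morphism (product_space (induced X V) affine_line) (bundle_space L)
      (\<lambda>p. scalar L (snd p / (h (fst p) * d x (fst p))) (scalar L (h (fst p)) (e (fst p))))"
    by (rule morphism_cong[OF swf_product_space V(4)])
       (use openin_subset[OF V(1)] scalar_frame h in auto)
  show "\<exists>V. openin (zariski X) V \<and> x \<in> V \<and>
      (\<lambda>l. k l / h (\<pi> l) * (h (\<pi> l) * d x (\<pi> l))) \<in> regular (bundle_space L) {l \<in> E. \<pi> l \<in> V} \<and>
      morphism (product_space (induced X V) affine_line) (bundle_space L)
      (\<lambda>p. scalar L (snd p / (h (fst p) * d x (fst p))) (scalar L (h (fst p)) (e (fst p))))"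
    unfolding 1 using V(1-3) 2 by blast
qed

end

text \<open>One chart is chosen around every point. The vector \<open>e x\<close> is the one to
  which the chart at \<open>x\<close> itself gives the coordinate 1, and \<open>d x z\<close> is the
  coordinate of \<open>e z\<close> in the chart at \<open>x\<close>. As \<open>k\<close> comes from
  the chart at the foot point, homogeneity identifies \<open>k l * d x\<close> with the coordinate
  of \<open>l\<close> in the chart at \<open>x\<close>.\<close>

lemma line_bundle_on_framed:
  fixes L :: "('a, 'l) line_bundle"
  assumes X: "space_with_functions X" and L: "line_bundle_on X L"
  obtains e d k where "framed X L e d k"
proof -
  let ?E = "points (bundle_space L)" and ?\<pi> = "bundle_proj L"
  have total: "space_with_functions (bundle_space L)" and proj: "morphism (bundle_space L) X ?\<pi>"
    and sc: "\<And>c l. l \<in> ?E \<Longrightarrow> scalar L c l \<in> ?E" "\<And>c l. l \<in> ?E \<Longrightarrow> ?\<pi> (scalar L c l) = ?\<pi> l"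
    using L unfolding line_bundle_on_def by auto
  define Q where "Q x U \<phi> \<longleftrightarrow> openin (zariski X) U \<and> x \<in> U \<and>
        isomorphism (induced (bundle_space L) {l \<in> ?E. ?\<pi> l \<in> U}) (product_space (induced X U) affine_line) \<phi> \<and>
        (\<forall>l \<in> ?E. ?\<pi> l \<in> U \<longrightarrow> fst (\<phi> l) = ?\<pi> l \<and> (\<forall>c. \<phi> (scalar L c l) = (?\<pi> l, c * snd (\<phi> l))))"
    for x U \<phi>
  have "\<forall>x\<in>points X. \<exists>U \<phi>. Q x U \<phi>"
    using L unfolding line_bundle_on_def Q_def by (elim conjE)
  from bchoice[OF this] obtain V where "\<forall>x\<in>points X. \<exists>\<phi>. Q x (V x) \<phi>" by (elim exE)
  from bchoice[OF this] obtain \<phi> where Q: "\<forall>x\<in>points X. Q x (V x) (\<phi> x)" by (elim exE)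
  have V: "openin (zariski X) (V x)" "x \<in> V x"
    and iso: "isomorphism (induced (bundle_space L) {l \<in> ?E. ?\<pi> l \<in> V x}) (product_space (induced X (V x)) affine_line) (\<phi> x)"
    if "x \<in> points X" for x
    using Q[rule_format, OF that] unfolding Q_def by simp_all
  have \<phi>: "fst (\<phi> x l) = ?\<pi> l" "\<phi> x (scalar L c l) = (?\<pi> l, c * snd (\<phi> x l))"
    if "x \<in> points X" "l \<in> ?E" "?\<pi> l \<in> V x" for x l c
    using Q[rule_format, OF that(1)] that(2,3) unfolding Q_def by simp_all
  let ?P = "\<lambda>x. {l \<in> ?E. ?\<pi> l \<in> V x}"
  define \<psi> where "\<psi> x l = snd (\<phi> x l)" for x l
  have VX: "V x \<subseteq> points X" if "x \<in> points X" for x by (rule openin_subset[OF V(1)[OF that]])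
  have bij: "bij_betw (\<phi> x) (?P x) (V x \<times> UNIV)" if "x \<in> points X" for x
    using iso[OF that] unfolding isomorphism_def by simp
  have \<phi>\<psi>: "\<phi> x l = (?\<pi> l, \<psi> x l)" if "x \<in> points X" "l \<in> ?P x" for x l
    by (rule prod_eqI) (use \<phi>(1)[OF that(1)] that(2) in \<open>auto simp: \<psi>_def\<close>)
  have \<psi>sc: "\<psi> x (scalar L c l) = c * \<psi> x l" if "x \<in> points X" "l \<in> ?P x" for x l c
    using \<phi>(2)[OF that(1)] that(2) unfolding \<psi>_def by simp
  have \<psi>inj: "l = m" if "x \<in> points X" "l \<in> ?P x" "m \<in> ?P x" "?\<pi> l = ?\<pi> m" "\<psi> x l = \<psi> x m" for x l m
    by (rule inj_onD[OF bij_betw_imp_inj_on[OF bij[OF that(1)]] _ that(2,3)])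
       (simp add: \<phi>\<psi>[OF that(1,2)] \<phi>\<psi>[OF that(1,3)] that(4,5))
  have "\<exists>l\<in>?E. ?\<pi> l = x \<and> \<psi> x l = 1" if x: "x \<in> points X" for x
  proof -
    have "(x, 1) \<in> \<phi> x ` ?P x" using bij[OF x] V(2)[OF x] unfolding bij_betw_def by auto
    then obtain l where l: "l \<in> ?P x" "\<phi> x l = (x, 1)"
      by (elim imageE) (rule that, assumption, rule sym, assumption)
    with \<phi>\<psi>[OF x l(1)] show ?thesis by auto
  qed
  then obtain e where e: "\<And>x. x \<in> points X \<Longrightarrow> e x \<in> ?E" "\<And>x. x \<in> points X \<Longrightarrow> ?\<pi> (e x) = x"
    "\<And>x. x \<in> points X \<Longrightarrow> \<psi> x (e x) = 1" by metis
  have eP: "e z \<in> ?P x" if "x \<in> points X" "z \<in> V x" for x z using e VX[OF that(1)] that by auto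
  \<comment> \<open>A vanishing coordinate in the chart at \<open>x\<close> would make
    \<open>e z\<close> equal to 0 times itself, and then its coordinate in the chart at
    \<open>z\<close> would vanish as well, where it is 1.\<close>
  have \<psi>e: "\<psi> x (e z) \<noteq> 0" if x: "x \<in> points X" and z: "z \<in> V x" for x z
  proof
    assume 0: "\<psi> x (e z) = 0"
    have zX: "z \<in> points X" using VX[OF x] z by auto
    have "scalar L 0 (e z) = e z"
      by (rule \<psi>inj[OF x]) (use eP[OF x z] sc 0 \<psi>sc[OF x eP[OF x z]] in auto)
    then have "\<psi> z (e z) = 0" using \<psi>sc[OF zX eP[OF zX V(2)[OF zX]], of 0] by simp
    with e(3)[OF zX] show False by simp
  qed
  \<comment> \<open>The value 1 outside the chart domain keeps \<open>d\<close> nonzero everywhere,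
    as the locale demands of total functions.\<close>
  define d where "d x z = (if x \<in> points X \<and> z \<in> V x then \<psi> x (e z) else 1)" for x z
  define k where "k l = \<psi> (?\<pi> l) l" for l
  have pX: "?\<pi> l \<in> points X" if "l \<in> ?E" for l by (rule morphism_points[OF proj that])
  have coeff: "scalar L (k l) (e (?\<pi> l)) = l" if l: "l \<in> ?E" for l
  proof (rule \<psi>inj[OF pX[OF l]])
    show "l \<in> ?P (?\<pi> l)" using l V(2) pX by auto
    show "scalar L (k l) (e (?\<pi> l)) \<in> ?P (?\<pi> l)" using l V(2) pX e sc by auto
    show "?\<pi> (scalar L (k l) (e (?\<pi> l))) = ?\<pi> l" using l pX e sc by auto
    show "\<psi> (?\<pi> l) (scalar L (k l) (e (?\<pi> l))) = \<psi> (?\<pi> l) l"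
      using \<psi>sc[OF pX[OF l] eP[OF pX[OF l] V(2)[OF pX[OF l]]]] e(3)[OF pX[OF l]] unfolding k_def by simp
  qed
  have k\<psi>: "k l * d x (?\<pi> l) = \<psi> x l" if x: "x \<in> points X" and l: "l \<in> ?P x" for x l
    using \<psi>sc[OF x eP[OF x, of "?\<pi> l"], of "k l"] coeff[of l] l x unfolding d_def by auto
  have "framed X L e d k"
  proof
    show "space_with_functions X" by (rule X)
    show "space_with_functions (bundle_space L)" by (rule total)
    show "morphism (bundle_space L) X ?\<pi>" by (rule proj)
    show "scalar L c l \<in> ?E" "?\<pi> (scalar L c l) = ?\<pi> l" if "l \<in> ?E" for c l
      using that sc by auto
    show "e x \<in> ?E" "?\<pi> (e x) = x" if "x \<in> points X" for x using that e by auto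
    show "scalar L (k l) (e (?\<pi> l)) = l" if "l \<in> ?E" for l by (rule coeff[OF that])
    show kc: "k (scalar L c (e x)) = c" if x: "x \<in> points X" for x c
      using \<psi>sc[OF x eP[OF x V(2)[OF x]]] e x sc unfolding k_def by simp
    show "scalar L a (scalar L c (e x)) = scalar L (a * c) (e x)" if x: "x \<in> points X" for a c x
    proof (rule \<psi>inj[OF x])
      have 1: "e x \<in> ?P x" by (rule eP[OF x V(2)[OF x]])
      then have 2: "scalar L c (e x) \<in> ?P x" using sc by auto
      show "scalar L a (scalar L c (e x)) \<in> ?P x" "scalar L (a * c) (e x) \<in> ?P x"
        "?\<pi> (scalar L a (scalar L c (e x))) = ?\<pi> (scalar L (a * c) (e x))" using 1 2 sc by auto
      show "\<psi> x (scalar L a (scalar L c (e x))) = \<psi> x (scalar L (a * c) (e x))"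
        using \<psi>sc[OF x 1] \<psi>sc[OF x 2] by simp
    qed
    show "d x z \<noteq> 0" for x z using \<psi>e unfolding d_def by simp
    fix x assume x: "x \<in> points X"
    have P: "openin (zariski (bundle_space L)) (?P x)" by (rule morphism_openin[OF proj V(1)[OF x]])
    have m: "morphism (induced (bundle_space L) (?P x)) (product_space (induced X (V x)) affine_line) (\<phi> x)"
      and m': "morphism (product_space (induced X (V x)) affine_line) (induced (bundle_space L) (?P x)) (inv_into (?P x) (\<phi> x))"
      using iso[OF x] unfolding isomorphism_def by simp_all
    have "\<psi> x \<in> regular (bundle_space L) (?P x)"
      using m regular_induced_open[OF total P, of "?P x"]
      unfolding morphism_product_space_iff[OF swf_induced swf_induced swf_affine_line]
        morphism_affine_line_iff[OF swf_induced] \<psi>_def by simp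
    then have 1: "(\<lambda>l. k l * d x (?\<pi> l)) \<in> regular (bundle_space L) (?P x)"
      by (rule regular_cong[OF total]) (use k\<psi>[OF x] in auto)
    have "morphism (product_space (induced X (V x)) affine_line) (bundle_space L) (inv_into (?P x) (\<phi> x))"
      using m' unfolding morphism_induced_iff[OF swf_product_space total openin_subset[OF P]] by blast
    then have 2: "morphism (product_space (induced X (V x)) affine_line) (bundle_space L)
      (\<lambda>p. scalar L (snd p / d x (fst p)) (e (fst p)))"
    proof (rule morphism_cong[OF swf_product_space])
      fix p assume p: "p \<in> points (product_space (induced X (V x)) affine_line)"
      then have z: "fst p \<in> V x" by auto
      let ?l = "scalar L (snd p / d x (fst p)) (e (fst p))"
      have l: "?l \<in> ?P x" using sc eP[OF x z] by auto
      have "\<phi> x ?l = (fst p, snd p / d x (fst p) * \<psi> x (e (fst p)))"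
        using \<phi>(2)[OF x, of "e (fst p)"] eP[OF x z] e(2) VX[OF x] z unfolding \<psi>_def by auto
      also have "\<dots> = p" using \<psi>e[OF x z] x z unfolding d_def by simp
      finally show "inv_into (?P x) (\<phi> x) p = ?l"
        using inv_into_f_f[OF bij_betw_imp_inj_on[OF bij[OF x]] l] by simp
    qed
    show "\<exists>V. openin (zariski X) V \<and> x \<in> V \<and>
      (\<lambda>l. k l * d x (?\<pi> l)) \<in> regular (bundle_space L) {l \<in> ?E. ?\<pi> l \<in> V} \<and>
      morphism (product_space (induced X V) affine_line) (bundle_space L) (\<lambda>p. scalar L (snd p / d x (fst p)) (e (fst p)))"
      using V[OF x] 1 2 by blast
  qed
  then show thesis by (rule that)
qed

section \<open>Maps between framed bundles\<close>

text \<open>In the charts at \<open>x\<close> the map is multiplication by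
  \<open>h * d' x / d x\<close>, the unit germ of the hypothesis; \<open>h\<close> need not be
  regular by itself.\<close>

lemma frame_change_morphism:
  assumes L: "framed X L e d k" and M: "framed X M e' d' k'"
    and h: "\<And>x. x \<in> points X \<Longrightarrow> unit_at X x (\<lambda>z. h z * (d' x z / d x z))"
  shows "morphism (bundle_space L) (bundle_space M)
    (\<lambda>l. scalar M (k l * h (bundle_proj L l)) (e' (bundle_proj L l)))"
proof -
  interpret L: framed X L e d k by (rule L)
  interpret M: framed X M e' d' k' by (rule M)
  let ?F = "\<lambda>l. scalar M (k l * h (L.\<pi> l)) (e' (L.\<pi> l))"
  have F: "?F l \<in> M.E" "M.\<pi> (?F l) = L.\<pi> l" "k' (?F l) = k l * h (L.\<pi> l)" if "l \<in> L.E" for l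
    using L.proj_point[OF that] M.scalar M.frame M.coeff_frame by auto
  show ?thesis
  proof (rule M.morphism_into[OF L.total F(1)])
    show "morphism (bundle_space L) X (\<lambda>z. M.\<pi> (?F z))"
      by (rule morphism_cong[OF L.total L.proj]) (simp add: F)
    fix l assume l: "l \<in> L.E"
    let ?x = "L.\<pi> l"
    have x: "?x \<in> points X" by (rule L.proj_point[OF l])
    obtain V where V: "openin (zariski X) V" "?x \<in> V"
      "(\<lambda>l. k l * d ?x (L.\<pi> l)) \<in> regular (bundle_space L) {l \<in> L.E. L.\<pi> l \<in> V}"
      by (rule L.local_section[OF x])
    obtain W where W: "openin (zariski X) W" "?x \<in> W"
      "(\<lambda>z. h z * (d' ?x z / d ?x z)) \<in> regular X W" by (rule unit_atE[OF L.base h[OF x]])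
    have "(\<lambda>w. k w * d ?x (L.\<pi> w) * (h (L.\<pi> w) * (d' ?x (L.\<pi> w) / d ?x (L.\<pi> w)))) \<in>
      regular (bundle_space L) ({l \<in> L.E. L.\<pi> l \<in> V} \<inter> {l \<in> L.E. L.\<pi> l \<in> W})"
      by (rule regular_Int_mult(2)[OF L.total V(3) morphism_regular[OF L.proj W(3)]])
    then have "(\<lambda>w. k' (?F w) * d' (M.\<pi> (?F l)) (M.\<pi> (?F w))) \<in>
      regular (bundle_space L) ({l \<in> L.E. L.\<pi> l \<in> V} \<inter> {l \<in> L.E. L.\<pi> l \<in> W})"
      by (rule regular_cong[OF L.total]) (use F l L.nonzero in auto)
    then show "\<exists>N. l \<in> N \<and> (\<lambda>w. k' (?F w) * d' (M.\<pi> (?F l)) (M.\<pi> (?F w))) \<in> regular (bundle_space L) N"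
      using l V(2) W(2) by (intro exI conjI) auto
  qed
qed

text \<open>A fibrewise linear map sends \<open>e\<close> to \<open>h\<close> times
  \<open>e'\<close>, and in charts it is multiplication by \<open>h * d' / d\<close>. Given
  \<open>h\<close>, this defines the isomorphism, with \<open>1 / h\<close> belonging to the
  inverse; given the isomorphism, \<open>h\<close> is read off from the image of the frame and
  tested along local sections.\<close>

lemma bundles_isomorphic_iff_principal:
  assumes L: "framed X L e d k" and M: "framed X M e' d' k'"
  shows "bundles_isomorphic L M \<longleftrightarrow> principal X (\<lambda>x z. d' x z / d x z)"
proof -
  interpret L: framed X L e d k by (rule L)
  interpret M: framed X M e' d' k' by (rule M)
  show ?thesis
  proof
    assume "principal X (\<lambda>x z. d' x z / d x z)"
    then obtain h where h: "\<forall>z. h z \<noteq> 0" "\<forall>x\<in>points X. unit_at X x (\<lambda>z. h z * (d' x z / d x z))"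
      unfolding principal_def by blast
    have h': "unit_at X x (\<lambda>z. 1 / h z * (d x z / d' x z))" if "x \<in> points X" for x
      using unit_at_inverse[OF L.base h(2)[rule_format, OF that]] by simp
    let ?F = "\<lambda>l. scalar M (k l * h (L.\<pi> l)) (e' (L.\<pi> l))"
    let ?G = "\<lambda>m. scalar L (k' m * (1 / h (M.\<pi> m))) (e (M.\<pi> m))"
    have F: "?F l \<in> M.E" "M.\<pi> (?F l) = L.\<pi> l" "k' (?F l) = k l * h (L.\<pi> l)" if "l \<in> L.E" for l
      using L.proj_point[OF that] M.scalar M.frame M.coeff_frame by auto
    have G: "?G l \<in> L.E" "L.\<pi> (?G l) = M.\<pi> l" "k (?G l) = k' l * (1 / h (M.\<pi> l))" if "l \<in> M.E" for l
      using M.proj_point[OF that] L.scalar L.frame L.coeff_frame by auto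
    have "isomorphism (bundle_space L) (bundle_space M) ?F"
    proof (rule isomorphismI)
      show "morphism (bundle_space L) (bundle_space M) ?F"
        by (rule frame_change_morphism[OF L M]) (use h in blast)
      show "morphism (bundle_space M) (bundle_space L) ?G"
        by (rule frame_change_morphism[OF M L]) (use h' in blast)
      show "space_with_functions (bundle_space M)" by (rule M.total)
      show "?G (?F l) = l" if "l \<in> L.E" for l
        using F[OF that] L.coeff[OF that] h(1) by simp
      show "?F (?G l) = l" if "l \<in> M.E" for l
        using G[OF that] M.coeff[OF that] h(1) by simp
    qed
    moreover have "M.\<pi> (?F l) = L.\<pi> l \<and> (\<forall>c. ?F (scalar L c l) = scalar M c (?F l))" if "l \<in> L.E" for l
      using that F(2)[OF that] L.scalar L.coeff_scalar M.scalar_frame[OF L.proj_point[OF that]] by (simp add: mult_ac)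
    ultimately show "bundles_isomorphic L M" unfolding bundles_isomorphic_def by blast
  next
    assume "bundles_isomorphic L M"
    then obtain f where f: "isomorphism (bundle_space L) (bundle_space M) f"
      and fp: "\<And>l. l \<in> L.E \<Longrightarrow> M.\<pi> (f l) = L.\<pi> l" "\<And>l c. l \<in> L.E \<Longrightarrow> f (scalar L c l) = scalar M c (f l)"
      unfolding bundles_isomorphic_def by blast
    have fm: "morphism (bundle_space L) (bundle_space M) f" and fi: "inj_on f L.E"
      using f unfolding isomorphism_def by (auto dest: bij_betw_imp_inj_on)
    define h where "h z = (if z \<in> points X then k' (f (e z)) else 1)" for z
    have fe: "f (e z) \<in> M.E" "M.\<pi> (f (e z)) = z" if "z \<in> points X" for z
      using morphism_points[OF fm] fp L.frame that by auto
    have h0: "h z \<noteq> 0" for z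
    proof
      assume 0: "h z = 0"
      then have z: "z \<in> points X" "k' (f (e z)) = 0" unfolding h_def by (auto split: if_splits)
      \<comment> \<open>If the image of a frame vector had coefficient 0, it would coincide with the
        image of 0 times that vector, against injectivity of \<open>f\<close>.\<close>
      have "f (scalar L 0 (e z)) = f (e z)"
        using fp(2)[OF L.frame(1)[OF z(1)]] M.coeff_scalar[OF fe(1)[OF z(1)]] z fe M.scalar
        by (intro M.vector_eqI) auto
      then have "scalar L 0 (e z) = e z" using fi L.scalar L.frame z(1) unfolding inj_on_def by blast
      then show False using L.coeff_scalar[OF L.frame(1)[OF z(1)], of 0] L.coeff_e[OF z(1)] by simp
    qed
    have "unit_at X x (\<lambda>z. h z * (d' x z / d x z))" if x: "x \<in> points X" for x
    proof -
      obtain V where V: "openin (zariski X) V" "x \<in> V"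
        "\<forall>g W. g \<in> regular (bundle_space L) {l \<in> L.E. L.\<pi> l \<in> W} \<longrightarrow>
          (\<lambda>z. g (scalar L (1 / d x z) (e z))) \<in> regular X (V \<inter> W)"
        by (rule L.regular_along_section[OF x])
      obtain W where W: "openin (zariski X) W" "x \<in> W"
        "(\<lambda>l. k' l * d' x (M.\<pi> l)) \<in> regular (bundle_space M) {l \<in> M.E. M.\<pi> l \<in> W}"
        by (rule M.local_section[OF x])
      have eq: "{l \<in> L.E. f l \<in> {l \<in> M.E. M.\<pi> l \<in> W}} = {l \<in> L.E. L.\<pi> l \<in> W}"
        using morphism_points[OF fm] fp by auto
      have "(\<lambda>l. k' (f l) * d' x (M.\<pi> (f l))) \<in> regular (bundle_space L) {l \<in> L.E. L.\<pi> l \<in> W}"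
        using morphism_regular[OF fm W(3)] unfolding eq .
      from V(3)[rule_format, OF this]
      have "(\<lambda>z. h z * (d' x z / d x z)) \<in> regular X (V \<inter> W)"
      proof (rule regular_cong[OF L.base])
        fix z assume "z \<in> V \<inter> W"
        then have z: "z \<in> points X" using openin_subset[OF V(1)] by auto
        show "k' (f (scalar L (1 / d x z) (e z))) * d' x (M.\<pi> (f (scalar L (1 / d x z) (e z)))) = h z * (d' x z / d x z)"
          using z L.frame[OF z] L.scalar[OF L.frame(1)[OF z]] fp(2)[OF L.frame(1)[OF z]] M.coeff_scalar[OF fe(1)[OF z]]
            M.scalar[OF fe(1)[OF z]] fe(2)[OF z] unfolding h_def by simp
      qed
      then show ?thesis by (rule unit_atI[OF L.base]) (use V W h0 L.nonzero M.nonzero in auto)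
    qed
    with h0 show "principal X (\<lambda>x z. d' x z / d x z)" unfolding principal_def by blast
  qed
qed

text \<open>Bilinearity on one-dimensional fibres determines \<open>b\<close> by its value
  \<open>h\<close> times \<open>e''\<close> on the pair of frames, and in charts \<open>b\<close> is
  the product of the two coordinates times \<open>h * d'' / (d * d')\<close>. The condition on
  nonzero vectors is what keeps \<open>h\<close> free of zeros.\<close>

lemma is_tensor_product_iff_principal:
  assumes L: "framed X L e d k" and M: "framed X M e' d' k'" and N: "framed X N e'' d'' k''"
  shows "is_tensor_product L M N \<longleftrightarrow> principal X (\<lambda>x z. d'' x z / (d x z * d' x z))"
proof -
  interpret L: framed X L e d k by (rule L)
  interpret M: framed X M e' d' k' by (rule M)
  interpret N: framed X N e'' d'' k'' by (rule N)
  define P where "P = {(l, m). l \<in> L.E \<and> m \<in> M.E \<and> L.\<pi> l = M.\<pi> m}"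
  let ?P = "fibre_space (bundle_space L) (bundle_space M) P"
  have Psub: "P \<subseteq> L.E \<times> M.E" unfolding P_def by auto
  have swfP: "space_with_functions ?P" by (rule swf_fibre_space)
  note fs = morphism_fst_snd[OF L.total M.total Psub]
  have tp: "is_tensor_product L M N \<longleftrightarrow> (\<exists>b. morphism ?P (bundle_space N) b \<and>
        (\<forall>(l, m) \<in> P. N.\<pi> (b (l, m)) = L.\<pi> l \<and>
           (\<forall>c. b (scalar L c l, m) = scalar N c (b (l, m)) \<and>
                b (l, scalar M c m) = scalar N c (b (l, m))) \<and>
           (l \<in> nonzero_vectors L \<and> m \<in> nonzero_vectors M \<longrightarrow> b (l, m) \<in> nonzero_vectors N)))"
    unfolding is_tensor_product_def Let_def P_def by blast
  show ?thesis
  proof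
    assume "principal X (\<lambda>x z. d'' x z / (d x z * d' x z))"
    then obtain h where h: "\<forall>z. h z \<noteq> 0" "\<forall>x\<in>points X. unit_at X x (\<lambda>z. h z * (d'' x z / (d x z * d' x z)))"
      unfolding principal_def by blast
    define b where "b = (\<lambda>p. scalar N (k (fst p) * k' (snd p) * h (L.\<pi> (fst p))) (e'' (L.\<pi> (fst p))))"
    have b: "b p \<in> N.E" "N.\<pi> (b p) = L.\<pi> (fst p)" "k'' (b p) = k (fst p) * k' (snd p) * h (L.\<pi> (fst p))"
      if "p \<in> P" for p
    proof -
      have "L.\<pi> (fst p) \<in> points X" using that L.proj_point M.proj_point unfolding P_def by auto
      then show "b p \<in> N.E" "N.\<pi> (b p) = L.\<pi> (fst p)" "k'' (b p) = k (fst p) * k' (snd p) * h (L.\<pi> (fst p))"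
        using N.scalar N.frame N.coeff_frame unfolding b_def by auto
    qed
    have "morphism ?P (bundle_space N) b"
    proof (rule N.morphism_into[OF swfP])
      show "b z \<in> N.E" if "z \<in> points ?P" for z using that b by simp
      show "morphism ?P X (\<lambda>z. N.\<pi> (b z))"
        by (rule morphism_cong[OF swfP morphism_compose[OF fs(1) L.proj]]) (simp add: b)
      fix p assume p: "p \<in> points ?P"
      let ?x = "L.\<pi> (fst p)"
      have pP: "p \<in> P" using p by simp
      have x: "?x \<in> points X" using pP L.proj_point M.proj_point unfolding P_def by auto
      obtain V where V: "openin (zariski X) V" "?x \<in> V"
        "(\<lambda>l. k l * d ?x (L.\<pi> l)) \<in> regular (bundle_space L) {l \<in> L.E. L.\<pi> l \<in> V}"
        by (rule L.local_section[OF x])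
      obtain V' where V': "openin (zariski X) V'" "?x \<in> V'"
        "(\<lambda>l. k' l * d' ?x (M.\<pi> l)) \<in> regular (bundle_space M) {l \<in> M.E. M.\<pi> l \<in> V'}"
        by (rule M.local_section[OF x])
      obtain W where W: "openin (zariski X) W" "?x \<in> W"
        "(\<lambda>z. h z * (d'' ?x z / (d ?x z * d' ?x z))) \<in> regular X W"
        by (rule unit_atE[OF L.base h(2)[rule_format, OF x]])
      let ?N = "{p \<in> points ?P. fst p \<in> {l \<in> L.E. L.\<pi> l \<in> V}} \<inter> {p \<in> points ?P. snd p \<in> {l \<in> M.E. M.\<pi> l \<in> V'}} \<inter>
         {p \<in> points ?P. L.\<pi> (fst p) \<in> W}"
      have "(\<lambda>p. k (fst p) * d ?x (L.\<pi> (fst p)) * (k' (snd p) * d' ?x (M.\<pi> (snd p))) *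
         (h (L.\<pi> (fst p)) * (d'' ?x (L.\<pi> (fst p)) / (d ?x (L.\<pi> (fst p)) * d' ?x (L.\<pi> (fst p)))))) \<in> regular ?P ?N"
        by (rule regular_Int_mult(2)[OF swfP regular_Int_mult(2)[OF swfP
           morphism_regular[OF fs(1) V(3)] morphism_regular[OF fs(2) V'(3)]]
           morphism_regular[OF morphism_compose[OF fs(1) L.proj] W(3)]])
      then have "(\<lambda>w. k'' (b w) * d'' (N.\<pi> (b p)) (N.\<pi> (b w))) \<in> regular ?P ?N"
      proof (rule regular_cong[OF swfP])
        fix w assume "w \<in> ?N"
        then have wP: "w \<in> P" by simp
        then have w: "M.\<pi> (snd w) = L.\<pi> (fst w)" unfolding P_def by auto
        show "k (fst w) * d ?x (L.\<pi> (fst w)) * (k' (snd w) * d' ?x (M.\<pi> (snd w))) *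
         (h (L.\<pi> (fst w)) * (d'' ?x (L.\<pi> (fst w)) / (d ?x (L.\<pi> (fst w)) * d' ?x (L.\<pi> (fst w))))) =
         k'' (b w) * d'' (N.\<pi> (b p)) (N.\<pi> (b w))"
          unfolding b(2)[OF pP] b(2,3)[OF wP] w using L.nonzero M.nonzero by simp
      qed
      moreover have "p \<in> ?N" using pP V(2) V'(2) W(2) unfolding P_def by auto
      ultimately show "\<exists>N. p \<in> N \<and> (\<lambda>w. k'' (b w) * d'' (N.\<pi> (b p)) (N.\<pi> (b w))) \<in> regular ?P N"
        by (intro exI conjI)
    qed
    moreover have "N.\<pi> (b (l, m)) = L.\<pi> l \<and>
           (\<forall>c. b (scalar L c l, m) = scalar N c (b (l, m)) \<and>
                b (l, scalar M c m) = scalar N c (b (l, m))) \<and>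
           (l \<in> nonzero_vectors L \<and> m \<in> nonzero_vectors M \<longrightarrow> b (l, m) \<in> nonzero_vectors N)" if lm: "(l, m) \<in> P" for l m
    proof (intro conjI allI impI)
      have l: "l \<in> L.E" "m \<in> M.E" "L.\<pi> l \<in> points X" using lm L.proj_point M.proj_point unfolding P_def by auto
      show "N.\<pi> (b (l, m)) = L.\<pi> l" using b[OF lm] by simp
      show "b (scalar L c l, m) = scalar N c (b (l, m))" "b (l, scalar M c m) = scalar N c (b (l, m))" for c
        using l L.scalar L.coeff_scalar M.coeff_scalar N.scalar_frame unfolding b_def by (simp_all add: mult_ac)
      show "l \<in> nonzero_vectors L \<and> m \<in> nonzero_vectors M \<Longrightarrow> b (l, m) \<in> nonzero_vectors N"
        using b[OF lm] h(1) unfolding L.nonzero_vectors M.nonzero_vectors N.nonzero_vectors by simp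
    qed
    ultimately show "is_tensor_product L M N" unfolding tp by blast
  next
    assume "is_tensor_product L M N"
    then obtain b where bm: "morphism ?P (bundle_space N) b"
      and bp: "\<forall>(l, m) \<in> P. N.\<pi> (b (l, m)) = L.\<pi> l \<and>
           (\<forall>c. b (scalar L c l, m) = scalar N c (b (l, m)) \<and>
                b (l, scalar M c m) = scalar N c (b (l, m))) \<and>
           (l \<in> nonzero_vectors L \<and> m \<in> nonzero_vectors M \<longrightarrow> b (l, m) \<in> nonzero_vectors N)"
      unfolding tp by blast
    have b1: "N.\<pi> (b (l, m)) = L.\<pi> l" "b (scalar L c l, m) = scalar N c (b (l, m))"
      "b (l, scalar M c m) = scalar N c (b (l, m))"
      "l \<in> nonzero_vectors L \<Longrightarrow> m \<in> nonzero_vectors M \<Longrightarrow> b (l, m) \<in> nonzero_vectors N"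
      if "(l, m) \<in> P" for l m c
      using bp[rule_format, OF that] by auto
    define h where "h z = (if z \<in> points X then k'' (b (e z, e' z)) else 1)" for z
    have ee: "(e z, e' z) \<in> P" "b (e z, e' z) \<in> N.E" "k'' (b (e z, e' z)) \<noteq> 0" if "z \<in> points X" for z
    proof -
      show 1: "(e z, e' z) \<in> P" using that L.frame M.frame unfolding P_def by auto
      show "b (e z, e' z) \<in> N.E" using morphism_points[OF bm] 1 by simp
      have "e z \<in> nonzero_vectors L" "e' z \<in> nonzero_vectors M"
        using that L.frame M.frame L.coeff_e M.coeff_e unfolding L.nonzero_vectors M.nonzero_vectors by auto
      then show "k'' (b (e z, e' z)) \<noteq> 0" using b1(4)[OF 1] unfolding N.nonzero_vectors by simp
    qed
    have h0: "h z \<noteq> 0" for z using ee unfolding h_def by simp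
    have "unit_at X x (\<lambda>z. h z * (d'' x z / (d x z * d' x z)))" if x: "x \<in> points X" for x
    proof -
      obtain V where V: "openin (zariski X) V" "x \<in> V"
        "morphism (induced X V) (bundle_space L) (\<lambda>z. scalar L (1 / d x z) (e z))"
        by (rule L.local_section[OF x])
      obtain V' where V': "openin (zariski X) V'" "x \<in> V'"
        "morphism (induced X V') (bundle_space M) (\<lambda>z. scalar M (1 / d' x z) (e' z))"
        by (rule M.local_section[OF x])
      obtain W where W: "openin (zariski X) W" "x \<in> W"
        "(\<lambda>l. k'' l * d'' x (N.\<pi> l)) \<in> regular (bundle_space N) {l \<in> N.E. N.\<pi> l \<in> W}"
        by (rule N.local_section[OF x])
      define O' where "O' = V \<inter> V' \<inter> W"
      have O': "openin (zariski X) O'" "x \<in> O'" "O' \<subseteq> V" "O' \<subseteq> V'" "O' \<subseteq> W" "O' \<subseteq> points X"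
        using V V' W openin_subset[OF V(1)] unfolding O'_def by auto
      \<comment> \<open>Along the pair of local sections both input coordinates are 1, so the
        coordinate of the image is the very function to be shown regular. The three charts involved
        have different domains, hence the restriction to \<open>O'\<close>.\<close>
      let ?s = "\<lambda>z. (scalar L (1 / d x z) (e z), scalar M (1 / d' x z) (e' z))"
      have res: "morphism (induced X O') Y f" if V: "openin (zariski X) V" "O' \<subseteq> V" and f: "morphism (induced X V) Y f" for V f
          and Y :: "'q fspace"
      proof -
        have "morphism (induced X O') (induced X V) (\<lambda>z. z)"
          unfolding morphism_induced_iff[OF swf_induced L.base openin_subset[OF V(1)]]
          using morphism_inclusion[OF L.base O'(6)] V(2) by auto
        from morphism_compose[OF this f] show ?thesis .
      qed
      have sP: "?s z \<in> P" if "z \<in> O'" for z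
        using that O'(6) L.frame M.frame L.scalar M.scalar unfolding P_def by auto
      have s: "morphism (induced X O') ?P ?s"
        unfolding morphism_fibre_space_iff[OF swf_induced L.total M.total Psub] fst_conv snd_conv
        using sP res[OF V(1) O'(3) V(3)] res[OF V'(1) O'(4) V'(3)] by auto
      have bs: "b (?s z) = scalar N (1 / d x z * (1 / d' x z)) (b (e z, e' z))" if z: "z \<in> O'" for z
      proof -
        have zX: "z \<in> points X" using z O' by auto
        have "(e z, scalar M (1 / d' x z) (e' z)) \<in> P"
          using zX L.frame M.frame M.scalar unfolding P_def by auto
        then have "b (?s z) = scalar N (1 / d x z) (b (e z, scalar M (1 / d' x z) (e' z)))" by (rule b1(2))
        also have "\<dots> = scalar N (1 / d x z) (scalar N (1 / d' x z) (b (e z, e' z)))"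
          by (simp add: b1(3)[OF ee(1)[OF zX]])
        also have "\<dots> = scalar N (1 / d x z * (1 / d' x z)) (b (e z, e' z))"
          by (rule N.scalar_scalar[OF ee(2)[OF zX]])
        finally show ?thesis .
      qed
      have eq: "{z \<in> points (induced X O'). b (?s z) \<in> {l \<in> N.E. N.\<pi> l \<in> W}} = O'"
      proof -
        have "b (?s z) \<in> N.E" "N.\<pi> (b (?s z)) = z" if z: "z \<in> O'" for z
        proof -
          have zX: "z \<in> points X" using z O' by auto
          show "b (?s z) \<in> N.E" "N.\<pi> (b (?s z)) = z"
            using bs[OF z] N.scalar[OF ee(2)[OF zX]] b1(1)[OF ee(1)[OF zX]] L.frame(2)[OF zX] by simp_all
        qed
        then show ?thesis using O'(5) by auto
      qed
      have "(\<lambda>z. k'' (b (?s z)) * d'' x (N.\<pi> (b (?s z)))) \<in> regular (induced X O') O'"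
        using morphism_regular[OF morphism_compose[OF s bm] W(3)] unfolding eq .
      then have "(\<lambda>z. k'' (b (?s z)) * d'' x (N.\<pi> (b (?s z)))) \<in> regular X O'"
        using regular_induced_open[OF L.base O'(1), of O'] by simp
      then have "(\<lambda>z. h z * (d'' x z / (d x z * d' x z))) \<in> regular X O'"
      proof (rule regular_cong[OF L.base])
        fix z assume z: "z \<in> O'"
        then have zX: "z \<in> points X" using O' by auto
        have "N.\<pi> (b (?s z)) = z" "k'' (b (?s z)) = h z / (d x z * d' x z)"
          using bs[OF z] ee[OF zX] b1(1)[OF ee(1)[OF zX]] N.scalar N.coeff_scalar L.frame zX unfolding h_def by auto
        then show "k'' (b (?s z)) * d'' x (N.\<pi> (b (?s z))) = h z * (d'' x z / (d x z * d' x z))" by simp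
      qed
      then show ?thesis by (rule unit_atI[OF L.base]) (use O' h0 L.nonzero M.nonzero N.nonzero in auto)
    qed
    with h0 show "principal X (\<lambda>x z. d'' x z / (d x z * d' x z))" unfolding principal_def by blast
  qed
qed

section \<open>Constructions of framed bundles\<close>

lemma framed_trivial_bundle:
  assumes X: "space_with_functions X"
  shows "framed X (trivial_bundle X) (\<lambda>x. (x, 1)) (\<lambda>_ _. 1) snd"
proof -
  let ?P = "product_space X affine_line"
  note fs = morphism_fst_snd[OF X swf_affine_line order_refl, folded product_space_def]
  have sp: "bundle_space (trivial_bundle X) = ?P" "bundle_proj (trivial_bundle X) = fst"
    "scalar (trivial_bundle X) = (\<lambda>c (x, a). (x, c * a))" unfolding trivial_bundle_def by simp_all
  have P: "space_with_functions ?P" by (rule swf_product_space)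
  have snd: "snd \<in> regular ?P (points ?P)"
    using fs(2) unfolding morphism_affine_line_iff[OF P] .
  show ?thesis
  proof (standard, unfold sp)
    fix x assume x: "x \<in> points X"
    have 1: "(\<lambda>l. snd l * 1) \<in> regular ?P {l \<in> points ?P. fst l \<in> points X}"
      using snd by (auto simp: Collect_conj_eq[symmetric] mem_Times_iff elim!: back_subst[where P="\<lambda>S. snd \<in> regular ?P S"])
    have "morphism (product_space (induced X (points X)) affine_line) ?P (\<lambda>p. p)"
      unfolding morphism_product_space_iff[OF swf_product_space X swf_affine_line]
    proof
      note fs' = morphism_fst_snd[OF swf_induced[of X "points X"] swf_affine_line order_refl,
          folded product_space_def]
      show "morphism (product_space (induced X (points X)) affine_line) X (\<lambda>z. fst z)"
        by (rule morphism_compose[OF fs'(1) morphism_inclusion[OF X order_refl]])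
      show "morphism (product_space (induced X (points X)) affine_line) affine_line (\<lambda>z. snd z)"
        by (rule fs'(2))
    qed
    then have 2: "morphism (product_space (induced X (points X)) affine_line) ?P
      (\<lambda>p. case (fst p, 1) of (x, a) \<Rightarrow> (x, snd p / 1 * a))" by simp
    show "\<exists>V. openin (zariski X) V \<and> x \<in> V \<and>
      (\<lambda>l. snd l * 1) \<in> regular ?P {l \<in> points ?P. fst l \<in> V} \<and>
      morphism (product_space (induced X V) affine_line) ?P (\<lambda>p. case (fst p, 1) of (x, a) \<Rightarrow> (x, snd p / 1 * a))"
      using x 1 2 by (intro exI[of _ "points X"] conjI openin_topspace)
  qed (use X P fs(1) in auto)
qed

lemma framed_pullback_bundle:
  assumes L: "framed X L e d k" and Y: "space_with_functions Y" and \<phi>: "morphism Y X \<phi>"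
  shows "framed Y (pullback_bundle Y \<phi> L) (\<lambda>y. (y, e (\<phi> y))) (\<lambda>x z. d (\<phi> x) (\<phi> z)) (\<lambda>p. k (snd p))"
proof -
  interpret L: framed X L e d k by (rule L)
  define S where "S = {(y, l). y \<in> points Y \<and> l \<in> L.E \<and> \<phi> y = L.\<pi> l}"
  let ?P = "fibre_space Y (bundle_space L) S"
  have S: "S \<subseteq> points Y \<times> L.E" unfolding S_def by auto
  note fs = morphism_fst_snd[OF Y L.total S]
  have sp: "bundle_space (pullback_bundle Y \<phi> L) = ?P" "bundle_proj (pullback_bundle Y \<phi> L) = fst"
    "scalar (pullback_bundle Y \<phi> L) = (\<lambda>c (y, l). (y, scalar L c l))"
    unfolding pullback_bundle_def S_def by simp_all
  have P: "space_with_functions ?P" by (rule swf_fibre_space)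
  have \<phi>X: "\<phi> y \<in> points X" if "y \<in> points Y" for y by (rule morphism_points[OF \<phi> that])
  show ?thesis
  proof (standard, unfold sp)
    fix x assume x: "x \<in> points Y"
    obtain V where V: "openin (zariski X) V" "\<phi> x \<in> V"
      "(\<lambda>l. k l * d (\<phi> x) (L.\<pi> l)) \<in> regular (bundle_space L) {l \<in> L.E. L.\<pi> l \<in> V}"
      "morphism (product_space (induced X V) affine_line) (bundle_space L)
        (\<lambda>p. scalar L (snd p / d (\<phi> x) (fst p)) (e (fst p)))"
      by (rule L.local_section[OF \<phi>X[OF x]])
    define W where "W = {y \<in> points Y. \<phi> y \<in> V}"
    have W: "openin (zariski Y) W" "x \<in> W" "W \<subseteq> points Y"
      using morphism_openin[OF \<phi> V(1)] x V(2) unfolding W_def by auto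
    have eq: "{p \<in> points ?P. snd p \<in> {l \<in> L.E. L.\<pi> l \<in> V}} = {p \<in> points ?P. fst p \<in> W}"
      unfolding W_def S_def by auto
    have 1: "(\<lambda>p. k (snd p) * d (\<phi> x) (\<phi> (fst p))) \<in> regular ?P {p \<in> points ?P. fst p \<in> W}"
      by (rule regular_cong[OF P morphism_regular[OF fs(2) V(3), unfolded eq]]) (auto simp: S_def)
    let ?Q = "product_space (induced Y W) affine_line"
    have Q: "space_with_functions ?Q" by (rule swf_product_space)
    note fs' = morphism_fst_snd[OF swf_induced[of Y W] swf_affine_line order_refl,
          folded product_space_def]
    have mW: "morphism ?Q Y fst" by (rule morphism_compose[OF fs'(1) morphism_inclusion[OF Y W(3)]])
    have "morphism ?Q (product_space (induced X V) affine_line) (\<lambda>p. (\<phi> (fst p), snd p))"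
      unfolding morphism_product_space_iff[OF Q swf_induced swf_affine_line] fst_conv snd_conv
        morphism_induced_iff[OF Q L.base openin_subset[OF V(1)]]
      using morphism_compose[OF mW \<phi>] fs'(2) by (auto simp: W_def)
    from morphism_compose[OF this V(4)]
    have m: "morphism ?Q (bundle_space L) (\<lambda>p. scalar L (snd p / d (\<phi> x) (\<phi> (fst p))) (e (\<phi> (fst p))))" by simp
    have "morphism ?Q ?P (\<lambda>p. (fst p, scalar L (snd p / d (\<phi> x) (\<phi> (fst p))) (e (\<phi> (fst p)))))"
      unfolding morphism_fibre_space_iff[OF Q Y L.total S] fst_conv snd_conv
      using mW m L.scalar L.frame \<phi>X W(3) by (auto simp: S_def)
    then have 2: "morphism ?Q ?P (\<lambda>p. case (fst p, e (\<phi> (fst p))) of (y, l) \<Rightarrow> (y, scalar L (snd p / d (\<phi> x) (\<phi> (fst p))) l))"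
      by simp
    show "\<exists>V. openin (zariski Y) V \<and> x \<in> V \<and>
      (\<lambda>p. k (snd p) * d (\<phi> x) (\<phi> (fst p))) \<in> regular ?P {p \<in> points ?P. fst p \<in> V} \<and>
      morphism (product_space (induced Y V) affine_line) ?P
        (\<lambda>p. case (fst p, e (\<phi> (fst p))) of (y, l) \<Rightarrow> (y, scalar L (snd p / d (\<phi> x) (\<phi> (fst p))) l))"
      by (intro exI[of _ W] conjI W(1,2) 1 2)
  qed (use Y P fs(1) \<phi>X L.scalar L.frame L.coeff_frame L.scalar_frame L.nonzero L.coeff in
      \<open>auto simp: S_def\<close>)
qed

text \<open>The total space is the product set with the coarsest structure for which the projection
  and the products of the second component with each \<open>d x\<close> are regular. This choice of
  generators makes the charts regular by construction; the gauge condition is needed for their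
  inverses.\<close>

lemma gauge_on_framed:
  fixes X :: "'a fspace"
  assumes X: "space_with_functions X" and d: "gauge_on X d"
  obtains L :: "('a, 'a \<times> complex) line_bundle" and e k where "framed X L e d k"
proof -
  have nz: "d x z \<noteq> 0" for x z using d unfolding gauge_on_def by blast
  have "\<forall>x\<in>points X. \<exists>V. openin (zariski X) V \<and> x \<in> V \<and> (\<forall>y\<in>V. unit_at X y (\<lambda>z. d x z / d y z))"
    using d unfolding gauge_on_def by blast
  from bchoice[OF this] obtain V where
    V: "\<forall>x\<in>points X. openin (zariski X) (V x) \<and> x \<in> V x \<and> (\<forall>y\<in>V x. unit_at X y (\<lambda>z. d x z / d y z))"
    by (elim exE)
  define S where "S = points X \<times> (UNIV :: complex set)"
  define G where "G = pulled_back S fst X \<union> {({p\<in>S. fst p \<in> V x}, \<lambda>p. snd p * d x (fst p)) |x. x \<in> points X}"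
  define P where "P = initial_space S G"
  have dom: "D \<subseteq> S" if "(D, f) \<in> G" for D f using that unfolding G_def by (auto dest: pulled_back_dom)
  have P: "space_with_functions P" unfolding P_def by (rule swf_initial_space) (rule dom)
  have pP: "points P = S" unfolding P_def zariski_initial_space by (rule topspace_initial) (rule dom)
  have ball: "(\<forall>(D, g)\<in>{(A x, f x) |x. x \<in> I}. Q D g) \<longleftrightarrow> (\<forall>x\<in>I. Q (A x) (f x))"
    for A :: "'i \<Rightarrow> 'u" and f :: "'i \<Rightarrow> 'v" and I Q by auto
  have mP: "morphism Z P F \<longleftrightarrow> F \<in> points Z \<rightarrow> S \<and> morphism Z X (\<lambda>z. fst (F z)) \<and>
    (\<forall>x\<in>points X. (\<lambda>z. snd (F z) * d x (fst (F z))) \<in> regular Z {z\<in>points Z. F z \<in> {p\<in>S. fst p \<in> V x}})"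
    if Z: "space_with_functions Z" for Z :: "'z fspace" and F
  proof -
    have "morphism Z P F \<longleftrightarrow> F \<in> points Z \<rightarrow> S \<and> (\<forall>(D, g)\<in>G. (\<lambda>z. g (F z)) \<in> regular Z {z\<in>points Z. F z \<in> D})"
      unfolding P_def by (rule morphism_initial_space_iff[OF _ Z]) (rule dom)
    also have "\<dots> \<longleftrightarrow> F \<in> points Z \<rightarrow> S \<and> morphism Z X (\<lambda>z. fst (F z)) \<and>
    (\<forall>x\<in>points X. (\<lambda>z. snd (F z) * d x (fst (F z))) \<in> regular Z {z\<in>points Z. F z \<in> {p\<in>S. fst p \<in> V x}})"
    proof (rule conj_cong[OF refl])
      assume F: "F \<in> points Z \<rightarrow> S"
      have "fst \<in> S \<rightarrow> points X" unfolding S_def by auto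
      note pb = morphism_pulled_back_iff[OF Z X F this]
      show "(\<forall>(D, g)\<in>G. (\<lambda>z. g (F z)) \<in> regular Z {z\<in>points Z. F z \<in> D}) \<longleftrightarrow> morphism Z X (\<lambda>z. fst (F z)) \<and>
        (\<forall>x\<in>points X. (\<lambda>z. snd (F z) * d x (fst (F z))) \<in> regular Z {z\<in>points Z. F z \<in> {p\<in>S. fst p \<in> V x}})"
        unfolding G_def ball_Un pb ball ..
    qed
    finally show ?thesis .
  qed
  have idP: "morphism P P (\<lambda>p. p)" by (rule morphism_id[OF P])
  define L where "L = \<lparr>bundle_space = P, bundle_proj = fst, scalar = (\<lambda>c (x, a). (x, c * a))\<rparr>"
  have sp: "bundle_space L = P" "bundle_proj L = fst" "scalar L = (\<lambda>c (x, a). (x, c * a))"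
    unfolding L_def by simp_all
  have "framed X L (\<lambda>x. (x, 1)) d snd"
  proof (standard, unfold sp)
    show "morphism P X fst" using idP unfolding mP[OF P] by blast
    fix x assume x: "x \<in> points X"
    have VX: "V x \<subseteq> points X" using V x openin_subset by blast
    have eq: "{p \<in> points P. p \<in> {p\<in>S. fst p \<in> V x}} = {p \<in> points P. fst p \<in> V x}" unfolding pP by auto
    have 1: "(\<lambda>p. snd p * d x (fst p)) \<in> regular P {p \<in> points P. fst p \<in> V x}"
      using idP x unfolding mP[OF P] eq[symmetric] by blast
    let ?Q = "product_space (induced X (V x)) affine_line"
    let ?F = "\<lambda>p. (fst p, snd p / d x (fst p))"
    have Q: "space_with_functions ?Q" by (rule swf_product_space)
    note fs' = morphism_fst_snd[OF swf_induced[of X "V x"] swf_affine_line order_refl,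
          folded product_space_def]
    have mX: "morphism ?Q X fst" by (rule morphism_compose[OF fs'(1) morphism_inclusion[OF X VX]])
    have "morphism ?Q P ?F"
      unfolding mP[OF Q]
    proof (intro conjI ballI)
      show "?F \<in> points ?Q \<rightarrow> S" using VX unfolding S_def by auto
      show "morphism ?Q X (\<lambda>z. fst (?F z))" using mX by simp
      fix y assume y: "y \<in> points X"
      let ?A = "{z \<in> points ?Q. ?F z \<in> {p\<in>S. fst p \<in> V y}}"
      have "?A = {z \<in> points ?Q. fst z \<in> V y}" using VX unfolding S_def by auto
      then have A: "openin (zariski ?Q) ?A" using morphism_openin[OF mX] V y by simp
      show "(\<lambda>z. snd (?F z) * d y (fst (?F z))) \<in> regular ?Q ?A"
      proof (rule regular_local[OF Q A])
        fix q assume q: "q \<in> ?A"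
        let ?z = "fst q"
        have z: "?z \<in> V x" "?z \<in> V y" using q by auto
        \<comment> \<open>The gauge condition compares \<open>d x\<close> and \<open>d y\<close>
          only with the member of the family that belongs to the point itself. Dividing the two
          comparisons at the point below \<open>q\<close> relates them to each other.\<close>
        have "unit_at X ?z (\<lambda>z. d x z / d ?z z)" "unit_at X ?z (\<lambda>z. d y z / d ?z z)"
          using z V x y by blast+
        from unit_at_divide[OF X this(2) this(1)]
        have "unit_at X ?z (\<lambda>z. d y z / d x z)" using nz by simp
        then obtain T where T: "?z \<in> T" "(\<lambda>z. d y z / d x z) \<in> regular X T" unfolding unit_at_def by blast
        have "snd \<in> regular ?Q (points ?Q)" using fs'(2) unfolding morphism_affine_line_iff[OF Q] .
        from regular_Int_mult(2)[OF Q this morphism_regular[OF mX T(2)]]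
        have "(\<lambda>p. snd p * (d y (fst p) / d x (fst p))) \<in> regular ?Q (points ?Q \<inter> {p \<in> points ?Q. fst p \<in> T})" .
        then have "(\<lambda>z. snd (?F z) * d y (fst (?F z))) \<in> regular ?Q (points ?Q \<inter> {p \<in> points ?Q. fst p \<in> T})"
          by (rule regular_cong[OF Q]) simp
        then show "\<exists>N. q \<in> N \<and> (\<lambda>z. snd (?F z) * d y (fst (?F z))) \<in> regular ?Q N"
          using q T(1) by (intro exI conjI) auto
      qed
    qed
    then have 2: "morphism ?Q P (\<lambda>p. case (fst p, 1) of (y, a) \<Rightarrow> (y, snd p / d x (fst p) * a))" by simp
    show "\<exists>V. openin (zariski X) V \<and> x \<in> V \<and>
      (\<lambda>l. snd l * d x (fst l)) \<in> regular P {l \<in> points P. fst l \<in> V} \<and>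
      morphism (product_space (induced X V) affine_line) P (\<lambda>p. case (fst p, 1) of (y, a) \<Rightarrow> (y, snd p / d x (fst p) * a))"
      using V x 1 2 by (intro exI[of _ "V x"]) blast
  qed (use X P nz in \<open>auto simp: pP S_def\<close>)
  then show thesis by (rule that)
qed

section \<open>The Picard group\<close>

text \<open>A gauge of \<open>M\<close> depends on a frame, hence the existential quantifier. The
  class of a bundle becomes a function of any of its gauges, and computations in
  \<open>Pic X\<close> become computations with functions.\<close>

definition gauge_class :: "'a fspace \<Rightarrow> ('a \<Rightarrow> 'a \<Rightarrow> complex) \<Rightarrow> ('a, 'a \<times> complex) line_bundle set" where
  "gauge_class X d = {M. \<exists>e d' k. framed X M e d' k \<and> principal X (\<lambda>x z. d x z / d' x z)}"

context
  fixes X :: "'a fspace"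
  assumes X: "space_with_functions X"
begin

lemma principal_swap: "principal X (\<lambda>x z. d x z / d' x z) \<longleftrightarrow> principal X (\<lambda>x z. d' x z / d x z)"
  using principal_inverse[OF X, of "\<lambda>x z. d x z / d' x z"] principal_inverse[OF X, of "\<lambda>x z. d' x z / d x z"]
  by auto

lemma principal_trans:
  assumes "principal X (\<lambda>x z. d x z / d' x z)" "principal X (\<lambda>x z. d' x z / d'' x z)" "\<And>x z. d' x z \<noteq> 0"
  shows "principal X (\<lambda>x z. d x z / d'' x z)"
  using principal_mult[OF X assms(1,2)] assms(3) by simp

lemma principal_cong:
  assumes "principal X d" "\<And>x z. x \<in> points X \<Longrightarrow> z \<in> points X \<Longrightarrow> d x z = d' x z"
  shows "principal X d'"
proof -
  obtain h where h: "\<forall>z. h z \<noteq> 0" "\<forall>x\<in>points X. unit_at X x (\<lambda>z. h z * d x z)"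
    using assms(1) unfolding principal_def by blast
  have "unit_at X x (\<lambda>z. h z * d' x z)" if "x \<in> points X" for x
    by (rule unit_at_cong[OF X h(2)[rule_format, OF that] openin_topspace that]) (use assms(2) that in simp)
  with h show ?thesis unfolding principal_def by blast
qed

lemma pic_class_framed:
  assumes L: "framed X L e d k" shows "pic_class X L = gauge_class X d"
proof (intro Set.set_eqI iffI)
  fix M assume "M \<in> pic_class X L"
  then have M: "line_bundle_on X M" "bundles_isomorphic L M" unfolding pic_class_def by auto
  obtain e' d' k' where M': "framed X M e' d' k'" by (rule line_bundle_on_framed[OF X M(1)])
  have "principal X (\<lambda>x z. d x z / d' x z)"
    using M(2) bundles_isomorphic_iff_principal[OF L M'] principal_swap by blast
  with M' show "M \<in> gauge_class X d" unfolding gauge_class_def by blast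
next
  fix M assume "M \<in> gauge_class X d"
  then obtain e' d' k' where M': "framed X M e' d' k'" "principal X (\<lambda>x z. d x z / d' x z)"
    unfolding gauge_class_def by blast
  then have "bundles_isomorphic L M"
    using bundles_isomorphic_iff_principal[OF L M'(1)] principal_swap by blast
  with framed.line_bundle[OF M'(1)] show "M \<in> pic_class X L" unfolding pic_class_def by blast
qed

lemma framed_in_gauge_class: "framed X M e d k \<Longrightarrow> M \<in> gauge_class X d"
  unfolding gauge_class_def using principal_quotient_refl[OF X framed.gauge] by blast

lemma gauge_class_eqI:
  assumes d: "gauge_on X d" and d': "gauge_on X d'" and p: "principal X (\<lambda>x z. d x z / d' x z)"
  shows "gauge_class X d = gauge_class X d'"
proof -
  have "d x z \<noteq> 0" "d' x z \<noteq> 0" for x z using d d' unfolding gauge_on_def by auto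
  have "principal X (\<lambda>x z. d x z / f x z) \<longleftrightarrow> principal X (\<lambda>x z. d' x z / f x z)" for f
  proof
    assume "principal X (\<lambda>x z. d x z / f x z)"
    then show "principal X (\<lambda>x z. d' x z / f x z)"
      by (rule principal_trans[OF p[unfolded principal_swap[of d d']] _ \<open>\<And>x z. d x z \<noteq> 0\<close>])
  next
    assume "principal X (\<lambda>x z. d' x z / f x z)"
    then show "principal X (\<lambda>x z. d x z / f x z)"
      by (rule principal_trans[OF p _ \<open>\<And>x z. d' x z \<noteq> 0\<close>])
  qed
  then show ?thesis unfolding gauge_class_def by simp
qed

text \<open>A bundle \<open>M\<close> with gauge exactly \<open>d\<close> lies in both classes. The
  second class supplies another frame of the same \<open>M\<close>, and the two gauges of
  \<open>M\<close> are compared through the isomorphism of \<open>M\<close> with itself.\<close>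

lemma gauge_class_eqD:
  assumes d: "gauge_on X d" and d': "gauge_on X d'" and eq: "gauge_class X d = gauge_class X d'"
  shows "principal X (\<lambda>x z. d x z / d' x z)"
proof -
  obtain M :: "('a, 'a \<times> complex) line_bundle" and e k where M: "framed X M e d k"
    by (rule gauge_on_framed[OF X d])
  have "M \<in> gauge_class X d'" using framed_in_gauge_class[OF M] eq by simp
  then obtain e' d'' k' where M': "framed X M e' d'' k'" "principal X (\<lambda>x z. d' x z / d'' x z)"
    unfolding gauge_class_def by blast
  have "bundles_isomorphic M M"
    using bundles_isomorphic_iff_principal[OF M M] principal_quotient_refl[OF X d] by blast
  then have "principal X (\<lambda>x z. d'' x z / d x z)" using bundles_isomorphic_iff_principal[OF M M'(1)] by blast
  then have 1: "principal X (\<lambda>x z. d x z / d'' x z)" using principal_swap by blast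
  have 2: "principal X (\<lambda>x z. d'' x z / d' x z)" using M'(2) principal_swap by blast
  show ?thesis by (rule principal_trans[OF 1 2 framed.nonzero[OF M'(1)]])
qed

lemma gauge_class_cong:
  assumes d: "gauge_on X d" and d': "gauge_on X d'"
    and eq: "\<And>x z. x \<in> points X \<Longrightarrow> z \<in> points X \<Longrightarrow> d x z = d' x z"
  shows "gauge_class X d = gauge_class X d'"
  by (rule gauge_class_eqI[OF d d' principal_cong[OF principal_quotient_refl[OF X d]]]) (simp add: eq)

lemma carrier_Pic: "carrier (Pic X) = gauge_class X ` {d. gauge_on X d}"
proof (intro Set.set_eqI iffI)
  fix \<alpha> assume "\<alpha> \<in> carrier (Pic X)"
  then obtain L :: "('a, 'a \<times> complex) line_bundle" where L: "line_bundle_on X L" "\<alpha> = pic_class X L"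
    unfolding Pic_def by auto
  obtain e d k where M: "framed X L e d k" by (rule line_bundle_on_framed[OF X L(1)])
  show "\<alpha> \<in> gauge_class X ` {d. gauge_on X d}"
    using pic_class_framed[OF M] framed.gauge[OF M] L(2) by blast
next
  fix \<alpha> assume "\<alpha> \<in> gauge_class X ` {d. gauge_on X d}"
  then obtain d where d: "gauge_on X d" "\<alpha> = gauge_class X d" by blast
  obtain M :: "('a, 'a \<times> complex) line_bundle" and e k where M: "framed X M e d k"
    by (rule gauge_on_framed[OF X d(1)])
  have "\<alpha> = pic_class X M" using pic_class_framed[OF M] d(2) by simp
  then show "\<alpha> \<in> carrier (Pic X)" using framed.line_bundle[OF M] unfolding Pic_def by auto
qed

text \<open>A product in \<open>Pic X\<close> collects tensor products of arbitrary representatives,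
  so one inclusion has to cope with gauges that agree with \<open>d\<close> and \<open>d'\<close>
  only up to principal ones; for the other, representatives with exactly these gauges are
  constructed.\<close>

lemma gauge_class_mult:
  assumes d: "gauge_on X d" and d': "gauge_on X d'"
  shows "gauge_class X d \<otimes>\<^bsub>Pic X\<^esub> gauge_class X d' = gauge_class X (\<lambda>x z. d x z * d' x z)"
proof -
  have nz: "d x z \<noteq> 0" "d' x z \<noteq> 0" for x z using d d' unfolding gauge_on_def by auto
  have m: "A \<otimes>\<^bsub>Pic X\<^esub> B = {N. line_bundle_on X N \<and> (\<exists>L\<in>A. \<exists>M\<in>B. is_tensor_product L M N)}" for A B
    unfolding Pic_def by simp
  show ?thesis unfolding m
  proof (intro Set.set_eqI iffI)
    fix N :: "('a, 'a \<times> complex) line_bundle"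
    assume "N \<in> {N. line_bundle_on X N \<and> (\<exists>L\<in>gauge_class X d. \<exists>M\<in>gauge_class X d'. is_tensor_product L M N)}"
    then obtain L M where N: "line_bundle_on X N" and LM: "L \<in> gauge_class X d" "M \<in> gauge_class X d'"
      and t: "is_tensor_product L M N" by blast
    obtain e1 d1 k1 where L: "framed X L e1 d1 k1" "principal X (\<lambda>x z. d x z / d1 x z)"
      using LM(1) unfolding gauge_class_def by blast
    obtain e2 d2 k2 where M: "framed X M e2 d2 k2" "principal X (\<lambda>x z. d' x z / d2 x z)"
      using LM(2) unfolding gauge_class_def by blast
    obtain e3 d3 k3 where N': "framed X N e3 d3 k3" by (rule line_bundle_on_framed[OF X N])
    have "principal X (\<lambda>x z. d3 x z / (d1 x z * d2 x z))"
      using t is_tensor_product_iff_principal[OF L(1) M(1) N'] by blast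
    then have 1: "principal X (\<lambda>x z. d1 x z * d2 x z / d3 x z)" using principal_swap[of d3 "\<lambda>x z. d1 x z * d2 x z"] by simp
    have 2: "principal X (\<lambda>x z. d x z * d' x z / (d1 x z * d2 x z))"
      using principal_mult[OF X L(2) M(2)] by simp
    have "principal X (\<lambda>x z. d x z * d' x z / d3 x z)"
      by (rule principal_trans[OF 2 1]) (use framed.nonzero[OF L(1)] framed.nonzero[OF M(1)] in simp)
    with N' show "N \<in> gauge_class X (\<lambda>x z. d x z * d' x z)" unfolding gauge_class_def by blast
  next
    fix N assume "N \<in> gauge_class X (\<lambda>x z. d x z * d' x z)"
    then obtain e3 d3 k3 where N: "framed X N e3 d3 k3" "principal X (\<lambda>x z. d x z * d' x z / d3 x z)"
      unfolding gauge_class_def by blast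
    obtain L :: "('a, 'a \<times> complex) line_bundle" and e1 k1 where L: "framed X L e1 d k1"
      by (rule gauge_on_framed[OF X d(1)])
    obtain M :: "('a, 'a \<times> complex) line_bundle" and e2 k2 where M: "framed X M e2 d' k2"
      by (rule gauge_on_framed[OF X d'(1)])
    have "principal X (\<lambda>x z. d3 x z / (d x z * d' x z))"
      using N(2) principal_swap[of d3 "\<lambda>x z. d x z * d' x z"] by simp
    then have "is_tensor_product L M N" using is_tensor_product_iff_principal[OF L M N(1)] by blast
    then show "N \<in> {N. line_bundle_on X N \<and> (\<exists>L\<in>gauge_class X d. \<exists>M\<in>gauge_class X d'. is_tensor_product L M N)}"
      using framed_in_gauge_class[OF L] framed_in_gauge_class[OF M] framed.line_bundle[OF N(1)] by blast
  qed
qed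

lemma one_Pic: "\<one>\<^bsub>Pic X\<^esub> = gauge_class X (\<lambda>_ _. 1)"
  using pic_class_framed[OF framed_trivial_bundle[OF X]] unfolding Pic_def by simp

text \<open>The map from gauges to classes is surjective and multiplicative, so each axiom follows
  from the corresponding rule for multiplying functions; the inverse of a class is given by the
  reciprocal gauge.\<close>

lemma comm_group_Pic: "comm_group (Pic X)"
proof (rule comm_groupI)
  have c: "\<exists>d. gauge_on X d \<and> x = gauge_class X d" if "x \<in> carrier (Pic X)" for x
    using that unfolding carrier_Pic by blast
  show "x \<otimes>\<^bsub>Pic X\<^esub> y \<in> carrier (Pic X)" if "x \<in> carrier (Pic X)" "y \<in> carrier (Pic X)" for x y
    using that gauge_class_mult gauge_on_mult[OF X] unfolding carrier_Pic by auto
  show "\<one>\<^bsub>Pic X\<^esub> \<in> carrier (Pic X)" unfolding one_Pic carrier_Pic using gauge_on_one[OF X] by blast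
  show "x \<otimes>\<^bsub>Pic X\<^esub> y \<otimes>\<^bsub>Pic X\<^esub> z = x \<otimes>\<^bsub>Pic X\<^esub> (y \<otimes>\<^bsub>Pic X\<^esub> z)"
    if xyz: "x \<in> carrier (Pic X)" "y \<in> carrier (Pic X)" "z \<in> carrier (Pic X)" for x y z
  proof -
    obtain d d' d'' where d: "gauge_on X d" "gauge_on X d'" "gauge_on X d''"
      and e: "x = gauge_class X d" "y = gauge_class X d'" "z = gauge_class X d''"
      using xyz c by metis
    show ?thesis unfolding e by (simp add: gauge_class_mult d gauge_on_mult[OF X] mult.assoc)
  qed
  show "x \<otimes>\<^bsub>Pic X\<^esub> y = y \<otimes>\<^bsub>Pic X\<^esub> x" if xy: "x \<in> carrier (Pic X)" "y \<in> carrier (Pic X)" for x y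
  proof -
    obtain d d' where d: "gauge_on X d" "gauge_on X d'"
      and e: "x = gauge_class X d" "y = gauge_class X d'"
      using xy c by metis
    show ?thesis unfolding e by (simp add: gauge_class_mult d mult.commute)
  qed
  show "\<one>\<^bsub>Pic X\<^esub> \<otimes>\<^bsub>Pic X\<^esub> x = x" if x: "x \<in> carrier (Pic X)" for x
    using c[OF x] unfolding one_Pic by (auto simp: gauge_class_mult gauge_on_one[OF X])
  show "\<exists>y\<in>carrier (Pic X). y \<otimes>\<^bsub>Pic X\<^esub> x = \<one>\<^bsub>Pic X\<^esub>" if x: "x \<in> carrier (Pic X)" for x
  proof -
    obtain d where d: "gauge_on X d" "x = gauge_class X d" using c[OF x] by blast
    have "d x z \<noteq> 0" for x z using d unfolding gauge_on_def by auto
    then have "gauge_class X (\<lambda>x z. 1 / d x z) \<otimes>\<^bsub>Pic X\<^esub> x = \<one>\<^bsub>Pic X\<^esub>"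
      unfolding d(2) one_Pic by (simp add: gauge_class_mult d gauge_on_inverse[OF X])
    then show ?thesis using gauge_on_inverse[OF X d(1)] unfolding carrier_Pic by blast
  qed
qed

section \<open>Powers, finite products and pullbacks of classes\<close>

lemma gauge_on_power: "gauge_on X d \<Longrightarrow> gauge_on X (\<lambda>x z. d x z ^ n)"
  by (induction n) (auto intro: gauge_on_mult[OF X] gauge_on_one[OF X])

lemma gauge_on_power_int: "gauge_on X d \<Longrightarrow> gauge_on X (\<lambda>x z. d x z powi n)"
  using gauge_on_power[of d "nat n"] gauge_on_inverse[OF X gauge_on_power[of d "nat (- n)"]]
  by (cases "n \<ge> 0") (simp_all add: power_int_def inverse_eq_divide power_divide)

lemma gauge_on_prod:
  fixes r :: nat
  shows "(\<And>i. i < r \<Longrightarrow> gauge_on X (d i)) \<Longrightarrow> gauge_on X (\<lambda>x z. \<Prod>i<r. d i x z)"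
  by (induction r) (auto intro: gauge_on_mult[OF X] gauge_on_one[OF X])

lemma gauge_class_power:
  assumes d: "gauge_on X d" shows "gauge_class X d [^]\<^bsub>Pic X\<^esub> n = gauge_class X (\<lambda>x z. d x z ^ n)"
proof -
  interpret comm_group "Pic X" by (rule comm_group_Pic)
  show ?thesis
  proof (induction n)
    case 0 then show ?case by (simp add: one_Pic)
  next
    case (Suc n)
    then show ?case by (simp add: gauge_class_mult d gauge_on_power mult.commute)
  qed
qed

lemma gauge_class_inv:
  assumes d: "gauge_on X d" shows "inv\<^bsub>Pic X\<^esub> gauge_class X d = gauge_class X (\<lambda>x z. 1 / d x z)"
proof -
  interpret comm_group "Pic X" by (rule comm_group_Pic)
  have "d x z \<noteq> 0" for x z using d unfolding gauge_on_def by auto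
  then have "gauge_class X (\<lambda>x z. 1 / d x z) \<otimes>\<^bsub>Pic X\<^esub> gauge_class X d = \<one>\<^bsub>Pic X\<^esub>"
    unfolding one_Pic by (simp add: gauge_class_mult d gauge_on_inverse[OF X])
  then show ?thesis
    by (rule inv_equality) (auto simp: carrier_Pic d gauge_on_inverse[OF X])
qed

lemma gauge_class_power_int:
  assumes d: "gauge_on X d"
  shows "gauge_class X d [^]\<^bsub>Pic X\<^esub> (n::int) = gauge_class X (\<lambda>x z. d x z powi n)"
proof -
  interpret comm_group "Pic X" by (rule comm_group_Pic)
  have c: "gauge_class X d \<in> carrier (Pic X)" using d unfolding carrier_Pic by blast
  show ?thesis
  proof (cases n rule: int_cases2)
    case (nonneg m)
    then show ?thesis by (simp add: int_pow_int gauge_class_power d)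
  next
    case (nonpos m)
    have "gauge_class X d [^]\<^bsub>Pic X\<^esub> (- int m) = inv\<^bsub>Pic X\<^esub> (gauge_class X d [^]\<^bsub>Pic X\<^esub> m)"
      using int_pow_neg[OF c, of "int m"] by (simp add: int_pow_int)
    then show ?thesis unfolding nonpos
      by (simp add: gauge_class_power d gauge_class_inv gauge_on_power power_int_minus inverse_eq_divide)
  qed
qed

text \<open>Turns the expansion of a class in a basis into a monomial of functions, the form in
  which the pullback of a basis class is compared with the basis.\<close>

lemma gauge_class_finprod:
  fixes r :: nat
  assumes d: "\<And>i. i < r \<Longrightarrow> gauge_on X (d i)"
  shows "finprod (Pic X) (\<lambda>i. gauge_class X (d i) [^]\<^bsub>Pic X\<^esub> (a i :: int)) {..<r} =
    gauge_class X (\<lambda>x z. \<Prod>i<r. d i x z powi a i)"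
proof -
  interpret comm_group "Pic X" by (rule comm_group_Pic)
  show ?thesis using d
  proof (induction r)
    case 0 then show ?case by (simp add: one_Pic)
  next
    case (Suc r)
    have "gauge_class X (d i) \<in> carrier (Pic X)" if "i < Suc r" for i
      using Suc.prems[OF that] unfolding carrier_Pic by blast
    then have "finprod (Pic X) (\<lambda>i. gauge_class X (d i) [^]\<^bsub>Pic X\<^esub> a i) {..<Suc r} =
      gauge_class X (d r) [^]\<^bsub>Pic X\<^esub> a r \<otimes>\<^bsub>Pic X\<^esub> finprod (Pic X) (\<lambda>i. gauge_class X (d i) [^]\<^bsub>Pic X\<^esub> a i) {..<r}"
      unfolding lessThan_Suc by (subst finprod_insert) auto
    also have "\<dots> = gauge_class X (\<lambda>x z. d r x z powi a r) \<otimes>\<^bsub>Pic X\<^esub> gauge_class X (\<lambda>x z. \<Prod>i<r. d i x z powi a i)"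
      using Suc by (simp add: gauge_class_power_int)
    also have "\<dots> = gauge_class X (\<lambda>x z. d r x z powi a r * (\<Prod>i<r. d i x z powi a i))"
      by (rule gauge_class_mult) (auto intro!: gauge_on_power_int gauge_on_prod Suc.prems)
    finally show ?case by (simp add: mult.commute)
  qed
qed

text \<open>Read off from the pullback of a bundle that realises \<open>d\<close>, instead of
  pulling back the neighbourhoods by hand.\<close>

lemma gauge_on_pullback:
  assumes \<gamma>: "morphism X X \<gamma>" and d: "gauge_on X d" shows "gauge_on X (\<lambda>x z. d (\<gamma> x) (\<gamma> z))"
proof -
  obtain L :: "('a, 'a \<times> complex) line_bundle" and e k where L: "framed X L e d k"
    by (rule gauge_on_framed[OF X d])
  show ?thesis by (rule framed.gauge[OF framed_pullback_bundle[OF L X \<gamma>]])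
qed

lemma principal_pullback:
  assumes \<gamma>: "morphism X X \<gamma>" and d: "principal X d" shows "principal X (\<lambda>x z. d (\<gamma> x) (\<gamma> z))"
proof -
  obtain h where h: "\<forall>z. h z \<noteq> 0" "\<forall>x\<in>points X. unit_at X x (\<lambda>z. h z * d x z)"
    using d unfolding principal_def by blast
  have "unit_at X x (\<lambda>z. h (\<gamma> z) * d (\<gamma> x) (\<gamma> z))" if "x \<in> points X" for x
    using unit_at_compose[OF X X \<gamma> h(2)[rule_format, OF morphism_points[OF \<gamma> that]] that] .
  with h(1) show ?thesis unfolding principal_def by (intro exI[of _ "\<lambda>z. h (\<gamma> z)"]) auto
qed

text \<open>\<open>pic_pullback\<close> unites the classes of the pullbacks of all representatives.
  These classes coincide because pullback preserves principal gauges, and the union is not over the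
  empty set because some bundle realises \<open>d\<close>.\<close>

lemma pic_pullback_gauge_class:
  assumes \<gamma>: "morphism X X \<gamma>" and d: "gauge_on X d"
  shows "pic_pullback X \<gamma> (gauge_class X d) = gauge_class X (\<lambda>x z. d (\<gamma> x) (\<gamma> z))"
proof -
  have "pic_class X (pullback_bundle X \<gamma> L) = gauge_class X (\<lambda>x z. d (\<gamma> x) (\<gamma> z))"
    if "L \<in> gauge_class X d" for L
  proof -
    obtain e' d' k' where L: "framed X L e' d' k'" "principal X (\<lambda>x z. d x z / d' x z)"
      using \<open>L \<in> gauge_class X d\<close> unfolding gauge_class_def by blast
    have "principal X (\<lambda>x z. d' x z / d x z)" using L(2) principal_swap by blast
    from principal_pullback[OF \<gamma> this] show ?thesis
      unfolding pic_class_framed[OF framed_pullback_bundle[OF L(1) X \<gamma>]]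
      by (rule gauge_class_eqI[OF gauge_on_pullback[OF \<gamma> framed.gauge[OF L(1)]] gauge_on_pullback[OF \<gamma> d]])
  qed
  moreover have "gauge_class X d \<noteq> {}"
  proof -
    obtain L :: "('a, 'a \<times> complex) line_bundle" and e k where L: "framed X L e d k"
      by (rule gauge_on_framed[OF X d])
    show ?thesis using framed_in_gauge_class[OF L] by blast
  qed
  ultimately show ?thesis unfolding pic_pullback_def by auto
qed

lemma pic_pullback_closed:
  assumes \<gamma>: "morphism X X \<gamma>" and \<alpha>: "\<alpha> \<in> carrier (Pic X)"
  shows "pic_pullback X \<gamma> \<alpha> \<in> carrier (Pic X)"
proof -
  obtain d where d: "gauge_on X d" "\<alpha> = gauge_class X d" using \<alpha> unfolding carrier_Pic by blast
  show ?thesis unfolding d(2) pic_pullback_gauge_class[OF \<gamma> d(1)] carrier_Pic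
    using gauge_on_pullback[OF \<gamma> d(1)] by blast
qed

lemma pic_pullback_mult:
  assumes \<gamma>: "morphism X X \<gamma>" and \<alpha>: "\<alpha> \<in> carrier (Pic X)" and \<beta>: "\<beta> \<in> carrier (Pic X)"
  shows "pic_pullback X \<gamma> (\<alpha> \<otimes>\<^bsub>Pic X\<^esub> \<beta>) = pic_pullback X \<gamma> \<alpha> \<otimes>\<^bsub>Pic X\<^esub> pic_pullback X \<gamma> \<beta>"
proof -
  obtain d where d: "gauge_on X d" "\<alpha> = gauge_class X d" using \<alpha> unfolding carrier_Pic by blast
  obtain d' where d': "gauge_on X d'" "\<beta> = gauge_class X d'" using \<beta> unfolding carrier_Pic by blast
  show ?thesis unfolding d(2) d'(2)
    by (simp add: pic_pullback_gauge_class \<gamma> d d' gauge_class_mult gauge_on_mult[OF X] gauge_on_pullback)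
qed

text \<open>Agreement of \<epsilon> with the composite is asked for on points only, because the
  product in \<open>Aut\<close> is an extensional composition.\<close>

lemma pic_pullback_compose:
  assumes \<gamma>: "morphism X X \<gamma>" and \<delta>: "morphism X X \<delta>" and \<epsilon>: "morphism X X \<epsilon>"
    and eq: "\<And>x. x \<in> points X \<Longrightarrow> \<epsilon> x = \<gamma> (\<delta> x)" and \<alpha>: "\<alpha> \<in> carrier (Pic X)"
  shows "pic_pullback X \<delta> (pic_pullback X \<gamma> \<alpha>) = pic_pullback X \<epsilon> \<alpha>"
proof -
  obtain d where d: "gauge_on X d" "\<alpha> = gauge_class X d" using \<alpha> unfolding carrier_Pic by blast
  have g: "gauge_on X (\<lambda>x z. d (\<gamma> (\<delta> x)) (\<gamma> (\<delta> z)))"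
    by (rule gauge_on_pullback[OF \<delta> gauge_on_pullback[OF \<gamma> d(1)]])
  show ?thesis unfolding d(2)
    by (simp add: pic_pullback_gauge_class \<gamma> \<delta> \<epsilon> d gauge_on_pullback)
       (rule gauge_class_cong[OF g gauge_on_pullback[OF \<epsilon> d(1)]], simp add: eq)
qed

lemma pic_pullback_id:
  assumes \<gamma>: "morphism X X \<gamma>" and eq: "\<And>x. x \<in> points X \<Longrightarrow> \<gamma> x = x" and \<alpha>: "\<alpha> \<in> carrier (Pic X)"
  shows "pic_pullback X \<gamma> \<alpha> = \<alpha>"
proof -
  obtain d where d: "gauge_on X d" "\<alpha> = gauge_class X d" using \<alpha> unfolding carrier_Pic by blast
  show ?thesis unfolding d(2) pic_pullback_gauge_class[OF \<gamma> d(1)]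
    by (rule gauge_class_cong[OF gauge_on_pullback[OF \<gamma> d(1)] d(1)]) (simp add: eq)
qed

end

section \<open>The Neron--Severi torus\<close>

locale torsor_setup =
  fixes X :: "'a fspace" and r :: nat and L :: "nat \<Rightarrow> ('a, 'l) line_bundle"
    and e :: "nat \<Rightarrow> 'a \<Rightarrow> 'l" and d :: "nat \<Rightarrow> 'a \<Rightarrow> 'a \<Rightarrow> complex" and k :: "nat \<Rightarrow> 'l \<Rightarrow> complex"
  assumes base: "space_with_functions X"
    and fr: "\<And>i. i < r \<Longrightarrow> framed X (L i) (e i) (d i) (k i)"
    and basis: "integral_basis (Pic X) r (\<lambda>i. pic_class X (L i))"
begin

abbreviation "b i \<equiv> pic_class X (L i)"
abbreviation "T \<equiv> NS_torus X"
abbreviation "C \<equiv> carrier (Pic X)"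

sublocale Pic: comm_group "Pic X" by (rule comm_group_Pic[OF base])

lemma b: "i < r \<Longrightarrow> b i \<in> C" "i < r \<Longrightarrow> b i = gauge_class X (d i)"
  using basis pic_class_framed[OF base fr] unfolding integral_basis_def by auto

section \<open>Coordinates of classes in the given basis\<close>

definition coord :: "('a, 'a \<times> complex) line_bundle set \<Rightarrow> nat \<Rightarrow> int" where
  "coord \<alpha> = (THE a. a \<in> extensional {..<r} \<and> \<alpha> = finprod (Pic X) (\<lambda>i. b i [^]\<^bsub>Pic X\<^esub> a i) {..<r})"

lemma coord:
  assumes "\<alpha> \<in> C"
  shows "coord \<alpha> \<in> extensional {..<r}" "\<alpha> = finprod (Pic X) (\<lambda>i. b i [^]\<^bsub>Pic X\<^esub> coord \<alpha> i) {..<r}"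
proof -
  have "\<exists>!a :: nat \<Rightarrow> int. a \<in> extensional {..<r} \<and> \<alpha> = finprod (Pic X) (\<lambda>i. b i [^]\<^bsub>Pic X\<^esub> a i) {..<r}"
    using basis assms unfolding integral_basis_def by blast
  from theI'[OF this] show "coord \<alpha> \<in> extensional {..<r}" "\<alpha> = finprod (Pic X) (\<lambda>i. b i [^]\<^bsub>Pic X\<^esub> coord \<alpha> i) {..<r}"
    unfolding coord_def by blast+
qed

text \<open>Exponents arising in computations are not extensional; restricting them to the index
  range leaves the product unchanged and restores uniqueness.\<close>

lemma coord_unique:
  assumes "\<alpha> = finprod (Pic X) (\<lambda>i. b i [^]\<^bsub>Pic X\<^esub> a i) {..<r}" "\<alpha> \<in> C" "i < r"
  shows "coord \<alpha> i = a i"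
proof -
  have ex: "\<exists>!a :: nat \<Rightarrow> int. a \<in> extensional {..<r} \<and> \<alpha> = finprod (Pic X) (\<lambda>i. b i [^]\<^bsub>Pic X\<^esub> a i) {..<r}"
    using basis assms(2) unfolding integral_basis_def by blast
  have "finprod (Pic X) (\<lambda>i. b i [^]\<^bsub>Pic X\<^esub> a i) {..<r} = finprod (Pic X) (\<lambda>i. b i [^]\<^bsub>Pic X\<^esub> restrict a {..<r} i) {..<r}"
    by (rule Pic.finprod_cong') (use b in auto)
  then have "restrict a {..<r} \<in> extensional {..<r} \<and> \<alpha> = finprod (Pic X) (\<lambda>i. b i [^]\<^bsub>Pic X\<^esub> restrict a {..<r} i) {..<r}"
    using assms(1) by simp
  then have "coord \<alpha> = restrict a {..<r}" unfolding coord_def by (rule the1_equality[OF ex])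
  then show ?thesis using assms(3) by simp
qed

lemma coord_mult:
  assumes "\<alpha> \<in> C" "\<beta> \<in> C" "i < r" shows "coord (\<alpha> \<otimes>\<^bsub>Pic X\<^esub> \<beta>) i = coord \<alpha> i + coord \<beta> i"
proof (rule coord_unique[OF _ _ assms(3)])
  show "\<alpha> \<otimes>\<^bsub>Pic X\<^esub> \<beta> \<in> C" using assms by simp
  have "\<alpha> \<otimes>\<^bsub>Pic X\<^esub> \<beta> = finprod (Pic X) (\<lambda>i. b i [^]\<^bsub>Pic X\<^esub> coord \<alpha> i) {..<r} \<otimes>\<^bsub>Pic X\<^esub>
    finprod (Pic X) (\<lambda>i. b i [^]\<^bsub>Pic X\<^esub> coord \<beta> i) {..<r}"
    using coord(2)[OF assms(1)] coord(2)[OF assms(2)] by simp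
  also have "\<dots> = finprod (Pic X) (\<lambda>i. b i [^]\<^bsub>Pic X\<^esub> coord \<alpha> i \<otimes>\<^bsub>Pic X\<^esub> b i [^]\<^bsub>Pic X\<^esub> coord \<beta> i) {..<r}"
    by (rule Pic.finprod_multf[symmetric]) (use b in auto)
  also have "\<dots> = finprod (Pic X) (\<lambda>i. b i [^]\<^bsub>Pic X\<^esub> (coord \<alpha> i + coord \<beta> i)) {..<r}"
    by (rule Pic.finprod_cong') (use b in \<open>auto simp: Pic.int_pow_mult\<close>)
  finally show "\<alpha> \<otimes>\<^bsub>Pic X\<^esub> \<beta> = finprod (Pic X) (\<lambda>i. b i [^]\<^bsub>Pic X\<^esub> (coord \<alpha> i + coord \<beta> i)) {..<r}" .
qed

lemma coord_basis: "i < r \<Longrightarrow> j < r \<Longrightarrow> coord (b i) j = (if j = i then 1 else 0)"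
proof (rule coord_unique)
  assume i: "i < r"
  have "finprod (Pic X) (\<lambda>j. b j [^]\<^bsub>Pic X\<^esub> (if j = i then 1 else 0 :: int)) {..<r} =
    finprod (Pic X) (\<lambda>j. if i = j then b j else \<one>\<^bsub>Pic X\<^esub>) {..<r}"
    by (rule Pic.finprod_cong') (use b in auto)
  also have "\<dots> = b i" by (rule Pic.finprod_singleton) (use i b in auto)
  finally show "b i = finprod (Pic X) (\<lambda>j. b j [^]\<^bsub>Pic X\<^esub> (if j = i then 1 else 0 :: int)) {..<r}" by simp
  show "b i \<in> C" using i b by simp
qed

text \<open>For \<open>c\<close> without zeros, the homomorphism with prescribed values on the
  basis: the inverse of the coordinate isomorphism from the torus to a power of the multiplicative
  group.\<close>

definition torus_point :: "(nat \<Rightarrow> complex) \<Rightarrow> ('a, 'a \<times> complex) line_bundle set \<Rightarrow> complex" where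
  "torus_point c = (\<lambda>\<alpha>\<in>C. \<Prod>i<r. c i powi coord \<alpha> i)"

lemma torus_mult: "t \<in> T \<Longrightarrow> \<alpha> \<in> C \<Longrightarrow> \<beta> \<in> C \<Longrightarrow> t (\<alpha> \<otimes>\<^bsub>Pic X\<^esub> \<beta>) = t \<alpha> * t \<beta>"
  unfolding NS_torus_def hom_def Gm_def by auto

lemma torus_nonzero: "t \<in> T \<Longrightarrow> \<alpha> \<in> C \<Longrightarrow> t \<alpha> \<noteq> 0"
  unfolding NS_torus_def hom_def Gm_def by auto

lemma torusI:
  assumes "\<And>\<alpha>. \<alpha> \<in> C \<Longrightarrow> t \<alpha> \<noteq> 0"
    and "\<And>\<alpha> \<beta>. \<alpha> \<in> C \<Longrightarrow> \<beta> \<in> C \<Longrightarrow> t (\<alpha> \<otimes>\<^bsub>Pic X\<^esub> \<beta>) = t \<alpha> * t \<beta>"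
    and "t \<in> extensional C"
  shows "t \<in> T"
  using assms unfolding NS_torus_def hom_def Gm_def by auto

lemma torus_one: assumes "t \<in> T" shows "t \<one>\<^bsub>Pic X\<^esub> = 1"
  using torus_mult[OF assms Pic.one_closed Pic.one_closed] torus_nonzero[OF assms Pic.one_closed] by simp

lemma torus_power: "t \<in> T \<Longrightarrow> \<alpha> \<in> C \<Longrightarrow> t (\<alpha> [^]\<^bsub>Pic X\<^esub> (n::nat)) = t \<alpha> ^ n"
  by (induction n) (auto simp: torus_one torus_mult)

lemma torus_inv: "t \<in> T \<Longrightarrow> \<alpha> \<in> C \<Longrightarrow> t (inv\<^bsub>Pic X\<^esub> \<alpha>) = inverse (t \<alpha>)"
  using torus_mult[of t \<alpha> "inv\<^bsub>Pic X\<^esub> \<alpha>"] torus_one[of t] inverse_unique[of "t \<alpha>" "t (inv\<^bsub>Pic X\<^esub> \<alpha>)"]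
  by simp

lemma torus_power_int: "t \<in> T \<Longrightarrow> \<alpha> \<in> C \<Longrightarrow> t (\<alpha> [^]\<^bsub>Pic X\<^esub> (n::int)) = t \<alpha> powi n"
  by (cases n rule: int_cases2)
     (simp_all add: int_pow_int Pic.int_pow_neg torus_power torus_inv power_int_minus)

lemma torus_finprod:
  fixes n :: nat
  assumes t: "t \<in> T"
  shows "(\<And>i. i < n \<Longrightarrow> f i \<in> C) \<Longrightarrow> t (finprod (Pic X) f {..<n}) = (\<Prod>i<n. t (f i))"
proof (induction n)
  case 0 then show ?case by (simp add: torus_one t)
next
  case (Suc n)
  have "finprod (Pic X) f {..<Suc n} = f n \<otimes>\<^bsub>Pic X\<^esub> finprod (Pic X) f {..<n}"
    unfolding lessThan_Suc by (subst Pic.finprod_insert) (use Suc.prems in auto)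
  moreover have "finprod (Pic X) f {..<n} \<in> C" by (rule Pic.finprod_closed) (use Suc.prems in auto)
  ultimately show ?case using Suc by (simp add: torus_mult t mult.commute)
qed

lemma torus_expand: "t \<in> T \<Longrightarrow> \<alpha> \<in> C \<Longrightarrow> t \<alpha> = (\<Prod>i<r. t (b i) powi coord \<alpha> i)"
  using torus_finprod[of t r "\<lambda>i. b i [^]\<^bsub>Pic X\<^esub> coord \<alpha> i"] coord(2)[of \<alpha>] b
  by (simp add: torus_power_int)

lemma torus_eqI:
  assumes "s \<in> T" "t \<in> T" "\<And>i. i < r \<Longrightarrow> s (b i) = t (b i)" shows "s = t"
proof (rule extensionalityI[of s C])
  show "s \<in> extensional C" "t \<in> extensional C" using assms unfolding NS_torus_def by auto
  show "s \<alpha> = t \<alpha>" if "\<alpha> \<in> C" for \<alpha>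
    unfolding torus_expand[OF assms(1) that] torus_expand[OF assms(2) that]
    by (rule prod.cong) (simp_all add: assms(3))
qed

lemma torus_point_basis: "i < r \<Longrightarrow> torus_point c (b i) = c i"
proof -
  assume i: "i < r"
  have "torus_point c (b i) = (\<Prod>j<r. if j = i then c i else 1)"
  proof -
    have "torus_point c (b i) = (\<Prod>j<r. c j powi coord (b i) j)"
      unfolding torus_point_def using b(1)[OF i] by simp
    also have "\<dots> = (\<Prod>j<r. if j = i then c i else 1)"
      by (rule prod.cong) (auto simp: coord_basis i)
    finally show ?thesis .
  qed
  also have "\<dots> = c i" using i by simp
  finally show ?thesis .
qed

lemma torus_point: 
  assumes "\<And>i. i < r \<Longrightarrow> c i \<noteq> 0" shows "torus_point c \<in> T"
proof (rule torusI)
  show "torus_point c \<alpha> \<noteq> 0" if "\<alpha> \<in> C" for \<alpha> using that assms unfolding torus_point_def by simp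
  show "torus_point c \<in> extensional C" unfolding torus_point_def by simp
  show "torus_point c (\<alpha> \<otimes>\<^bsub>Pic X\<^esub> \<beta>) = torus_point c \<alpha> * torus_point c \<beta>" if "\<alpha> \<in> C" "\<beta> \<in> C" for \<alpha> \<beta>
  proof -
    have "(\<Prod>i<r. c i powi coord (\<alpha> \<otimes>\<^bsub>Pic X\<^esub> \<beta>) i) = (\<Prod>i<r. c i powi coord \<alpha> i * c i powi coord \<beta> i)"
      by (rule prod.cong[OF refl]) (use assms that in \<open>auto simp: coord_mult power_int_add\<close>)
    then show ?thesis using that unfolding torus_point_def by (simp add: prod.distrib)
  qed
qed

section \<open>Multiplication, inversion and pushforward on the torus\<close>

definition tmul where "tmul s t = (\<lambda>\<alpha>\<in>C. s \<alpha> * t \<alpha> :: complex)"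
definition tinv where "tinv t = (\<lambda>\<alpha>\<in>C. 1 / t \<alpha> :: complex)"

lemma tmul: "s \<in> T \<Longrightarrow> t \<in> T \<Longrightarrow> tmul s t \<in> T"
  by (rule torusI) (auto simp: tmul_def torus_nonzero torus_mult)

lemma tinv: "t \<in> T \<Longrightarrow> tinv t \<in> T"
  by (rule torusI) (auto simp: tinv_def torus_nonzero torus_mult)

lemma tmul_apply: "\<alpha> \<in> C \<Longrightarrow> tmul s t \<alpha> = s \<alpha> * t \<alpha>" by (simp add: tmul_def)
lemma tinv_apply: "\<alpha> \<in> C \<Longrightarrow> tinv t \<alpha> = 1 / t \<alpha>" by (simp add: tinv_def)

abbreviation "pf \<equiv> torus_pushforward X"

lemma pf_apply: "\<alpha> \<in> C \<Longrightarrow> pf \<gamma> t \<alpha> = t (pic_pullback X \<gamma> \<alpha>)"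
  by (simp add: torus_pushforward_def)

lemma pf: "morphism X X \<gamma> \<Longrightarrow> t \<in> T \<Longrightarrow> pf \<gamma> t \<in> T"
  by (rule torusI)
     (auto simp: torus_pushforward_def torus_nonzero torus_mult pic_pullback_closed[OF base] pic_pullback_mult[OF base])

lemma pf_mult: "morphism X X \<gamma> \<Longrightarrow> pf \<gamma> (tmul s t) = tmul (pf \<gamma> s) (pf \<gamma> t)"
  by (auto simp: torus_pushforward_def tmul_def pic_pullback_closed[OF base])

text \<open>Pullback of classes reverses the order of composition, and evaluating torus elements on
  pulled back classes reverses it again; hence pushforward is covariant.\<close>

lemma pf_compose:
  assumes "morphism X X \<gamma>" "morphism X X \<delta>" "morphism X X \<epsilon>" "\<And>x. x \<in> points X \<Longrightarrow> \<epsilon> x = \<gamma> (\<delta> x)"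
  shows "pf \<gamma> (pf \<delta> t) = pf \<epsilon> t"
  using pic_pullback_compose[OF base assms] pic_pullback_closed[OF base assms(1)]
  by (auto simp: torus_pushforward_def)

lemma pf_id:
  assumes "morphism X X \<gamma>" "\<And>x. x \<in> points X \<Longrightarrow> \<gamma> x = x" "t \<in> T" shows "pf \<gamma> t = t"
proof (rule torus_eqI[OF pf[OF assms(1,3)] assms(3)])
  fix i assume "i < r"
  then show "pf \<gamma> t (b i) = t (b i)"
    using pic_pullback_id[OF base assms(1,2) b(1)] b(1) by (simp add: torus_pushforward_def)
qed

end

context torsor_setup
begin

section \<open>The universal torsor\<close>

abbreviation "U \<equiv> bundle_torsor X r L"
abbreviation "US \<equiv> torsor_space U"

definition S where "S = {(x, u). x \<in> points X \<and> u \<in> (\<Pi>\<^sub>E i\<in>{..<r}. nonzero_vectors (L i)) \<and>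
  (\<forall>i<r. bundle_proj (L i) (u i) = x)}"

definition G where "G = pulled_back S fst X \<union> (\<Union>i<r. pulled_back S (\<lambda>p. snd p i) (bundle_space (L i)))"

lemma US_def: "US = initial_space S G"
  unfolding bundle_torsor_def S_def G_def Let_def by simp

lemma torsor_proj: "torsor_proj U = fst"
  unfolding bundle_torsor_def Let_def by simp

lemma torsor_act: "torsor_act U t p = (fst p, \<lambda>i\<in>{..<r}. scalar (L i) (t (b i)) (snd p i))"
  unfolding bundle_torsor_def Let_def by (simp add: case_prod_beta)

lemma G_dom: "(D, f) \<in> G \<Longrightarrow> D \<subseteq> S"
  unfolding G_def by (auto dest: pulled_back_dom)

lemma swf_US: "space_with_functions US"
  unfolding US_def by (rule swf_initial_space) (rule G_dom)

lemma points_US: "points US = S"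
  unfolding US_def zariski_initial_space by (rule topspace_initial) (rule G_dom)

lemma S_proj: "p \<in> S \<Longrightarrow> fst p \<in> points X"
  unfolding S_def by auto

lemma S_factor:
  assumes "p \<in> S" "i < r"
  shows "snd p i \<in> points (bundle_space (L i))" "bundle_proj (L i) (snd p i) = fst p" "k i (snd p i) \<noteq> 0"
  using assms framed.nonzero_vectors[OF fr[OF assms(2)]] unfolding S_def by auto

lemma morphism_US_iff:
  assumes Z: "space_with_functions Z"
  shows "morphism Z US F \<longleftrightarrow> F \<in> points Z \<rightarrow> S \<and> morphism Z X (\<lambda>z. fst (F z)) \<and>
    (\<forall>i<r. morphism Z (bundle_space (L i)) (\<lambda>z. snd (F z) i))"
proof -
  have "morphism Z US F \<longleftrightarrow> F \<in> points Z \<rightarrow> S \<and> (\<forall>(D, g)\<in>G. (\<lambda>z. g (F z)) \<in> regular Z {z\<in>points Z. F z \<in> D})"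
    unfolding US_def by (rule morphism_initial_space_iff[OF _ Z]) (rule G_dom)
  also have "\<dots> \<longleftrightarrow> F \<in> points Z \<rightarrow> S \<and> morphism Z X (\<lambda>z. fst (F z)) \<and>
    (\<forall>i<r. morphism Z (bundle_space (L i)) (\<lambda>z. snd (F z) i))"
  proof (rule conj_cong[OF refl])
    assume F: "F \<in> points Z \<rightarrow> S"
    have 1: "fst \<in> S \<rightarrow> points X" using S_proj by auto
    have 2: "(\<lambda>p. snd p i) \<in> S \<rightarrow> points (bundle_space (L i))" if "i < r" for i
      using S_factor(1) that by auto
    have "(\<forall>(D, g)\<in>G. (\<lambda>z. g (F z)) \<in> regular Z {z\<in>points Z. F z \<in> D}) \<longleftrightarrow>
      (\<forall>(D, g)\<in>pulled_back S fst X. (\<lambda>z. g (F z)) \<in> regular Z {z\<in>points Z. F z \<in> D}) \<and>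
      (\<forall>i<r. \<forall>(D, g)\<in>pulled_back S (\<lambda>p. snd p i) (bundle_space (L i)).
        (\<lambda>z. g (F z)) \<in> regular Z {z\<in>points Z. F z \<in> D})"
      unfolding G_def ball_Un UN_ball_bex_simps by auto
    then show "(\<forall>(D, g)\<in>G. (\<lambda>z. g (F z)) \<in> regular Z {z\<in>points Z. F z \<in> D}) \<longleftrightarrow> morphism Z X (\<lambda>z. fst (F z)) \<and>
      (\<forall>i<r. morphism Z (bundle_space (L i)) (\<lambda>z. snd (F z) i))"
      unfolding morphism_pulled_back_iff[OF Z base F 1]
      using morphism_pulled_back_iff[OF Z framed.total[OF fr] F 2] by simp
  qed
  finally show ?thesis .
qed

lemma morphism_US_proj: "morphism US X fst" "i < r \<Longrightarrow> morphism US (bundle_space (L i)) (\<lambda>p. snd p i)"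
  using morphism_id[OF swf_US] unfolding morphism_US_iff[OF swf_US] by auto

section \<open>Torsor points as pairs of a base point and a torus element\<close>

definition pt where "pt x t = (x, \<lambda>i\<in>{..<r}. scalar (L i) (t (b i)) (e i x))"
definition tau where "tau p = torus_point (\<lambda>i. k i (snd p i))"

lemma fst_pt [simp]: "fst (pt x t) = x" by (simp add: pt_def)

lemma coeff_pt: "x \<in> points X \<Longrightarrow> i < r \<Longrightarrow> k i (snd (pt x t) i) = t (b i)"
  using framed.coeff_frame[OF fr] by (simp add: pt_def)

lemma pt_in_S: assumes x: "x \<in> points X" and t: "t \<in> T" shows "pt x t \<in> S"
proof -
  have "scalar (L i) (t (b i)) (e i x) \<in> nonzero_vectors (L i)" "bundle_proj (L i) (scalar (L i) (t (b i)) (e i x)) = x"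
    if i: "i < r" for i
  proof -
    interpret framed X "L i" "e i" "d i" "k i" by (rule fr[OF i])
    show "scalar (L i) (t (b i)) (e i x) \<in> nonzero_vectors (L i)" "bundle_proj (L i) (scalar (L i) (t (b i)) (e i x)) = x"
      unfolding nonzero_vectors using scalar frame x coeff_frame torus_nonzero[OF t b(1)[OF i]] by auto
  qed
  with x show ?thesis unfolding S_def pt_def by auto
qed

lemma tau: "p \<in> S \<Longrightarrow> tau p \<in> T"
  unfolding tau_def by (rule torus_point) (rule S_factor(3))

lemma tau_basis: "i < r \<Longrightarrow> tau p (b i) = k i (snd p i)"
  unfolding tau_def by (rule torus_point_basis)

lemma tau_pt: "x \<in> points X \<Longrightarrow> t \<in> T \<Longrightarrow> tau (pt x t) = t"
  by (rule torus_eqI[OF tau[OF pt_in_S]]) (simp_all add: tau_basis coeff_pt)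

lemma pt_tau: assumes p: "p \<in> S" shows "pt (fst p) (tau p) = p"
proof (rule prod_eqI)
  show "snd (pt (fst p) (tau p)) = snd p"
  proof (rule extensionalityI[of _ "{..<r}"])
    show "snd (pt (fst p) (tau p)) \<in> extensional {..<r}" by (simp add: pt_def)
    show "snd p \<in> extensional {..<r}" using p unfolding S_def by (auto simp: PiE_def)
    fix i assume "i \<in> {..<r}"
    then have i: "i < r" by simp
    show "snd (pt (fst p) (tau p)) i = snd p i"
      using framed.coeff[OF fr[OF i] S_factor(1)[OF p i]] i by (simp add: pt_def tau_basis S_factor[OF p i])
  qed
qed simp

lemma act_pt:
  assumes x: "x \<in> points X" and s: "s \<in> T" and t: "t \<in> T"
  shows "torsor_act U s (pt x t) = pt x (tmul s t)"
  unfolding torsor_act using framed.scalar_frame[OF fr x] b(1)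
  by (auto simp: pt_def tmul_apply)

text \<open>The gauges of all \<open>L i\<close> as one torus-valued family. Its value at a class
  \<alpha> is the monomial in the \<open>d i\<close> with the coordinates of \<alpha> as exponents,
  which is a gauge for \<alpha>.\<close>

definition D where "D x z = torus_point (\<lambda>i. d i x z)"

lemma D: "D x z \<in> T"
  unfolding D_def by (rule torus_point) (rule framed.nonzero[OF fr])

lemma D_basis: "i < r \<Longrightarrow> D x z (b i) = d i x z"
  unfolding D_def by (rule torus_point_basis)

definition tunit where "tunit x H \<longleftrightarrow> (\<forall>i<r. unit_at X x (\<lambda>z. H z (b i)))"

text \<open>Every character is a monomial in the basis characters with exponents of either sign.
  Units are closed under such monomials, regular functions are not; hence the insistence on
  units.\<close>

lemma tunit_char:
  assumes H: "\<And>z. H z \<in> T" and u: "tunit x H" and x: "x \<in> points X" and \<alpha>: "\<alpha> \<in> C"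
  shows "unit_at X x (\<lambda>z. H z \<alpha>)"
  unfolding torus_expand[OF H \<alpha>]
  by (rule unit_at_prod[OF base x unit_at_power_int[OF base]]) (use u in \<open>auto simp: tunit_def\<close>)

text \<open>
  Compatibility of \<open>F\<close> with \<open>\<gamma>\<close> says that in local coordinates the map sending \<open>t \<cdot> e x\<close> to
  \<open>F x \<cdot> \<gamma>\<^sub>* t \<cdot> e (\<gamma> x)\<close> is regular.
\<close>

definition discrepancy where
  "discrepancy \<gamma> F x z = tmul (F z) (tmul (D (\<gamma> x) (\<gamma> z)) (tinv (pf \<gamma> (D x z))))"

definition compatible where
  "compatible \<gamma> F \<longleftrightarrow> (\<forall>z. F z \<in> T) \<and> (\<forall>x\<in>points X. tunit x (discrepancy \<gamma> F x))"

definition lift where "lift \<gamma> F p = pt (\<gamma> (fst p)) (tmul (F (fst p)) (pf \<gamma> (tau p)))"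

section \<open>Compatible functions and the regularity of their lifts\<close>

lemma discrepancy: "morphism X X \<gamma> \<Longrightarrow> F z \<in> T \<Longrightarrow> discrepancy \<gamma> F x z \<in> T"
  unfolding discrepancy_def by (intro tmul tinv pf D)

lemma discrepancy_apply:
  "\<alpha> \<in> C \<Longrightarrow> discrepancy \<gamma> F x z \<alpha> = F z \<alpha> * D (\<gamma> x) (\<gamma> z) \<alpha> / D x z (pic_pullback X \<gamma> \<alpha>)"
  unfolding discrepancy_def by (simp add: tmul_apply tinv_apply pf_apply)

lemma discrepancy_char:
  assumes "morphism X X \<gamma>" "compatible \<gamma> F" "x \<in> points X" "\<alpha> \<in> C"
  shows "unit_at X x (\<lambda>z. F z \<alpha> * D (\<gamma> x) (\<gamma> z) \<alpha> / D x z (pic_pullback X \<gamma> \<alpha>))"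
  using tunit_char[of "discrepancy \<gamma> F x" x \<alpha>] assms discrepancy
  unfolding compatible_def by (simp add: discrepancy_apply)

text \<open>The class \<open>\<gamma>\<^sup>* (b i)\<close> has the gauge \<open>d i\<close>
  composed with \<gamma> and, by its expansion in the basis, also the gauge \<open>D\<close>
  evaluated at that class. Equality of the classes makes the quotient principal, and a function
  \<open>h\<close> witnessing this becomes the value of \<open>F\<close> at
  \<open>b i\<close>.\<close>

lemma compatible_exists:
  assumes \<gamma>: "morphism X X \<gamma>"
  obtains F where "compatible \<gamma> F"
proof -
  have "\<exists>h. (\<forall>z. h z \<noteq> 0) \<and> (\<forall>x\<in>points X. unit_at X x (\<lambda>z. h z * (d i (\<gamma> x) (\<gamma> z) / D x z (pic_pullback X \<gamma> (b i)))))"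
    if i: "i < r" for i
  proof -
    let ?\<alpha> = "pic_pullback X \<gamma> (b i)"
    have \<alpha>: "?\<alpha> \<in> C" by (rule pic_pullback_closed[OF base \<gamma> b(1)[OF i]])
    have g: "gauge_on X (d j)" if "j < r" for j by (rule framed.gauge[OF fr[OF that]])
    have g': "gauge_on X (\<lambda>x z. \<Prod>j<r. d j x z powi coord ?\<alpha> j)"
      by (rule gauge_on_prod[OF base gauge_on_power_int[OF base g]])
    have 1: "?\<alpha> = gauge_class X (\<lambda>x z. d i (\<gamma> x) (\<gamma> z))"
      using pic_pullback_gauge_class[OF base \<gamma> g[OF i]] b(2)[OF i] by simp
    have "?\<alpha> = finprod (Pic X) (\<lambda>j. b j [^]\<^bsub>Pic X\<^esub> coord ?\<alpha> j) {..<r}" by (rule coord(2)[OF \<alpha>])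
    also have "\<dots> = finprod (Pic X) (\<lambda>j. gauge_class X (d j) [^]\<^bsub>Pic X\<^esub> coord ?\<alpha> j) {..<r}"
      by (rule Pic.finprod_cong') (use b in auto)
    also have "\<dots> = gauge_class X (\<lambda>x z. \<Prod>j<r. d j x z powi coord ?\<alpha> j)"
      by (rule gauge_class_finprod[OF base g])
    finally have "gauge_class X (\<lambda>x z. d i (\<gamma> x) (\<gamma> z)) = gauge_class X (\<lambda>x z. \<Prod>j<r. d j x z powi coord ?\<alpha> j)"
      using 1 by simp
    from gauge_class_eqD[OF base gauge_on_pullback[OF base \<gamma> g[OF i]] g' this]
    have "principal X (\<lambda>x z. d i (\<gamma> x) (\<gamma> z) / D x z ?\<alpha>)"
      unfolding D_def torus_point_def using \<alpha> by simp
    then show ?thesis unfolding principal_def .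
  qed
  then have "\<forall>i\<in>{..<r}. \<exists>h. (\<forall>z. h z \<noteq> 0) \<and> (\<forall>x\<in>points X. unit_at X x (\<lambda>z. h z * (d i (\<gamma> x) (\<gamma> z) / D x z (pic_pullback X \<gamma> (b i)))))"
    by simp
  from bchoice[OF this] obtain h where h: "\<forall>i\<in>{..<r}. (\<forall>z. h i z \<noteq> 0) \<and>
    (\<forall>x\<in>points X. unit_at X x (\<lambda>z. h i z * (d i (\<gamma> x) (\<gamma> z) / D x z (pic_pullback X \<gamma> (b i)))))"
    by (elim exE)
  define F where "F z = torus_point (\<lambda>i. h i z)" for z
  have F: "F z \<in> T" for z unfolding F_def by (rule torus_point) (use h in auto)
  have "tunit x (discrepancy \<gamma> F x)" if "x \<in> points X" for x
    using h that b(1) by (simp add: tunit_def discrepancy_apply D_basis F_def torus_point_basis)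
  with F have "compatible \<gamma> F" unfolding compatible_def by blast
  then show thesis by (rule that)
qed

text \<open>A constant factor is a unit in every character; this is the freedom that the
  normalisation will spend.\<close>

lemma compatible_scale:
  assumes \<gamma>: "morphism X X \<gamma>" and F: "compatible \<gamma> F" and c: "c \<in> T"
  shows "compatible \<gamma> (\<lambda>z. tmul c (F z))"
  unfolding compatible_def
proof (intro conjI allI ballI)
  show "tmul c (F z) \<in> T" for z using F c tmul unfolding compatible_def by blast
  fix x assume x: "x \<in> points X"
  show "tunit x (discrepancy \<gamma> (\<lambda>z. tmul c (F z)) x)"
    unfolding tunit_def
  proof (intro allI impI)
    fix i assume i: "i < r"
    have "unit_at X x (\<lambda>z. c (b i) * (F z (b i) * D (\<gamma> x) (\<gamma> z) (b i) / D x z (pic_pullback X \<gamma> (b i))))"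
      by (rule unit_at_mult[OF base unit_at_const[OF base x torus_nonzero[OF c b(1)[OF i]]]
            discrepancy_char[OF \<gamma> F x b(1)[OF i]]])
    then show "unit_at X x (\<lambda>z. discrepancy \<gamma> (\<lambda>z. tmul c (F z)) x z (b i))"
      using b(1)[OF i] by (simp add: discrepancy_apply tmul_apply mult.assoc)
  qed
qed

lemma lift_in_S: "morphism X X \<gamma> \<Longrightarrow> F (fst p) \<in> T \<Longrightarrow> p \<in> S \<Longrightarrow> lift \<gamma> F p \<in> S"
  unfolding lift_def by (intro pt_in_S morphism_points[of X X \<gamma>] S_proj tmul pf tau)

lemma lift_pt:
  "x \<in> points X \<Longrightarrow> t \<in> T \<Longrightarrow> lift \<gamma> F (pt x t) = pt (\<gamma> x) (tmul (F x) (pf \<gamma> t))"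
  unfolding lift_def by (simp add: tau_pt)

text \<open>In the charts at \<open>x\<close> and \<open>\<gamma> x\<close> the \<open>i\<close>-th
  coordinate of the lift is the discrepancy at \<open>b i\<close> times the monomial for
  \<open>\<gamma>\<^sup>* (b i)\<close> in the chart coordinates of the torsor point. Neither
  \<open>F\<close> nor \<open>tau\<close> need be regular; the irregular factors \<open>D\<close>
  cancel in the product.\<close>

lemma lift_morphism:
  assumes \<gamma>: "morphism X X \<gamma>" and F: "compatible \<gamma> F"
  shows "morphism US US (lift \<gamma> F)"
  unfolding morphism_US_iff[OF swf_US]
proof (intro conjI allI impI)
  have FT: "F z \<in> T" for z using F unfolding compatible_def by blast
  have S: "lift \<gamma> F p \<in> S" if "p \<in> S" for p by (rule lift_in_S[OF \<gamma> FT that])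
  show "lift \<gamma> F \<in> points US \<rightarrow> S" using S points_US by auto
  have mf: "morphism US X (\<lambda>p. fst (lift \<gamma> F p))"
    unfolding lift_def fst_pt by (rule morphism_compose[OF morphism_US_proj(1) \<gamma>])
  then show "morphism US X (\<lambda>p. fst (lift \<gamma> F p))" .
  fix i assume i: "i < r"
  show "morphism US (bundle_space (L i)) (\<lambda>p. snd (lift \<gamma> F p) i)"
  proof (rule framed.morphism_into[OF fr[OF i] swf_US])
    show "snd (lift \<gamma> F p) i \<in> points (bundle_space (L i))" if "p \<in> points US" for p
      using S_factor(1)[OF S i] that points_US by simp
    show "morphism US X (\<lambda>p. bundle_proj (L i) (snd (lift \<gamma> F p) i))"
      by (rule morphism_cong[OF swf_US mf]) (use S_factor(2)[OF S i] points_US in simp)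
    fix p assume "p \<in> points US"
    then have p: "p \<in> S" "p \<in> points US" using points_US by auto
    let ?x = "fst p" and ?\<alpha> = "pic_pullback X \<gamma> (b i)"
    have x: "?x \<in> points X" by (rule S_proj[OF p(1)])
    have \<alpha>: "?\<alpha> \<in> C" by (rule pic_pullback_closed[OF base \<gamma> b(1)[OF i]])
    \<comment> \<open>The exponents \<open>coord ?\<alpha> j\<close> may be negative, so the chart
      coordinates are needed as units. They are units because the torsor consists of nonzero
      vectors.\<close>
    have "unit_at US p (\<lambda>q. k j (snd q j) * d j ?x (fst q))" if j: "j < r" for j
    proof -
      obtain V where V: "openin (zariski X) V" "?x \<in> V"
        "(\<lambda>l. k j l * d j ?x (bundle_proj (L j) l)) \<in> regular (bundle_space (L j))
          {l \<in> points (bundle_space (L j)). bundle_proj (L j) l \<in> V}"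
        by (rule framed.local_section[OF fr[OF j] x])
      show ?thesis
      proof (rule unit_atI[OF swf_US])
        show "(\<lambda>q. k j (snd q j) * d j ?x (fst q)) \<in> regular US
          {q \<in> points US. snd q j \<in> {l \<in> points (bundle_space (L j)). bundle_proj (L j) l \<in> V}}"
          by (rule regular_cong[OF swf_US morphism_regular[OF morphism_US_proj(2)[OF j] V(3)]])
             (use S_factor(2)[OF _ j] points_US in auto)
        show "p \<in> {q \<in> points US. snd q j \<in> {l \<in> points (bundle_space (L j)). bundle_proj (L j) l \<in> V}}"
          using p V(2) S_factor[OF p(1) j] by auto
        show "k j (snd p j) * d j ?x (fst p) \<noteq> 0" using S_factor(3)[OF p(1) j] framed.nonzero[OF fr[OF j]] by simp
      qed
    qed
    then have "unit_at US p (\<lambda>q. \<Prod>j<r. (k j (snd q j) * d j ?x (fst q)) powi coord ?\<alpha> j)"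
      by (intro unit_at_prod[OF swf_US p(2)] unit_at_power_int[OF swf_US])
    moreover have "unit_at US p (\<lambda>q. F (fst q) (b i) * D (\<gamma> ?x) (\<gamma> (fst q)) (b i) / D ?x (fst q) ?\<alpha>)"
      by (rule unit_at_compose[OF base swf_US morphism_US_proj(1) discrepancy_char[OF \<gamma> F x b(1)[OF i]] p(2)])
    ultimately have "unit_at US p (\<lambda>q. (\<Prod>j<r. (k j (snd q j) * d j ?x (fst q)) powi coord ?\<alpha> j) *
       (F (fst q) (b i) * D (\<gamma> ?x) (\<gamma> (fst q)) (b i) / D ?x (fst q) ?\<alpha>))"
      by (rule unit_at_mult[OF swf_US])
    then obtain N where N: "p \<in> N" "(\<lambda>q. (\<Prod>j<r. (k j (snd q j) * d j ?x (fst q)) powi coord ?\<alpha> j) *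
       (F (fst q) (b i) * D (\<gamma> ?x) (\<gamma> (fst q)) (b i) / D ?x (fst q) ?\<alpha>)) \<in> regular US N"
      unfolding unit_at_def by blast
    have "(\<lambda>q. k i (snd (lift \<gamma> F q) i) * d i (bundle_proj (L i) (snd (lift \<gamma> F p) i))
       (bundle_proj (L i) (snd (lift \<gamma> F q) i))) \<in> regular US N"
    proof (rule regular_cong[OF swf_US N(2)])
      fix q assume "q \<in> N"
      then have q: "q \<in> S" using openin_subset[OF regular_openin[OF swf_US N(2)]] points_US by auto
      have 1: "k i (snd (lift \<gamma> F q) i) = F (fst q) (b i) * tau q ?\<alpha>"
        unfolding lift_def using coeff_pt[OF morphism_points[OF \<gamma> S_proj[OF q]] i] b(1)[OF i]
        by (simp add: tmul_apply pf_apply)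
      have 2: "tau q ?\<alpha> * D ?x (fst q) ?\<alpha> = (\<Prod>j<r. (k j (snd q j) * d j ?x (fst q)) powi coord ?\<alpha> j)"
        unfolding tau_def D_def torus_point_def using \<alpha> by (simp add: power_int_mult_distrib prod.distrib)
      have 3: "bundle_proj (L i) (snd (lift \<gamma> F p) i) = \<gamma> ?x" "bundle_proj (L i) (snd (lift \<gamma> F q) i) = \<gamma> (fst q)"
        using S_factor(2)[OF S[OF p(1)] i] S_factor(2)[OF S[OF q] i] by (simp_all add: lift_def)
      show "(\<Prod>j<r. (k j (snd q j) * d j ?x (fst q)) powi coord ?\<alpha> j) *
       (F (fst q) (b i) * D (\<gamma> ?x) (\<gamma> (fst q)) (b i) / D ?x (fst q) ?\<alpha>) =
        k i (snd (lift \<gamma> F q) i) * d i (bundle_proj (L i) (snd (lift \<gamma> F p) i)) (bundle_proj (L i) (snd (lift \<gamma> F q) i))"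
        unfolding 1 3 2[symmetric] using torus_nonzero[OF D \<alpha>] by (simp add: D_basis i)
    qed
    with N(1) show "\<exists>N. p \<in> N \<and> (\<lambda>q. k i (snd (lift \<gamma> F q) i) * d i (bundle_proj (L i) (snd (lift \<gamma> F p) i))
       (bundle_proj (L i) (snd (lift \<gamma> F q) i))) \<in> regular US N" by (intro exI conjI)
  qed
qed

text \<open>Solving \<open>s = F x \<cdot> \<gamma>\<^sub>* t\<close> for \<open>t\<close> yields
  the function of the inverse lift. Its discrepancy at \<open>b i\<close> is the reciprocal of the
  one of \<open>F\<close> at the class \<open>\<delta>\<^sup>* (b i)\<close>, composed with
  \<delta>; there the two pullbacks of \<open>b i\<close> cancel.\<close>

lemma compatible_inverse:
  assumes \<gamma>: "morphism X X \<gamma>" and \<delta>: "morphism X X \<delta>" and F: "compatible \<gamma> F"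
    and \<gamma>\<delta>: "\<And>x. x \<in> points X \<Longrightarrow> \<gamma> (\<delta> x) = x" and \<delta>\<gamma>: "\<And>x. x \<in> points X \<Longrightarrow> \<delta> (\<gamma> x) = x"
  shows "compatible \<delta> (\<lambda>y. pf \<delta> (tinv (F (\<delta> y))))"
  unfolding compatible_def
proof (intro conjI allI ballI)
  have FT: "F z \<in> T" for z using F unfolding compatible_def by blast
  show "pf \<delta> (tinv (F (\<delta> z))) \<in> T" for z by (intro pf[OF \<delta>] tinv FT)
  fix y assume y: "y \<in> points X"
  show "tunit y (discrepancy \<delta> (\<lambda>y. pf \<delta> (tinv (F (\<delta> y)))) y)"
    unfolding tunit_def
  proof (intro allI impI)
    fix i assume i: "i < r"
    let ?\<beta> = "pic_pullback X \<delta> (b i)"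
    have \<beta>: "?\<beta> \<in> C" by (rule pic_pullback_closed[OF base \<delta> b(1)[OF i]])
    have pp: "pic_pullback X \<gamma> ?\<beta> \<in> C" by (rule pic_pullback_closed[OF base \<gamma> \<beta>])
    have v: "\<delta> y \<in> points X" by (rule morphism_points[OF \<delta> y])
    have "unit_at X y (\<lambda>z. F (\<delta> z) ?\<beta> * D (\<gamma> (\<delta> y)) (\<gamma> (\<delta> z)) ?\<beta> / D (\<delta> y) (\<delta> z) (pic_pullback X \<gamma> ?\<beta>))"
      by (rule unit_at_compose[OF base base \<delta> discrepancy_char[OF \<gamma> F v \<beta>] y])
    from unit_at_inverse[OF base this]
    have "unit_at X y (\<lambda>z. D (\<delta> y) (\<delta> z) (pic_pullback X \<gamma> ?\<beta>) / (F (\<delta> z) ?\<beta> * D (\<gamma> (\<delta> y)) (\<gamma> (\<delta> z)) ?\<beta>))"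
      by simp
    then show "unit_at X y (\<lambda>z. discrepancy \<delta> (\<lambda>y. pf \<delta> (tinv (F (\<delta> y)))) y z (b i))"
    proof (rule unit_at_cong[OF base _ openin_topspace y])
      have "pic_pullback X \<gamma> ?\<beta> = pic_pullback X (\<lambda>x. \<delta> (\<gamma> x)) (b i)"
        by (rule pic_pullback_compose[OF base \<delta> \<gamma> morphism_compose[OF \<gamma> \<delta>] refl b(1)[OF i]])
      also have "\<dots> = b i"
        by (rule pic_pullback_id[OF base morphism_compose[OF \<gamma> \<delta>] \<delta>\<gamma> b(1)[OF i]])
      finally have eq: "pic_pullback X \<gamma> ?\<beta> = b i" .
      fix z assume "z \<in> points X"
      then show "D (\<delta> y) (\<delta> z) (pic_pullback X \<gamma> ?\<beta>) / (F (\<delta> z) ?\<beta> * D (\<gamma> (\<delta> y)) (\<gamma> (\<delta> z)) ?\<beta>) =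
        discrepancy \<delta> (\<lambda>y. pf \<delta> (tinv (F (\<delta> y)))) y z (b i)"
        unfolding eq using b(1)[OF i] \<beta> y by (simp add: discrepancy_apply pf_apply tinv_apply \<gamma>\<delta>)
    qed
  qed
qed

lemma tmul_assoc: "tmul (tmul s t) u = tmul s (tmul t u)"
  by (auto simp: tmul_def)

lemma tmul_tinv_cancel: "s \<in> T \<Longrightarrow> t \<in> T \<Longrightarrow> tmul (tinv s) (tmul s t) = t"
  by (rule torus_eqI[OF tmul[OF tinv tmul]]) (auto simp: tmul_apply tinv_apply b(1) torus_nonzero)

lemma tmul_tinv_cancel': "s \<in> T \<Longrightarrow> t \<in> T \<Longrightarrow> tmul s (tmul (tinv s) t) = t"
  by (rule torus_eqI[OF tmul[OF _ tmul[OF tinv]]]) (auto simp: tmul_apply tinv_apply b(1) torus_nonzero)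

text \<open>The inverse is itself a lift, for the inverse automorphism, so its regularity needs no
  separate argument.\<close>

lemma lift_bijective:
  assumes \<gamma>: "isomorphism X X \<gamma>" and F: "compatible \<gamma> F"
  shows "isomorphism US US (lift \<gamma> F)"
proof -
  let ?\<delta> = "inv_into (points X) \<gamma>"
  have bij: "bij_betw \<gamma> (points X) (points X)" and m: "morphism X X \<gamma>" and \<delta>: "morphism X X ?\<delta>"
    using \<gamma> unfolding isomorphism_def by auto
  have \<gamma>\<delta>: "\<gamma> (?\<delta> x) = x" and \<delta>\<gamma>: "?\<delta> (\<gamma> x) = x" if "x \<in> points X" for x
    using bij that bij_betw_inv_into_right bij_betw_inv_into_left by metis+
  have FT: "F z \<in> T" for z using F unfolding compatible_def by blast
  have pid: "pf ?\<delta> (pf \<gamma> t) = t" "pf \<gamma> (pf ?\<delta> t) = t" if "t \<in> T" for t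
  proof -
    have "pf ?\<delta> (pf \<gamma> t) = pf (\<lambda>x. ?\<delta> (\<gamma> x)) t" by (rule pf_compose[OF \<delta> m morphism_compose[OF m \<delta>] refl])
    also have "\<dots> = t" by (rule pf_id[OF morphism_compose[OF m \<delta>] \<delta>\<gamma> that])
    finally show "pf ?\<delta> (pf \<gamma> t) = t" .
    have "pf \<gamma> (pf ?\<delta> t) = pf (\<lambda>x. \<gamma> (?\<delta> x)) t" by (rule pf_compose[OF m \<delta> morphism_compose[OF \<delta> m] refl])
    also have "\<dots> = t" by (rule pf_id[OF morphism_compose[OF \<delta> m] \<gamma>\<delta> that])
    finally show "pf \<gamma> (pf ?\<delta> t) = t" .
  qed
  let ?F' = "\<lambda>y. pf ?\<delta> (tinv (F (?\<delta> y)))"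
  have F': "compatible ?\<delta> ?F'" by (rule compatible_inverse[OF m \<delta> F \<gamma>\<delta> \<delta>\<gamma>])
  show ?thesis
  proof (rule isomorphismI[OF lift_morphism[OF m F] lift_morphism[OF \<delta> F'] swf_US])
    fix p assume "p \<in> points US"
    then have p: "p \<in> S" using points_US by simp
    have x: "fst p \<in> points X" "\<gamma> (fst p) \<in> points X" "?\<delta> (fst p) \<in> points X"
      using S_proj[OF p] morphism_points[OF m] morphism_points[OF \<delta>] by auto
    have t: "tau p \<in> T" by (rule tau[OF p])
    have "lift ?\<delta> ?F' (lift \<gamma> F p) =
      pt (fst p) (tmul (pf ?\<delta> (tinv (F (fst p)))) (pf ?\<delta> (tmul (F (fst p)) (pf \<gamma> (tau p)))))"
      unfolding lift_def[of \<gamma>] using lift_pt[OF x(2) tmul[OF FT pf[OF m t]]] \<delta>\<gamma>[OF x(1)] by simp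
    also have "\<dots> = pt (fst p) (pf ?\<delta> (tmul (tinv (F (fst p))) (tmul (F (fst p)) (pf \<gamma> (tau p)))))"
      unfolding pf_mult[OF \<delta>] ..
    also have "\<dots> = p" unfolding tmul_tinv_cancel[OF FT pf[OF m t]] pid(1)[OF t] by (rule pt_tau[OF p])
    finally show "lift ?\<delta> ?F' (lift \<gamma> F p) = p" .
    have "lift \<gamma> F (lift ?\<delta> ?F' p) =
      pt (fst p) (tmul (F (?\<delta> (fst p))) (pf \<gamma> (tmul (pf ?\<delta> (tinv (F (?\<delta> (fst p))))) (pf ?\<delta> (tau p)))))"
      unfolding lift_def[of ?\<delta>] using lift_pt[OF x(3) tmul[OF pf[OF \<delta> tinv[OF FT]] pf[OF \<delta> t]]] \<gamma>\<delta>[OF x(1)] by simp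
    also have "\<dots> = pt (fst p) (tmul (F (?\<delta> (fst p))) (tmul (tinv (F (?\<delta> (fst p)))) (tau p)))"
      unfolding pf_mult[OF m] pid(2)[OF t] pid(2)[OF tinv[OF FT]] ..
    also have "\<dots> = p" unfolding tmul_tinv_cancel'[OF FT t] by (rule pt_tau[OF p])
    finally show "lift \<gamma> F (lift ?\<delta> ?F' p) = p" .
  qed
qed

lemma torsor_isomorphism_lift:
  assumes \<gamma>: "isomorphism X X \<gamma>" and F: "compatible \<gamma> F"
  shows "torsor_isomorphism X (torsor_pushforward X \<gamma> U) U (lift \<gamma> F)"
proof -
  let ?\<delta> = "inv_into (points X) \<gamma>"
  have bij: "bij_betw \<gamma> (points X) (points X)" and m: "morphism X X \<gamma>" and \<delta>: "morphism X X ?\<delta>"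
    using \<gamma> unfolding isomorphism_def by auto
  have \<gamma>\<delta>: "\<gamma> (?\<delta> x) = x" if "x \<in> points X" for x
    using bij that bij_betw_inv_into_right by metis
  have FT: "F z \<in> T" for z using F unfolding compatible_def by blast
  have pid: "pf \<gamma> (pf ?\<delta> t) = t" if "t \<in> T" for t
  proof -
    have "pf \<gamma> (pf ?\<delta> t) = pf (\<lambda>x. \<gamma> (?\<delta> x)) t" by (rule pf_compose[OF m \<delta> morphism_compose[OF \<delta> m] refl])
    also have "\<dots> = t" by (rule pf_id[OF morphism_compose[OF \<delta> m] \<gamma>\<delta> that])
    finally show "pf \<gamma> (pf ?\<delta> t) = t" .
  qed
  have equi: "lift \<gamma> F (torsor_act U (inv_into T (pf \<gamma>) t) p) = torsor_act U t (lift \<gamma> F p)"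
    if p: "p \<in> S" and t: "t \<in> T" for p t
  proof -
    \<comment> \<open>The action on the pushforward is defined through \<open>inv_into\<close>,
      which is meaningful on the image only. Pushforward along the inverse automorphism provides the
      preimage of \<open>t\<close>.\<close>
    have im: "t \<in> pf \<gamma> ` T" using pid[OF t] pf[OF \<delta> t] by (metis image_eqI)
    let ?s = "inv_into T (pf \<gamma>) t"
    have s: "?s \<in> T" "pf \<gamma> ?s = t" using inv_into_into[OF im] f_inv_into_f[OF im] by auto
    have x: "fst p \<in> points X" "\<gamma> (fst p) \<in> points X" using S_proj[OF p] morphism_points[OF m] by auto
    have tp: "tau p \<in> T" by (rule tau[OF p])
    have "torsor_act U ?s p = pt (fst p) (tmul ?s (tau p))"
      using act_pt[OF x(1) s(1) tp] pt_tau[OF p] by simp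
    then have "lift \<gamma> F (torsor_act U ?s p) = pt (\<gamma> (fst p)) (tmul (F (fst p)) (tmul t (pf \<gamma> (tau p))))"
      using lift_pt[OF x(1) tmul[OF s(1) tp]] pf_mult[OF m] s(2) by simp
    also have "tmul (F (fst p)) (tmul t (pf \<gamma> (tau p))) = tmul t (tmul (F (fst p)) (pf \<gamma> (tau p)))"
      by (auto simp: tmul_def)
    finally show ?thesis
      unfolding lift_def[of _ _ p] by (simp add: act_pt[OF x(2) t tmul[OF FT pf[OF m tp]]])
  qed
  show ?thesis
    unfolding torsor_isomorphism_def torsor_pushforward_def
    using lift_bijective[OF \<gamma> F] equi points_US by (simp add: torsor_proj lift_def[of _ _ p for p])
qed

section \<open>Comparison of the lift of a product with the product of lifts\<close>

definition defect where
  "defect F\<^sub>1 F\<^sub>2 F\<^sub>3 \<gamma>\<^sub>1 \<gamma>\<^sub>2 x = tmul (F\<^sub>3 x) (tinv (tmul (F\<^sub>1 (\<gamma>\<^sub>2 x)) (pf \<gamma>\<^sub>1 (F\<^sub>2 x))))"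

context
  fixes \<gamma>\<^sub>1 \<gamma>\<^sub>2 \<gamma>\<^sub>3 F\<^sub>1 F\<^sub>2 F\<^sub>3
  assumes \<gamma>\<^sub>1: "isomorphism X X \<gamma>\<^sub>1" and \<gamma>\<^sub>2: "isomorphism X X \<gamma>\<^sub>2" and \<gamma>\<^sub>3: "isomorphism X X \<gamma>\<^sub>3"
    and \<gamma>: "\<And>x. x \<in> points X \<Longrightarrow> \<gamma>\<^sub>3 x = \<gamma>\<^sub>1 (\<gamma>\<^sub>2 x)"
    and F\<^sub>1: "compatible \<gamma>\<^sub>1 F\<^sub>1" and F\<^sub>2: "compatible \<gamma>\<^sub>2 F\<^sub>2" and F\<^sub>3: "compatible \<gamma>\<^sub>3 F\<^sub>3"
begin

lemma mor: "morphism X X \<gamma>\<^sub>1" "morphism X X \<gamma>\<^sub>2" "morphism X X \<gamma>\<^sub>3"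
  using \<gamma>\<^sub>1 \<gamma>\<^sub>2 \<gamma>\<^sub>3 unfolding isomorphism_def by auto

lemma in_torus: "F\<^sub>1 z \<in> T" "F\<^sub>2 z \<in> T" "F\<^sub>3 z \<in> T"
  using F\<^sub>1 F\<^sub>2 F\<^sub>3 unfolding compatible_def by auto

lemma defect: "defect F\<^sub>1 F\<^sub>2 F\<^sub>3 \<gamma>\<^sub>1 \<gamma>\<^sub>2 x \<in> T"
  unfolding defect_def by (intro tmul tinv pf mor in_torus)

lemma defect_apply:
  "\<alpha> \<in> C \<Longrightarrow> defect F\<^sub>1 F\<^sub>2 F\<^sub>3 \<gamma>\<^sub>1 \<gamma>\<^sub>2 x \<alpha> =
     F\<^sub>3 x \<alpha> / (F\<^sub>1 (\<gamma>\<^sub>2 x) \<alpha> * F\<^sub>2 x (pic_pullback X \<gamma>\<^sub>1 \<alpha>))"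
  unfolding defect_def by (simp add: tmul_apply tinv_apply pf_apply)

text \<open>The defect is the discrepancy of \<open>F\<^sub>3\<close> divided by that of
  \<open>F\<^sub>1\<close> composed with \<open>\<gamma>\<^sub>2\<close> and by that of
  \<open>F\<^sub>2\<close> at the class \<open>\<gamma>\<^sub>1\<^sup>* \<alpha>\<close>. All values
  of \<open>D\<close> cancel: the outer ones against those of \<open>F\<^sub>3\<close>, the middle
  one between the other two factors.\<close>

lemma unit_at_defect:
  assumes \<alpha>: "\<alpha> \<in> C" and x: "x \<in> points X"
  shows "unit_at X x (\<lambda>z. defect F\<^sub>1 F\<^sub>2 F\<^sub>3 \<gamma>\<^sub>1 \<gamma>\<^sub>2 z \<alpha>)"
proof -
  let ?\<beta> = "pic_pullback X \<gamma>\<^sub>1 \<alpha>" and ?g = "pic_pullback X \<gamma>\<^sub>3 \<alpha>"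
  have \<beta>: "?\<beta> \<in> C" by (rule pic_pullback_closed[OF base mor(1) \<alpha>])
  have g: "?g \<in> C" by (rule pic_pullback_closed[OF base mor(3) \<alpha>])
  have eq: "pic_pullback X \<gamma>\<^sub>2 ?\<beta> = ?g" by (rule pic_pullback_compose[OF base mor \<gamma> \<alpha>])
  have u3: "unit_at X x (\<lambda>z. F\<^sub>3 z \<alpha> * D (\<gamma>\<^sub>3 x) (\<gamma>\<^sub>3 z) \<alpha> / D x z ?g)"
    by (rule discrepancy_char[OF mor(3) F\<^sub>3 x \<alpha>])
  have u2: "unit_at X x (\<lambda>z. F\<^sub>2 z ?\<beta> * D (\<gamma>\<^sub>2 x) (\<gamma>\<^sub>2 z) ?\<beta> / D x z ?g)"
    using discrepancy_char[OF mor(2) F\<^sub>2 x \<beta>] unfolding eq .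
  have u1: "unit_at X x (\<lambda>z. F\<^sub>1 (\<gamma>\<^sub>2 z) \<alpha> * D (\<gamma>\<^sub>1 (\<gamma>\<^sub>2 x)) (\<gamma>\<^sub>1 (\<gamma>\<^sub>2 z)) \<alpha> / D (\<gamma>\<^sub>2 x) (\<gamma>\<^sub>2 z) ?\<beta>)"
    by (rule unit_at_compose[OF base base mor(2)
          discrepancy_char[OF mor(1) F\<^sub>1 morphism_points[OF mor(2) x] \<alpha>] x])
  show ?thesis
  proof (rule unit_at_cong[OF base unit_at_divide[OF base u3 unit_at_mult[OF base u1 u2]] openin_topspace x])
    fix z assume z: "z \<in> points X"
    have "D y w \<alpha> \<noteq> 0" "D y w ?\<beta> \<noteq> 0" "D y w ?g \<noteq> 0" for y w using torus_nonzero[OF D] \<alpha> \<beta> g by auto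
    then show "F\<^sub>3 z \<alpha> * D (\<gamma>\<^sub>3 x) (\<gamma>\<^sub>3 z) \<alpha> / D x z ?g /
      (F\<^sub>1 (\<gamma>\<^sub>2 z) \<alpha> * D (\<gamma>\<^sub>1 (\<gamma>\<^sub>2 x)) (\<gamma>\<^sub>1 (\<gamma>\<^sub>2 z)) \<alpha> / D (\<gamma>\<^sub>2 x) (\<gamma>\<^sub>2 z) ?\<beta> *
        (F\<^sub>2 z ?\<beta> * D (\<gamma>\<^sub>2 x) (\<gamma>\<^sub>2 z) ?\<beta> / D x z ?g)) = defect F\<^sub>1 F\<^sub>2 F\<^sub>3 \<gamma>\<^sub>1 \<gamma>\<^sub>2 z \<alpha>"
      unfolding defect_apply[OF \<alpha>] using \<gamma>[OF x] \<gamma>[OF z] by (simp add: field_simps)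
  qed
qed

text \<open>By functoriality of pushforward the torus part of \<open>p\<close> contributes the same
  factor on both sides; what remains is a ratio depending on the base point only.\<close>

lemma lift_defect:
  assumes p: "p \<in> S"
  shows "lift \<gamma>\<^sub>3 F\<^sub>3 p = torsor_act U (defect F\<^sub>1 F\<^sub>2 F\<^sub>3 \<gamma>\<^sub>1 \<gamma>\<^sub>2 (fst p)) (lift \<gamma>\<^sub>1 F\<^sub>1 (lift \<gamma>\<^sub>2 F\<^sub>2 p))"
proof -
  let ?x = "fst p"
  have x: "?x \<in> points X" "\<gamma>\<^sub>2 ?x \<in> points X" "\<gamma>\<^sub>1 (\<gamma>\<^sub>2 ?x) \<in> points X"
    using S_proj[OF p] morphism_points[OF mor(1)] morphism_points[OF mor(2)] by auto
  have t: "tau p \<in> T" by (rule tau[OF p])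
  have t2: "tmul (F\<^sub>2 ?x) (pf \<gamma>\<^sub>2 (tau p)) \<in> T" by (intro tmul in_torus pf[OF mor(2)] t)
  have t12: "tmul (F\<^sub>1 (\<gamma>\<^sub>2 ?x)) (pf \<gamma>\<^sub>1 (F\<^sub>2 ?x)) \<in> T" by (intro tmul in_torus pf[OF mor(1)])
  have t1: "tmul (F\<^sub>1 (\<gamma>\<^sub>2 ?x)) (pf \<gamma>\<^sub>1 (tmul (F\<^sub>2 ?x) (pf \<gamma>\<^sub>2 (tau p)))) \<in> T"
    by (intro tmul in_torus pf[OF mor(1)] t2)
  have comp: "pf \<gamma>\<^sub>1 (pf \<gamma>\<^sub>2 (tau p)) = pf \<gamma>\<^sub>3 (tau p)" by (rule pf_compose[OF mor \<gamma>])
  have t3: "pf \<gamma>\<^sub>3 (tau p) \<in> T" by (rule pf[OF mor(3) t])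
  have "lift \<gamma>\<^sub>1 F\<^sub>1 (lift \<gamma>\<^sub>2 F\<^sub>2 p) = pt (\<gamma>\<^sub>1 (\<gamma>\<^sub>2 ?x)) (tmul (F\<^sub>1 (\<gamma>\<^sub>2 ?x)) (pf \<gamma>\<^sub>1 (tmul (F\<^sub>2 ?x) (pf \<gamma>\<^sub>2 (tau p)))))"
    unfolding lift_def[of \<gamma>\<^sub>2] by (rule lift_pt[OF x(2) t2])
  then have "torsor_act U (defect F\<^sub>1 F\<^sub>2 F\<^sub>3 \<gamma>\<^sub>1 \<gamma>\<^sub>2 ?x) (lift \<gamma>\<^sub>1 F\<^sub>1 (lift \<gamma>\<^sub>2 F\<^sub>2 p)) = pt (\<gamma>\<^sub>1 (\<gamma>\<^sub>2 ?x))
    (tmul (defect F\<^sub>1 F\<^sub>2 F\<^sub>3 \<gamma>\<^sub>1 \<gamma>\<^sub>2 ?x) (tmul (F\<^sub>1 (\<gamma>\<^sub>2 ?x)) (pf \<gamma>\<^sub>1 (tmul (F\<^sub>2 ?x) (pf \<gamma>\<^sub>2 (tau p))))))"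
    using act_pt[OF x(3) defect t1] by simp
  also have "tmul (F\<^sub>1 (\<gamma>\<^sub>2 ?x)) (pf \<gamma>\<^sub>1 (tmul (F\<^sub>2 ?x) (pf \<gamma>\<^sub>2 (tau p)))) =
    tmul (tmul (F\<^sub>1 (\<gamma>\<^sub>2 ?x)) (pf \<gamma>\<^sub>1 (F\<^sub>2 ?x))) (pf \<gamma>\<^sub>3 (tau p))"
    unfolding pf_mult[OF mor(1)] comp tmul_assoc ..
  also have "tmul (defect F\<^sub>1 F\<^sub>2 F\<^sub>3 \<gamma>\<^sub>1 \<gamma>\<^sub>2 ?x) \<dots> = tmul (F\<^sub>3 ?x) (pf \<gamma>\<^sub>3 (tau p))"
    unfolding defect_def tmul_assoc[of "F\<^sub>3 ?x"] tmul_tinv_cancel[OF t12 t3] ..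
  finally show ?thesis unfolding lift_def[of \<gamma>\<^sub>3] \<gamma>[OF x(1)] by simp
qed

end

end

section \<open>The classical topology\<close>

text \<open>Preimages are to be open in \<tau> and not merely relative to \<open>D\<close>; with the
  whole codomain as \<open>W\<close> this makes openness of \<open>D\<close> part of the
  notion.\<close>

definition continuous_on_open :: "'a topology \<Rightarrow> 'a set \<Rightarrow> ('a \<Rightarrow> 'b::topological_space) \<Rightarrow> bool" where
  "continuous_on_open \<tau> D f \<longleftrightarrow> (\<forall>W. open W \<longrightarrow> openin \<tau> {x\<in>D. f x \<in> W})"

lemma continuous_on_open_dom: "continuous_on_open \<tau> D f \<Longrightarrow> openin \<tau> D"
  unfolding continuous_on_open_def by (drule spec[of _ UNIV]) simp

lemma continuous_on_open_pair:
  fixes f :: "'a \<Rightarrow> 'b::topological_space" and g :: "'a \<Rightarrow> 'c::topological_space"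
  assumes f: "continuous_on_open \<tau> D f" and g: "continuous_on_open \<tau> E g" and Q: "open Q"
  shows "openin \<tau> {x\<in>D \<inter> E. (f x, g x) \<in> Q}"
proof (subst openin_subopen, intro ballI)
  fix x assume x: "x \<in> {x\<in>D \<inter> E. (f x, g x) \<in> Q}"
  then have "(f x, g x) \<in> Q" by simp
  then obtain A B where AB: "open A" "open B" "(f x, g x) \<in> A \<times> B" "A \<times> B \<subseteq> Q"
    by (rule open_prod_elim[OF Q])
  have "openin \<tau> ({x\<in>D. f x \<in> A} \<inter> {x\<in>E. g x \<in> B})"
    using f g AB unfolding continuous_on_open_def by blast
  then show "\<exists>T. openin \<tau> T \<and> x \<in> T \<and> T \<subseteq> {x\<in>D \<inter> E. (f x, g x) \<in> Q}"
    using x AB by (intro exI conjI) auto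
qed

text \<open>Sums, products and quotients of complex numbers are continuous, so continuity of the
  generators spreads to all regular functions. It is applied with the euclidean topology on affine
  sets and with the product topology on pairs of points.\<close>

lemma analytic_continuous_initial:
  fixes S :: "'a set"
  assumes dom: "\<And>D f. (D, f) \<in> G \<Longrightarrow> D \<subseteq> S" and S: "openin \<tau> S"
    and G: "\<And>D f. (D, f) \<in> G \<Longrightarrow> continuous_on_open \<tau> D f"
    and f: "f \<in> regular (initial_space S G) U"
  shows "continuous_on_open \<tau> U f"
proof -
  have gen: "continuous_on_open \<tau> D q" if "(D, q) \<in> generated_algebra S G" for D q
    using that
  proof induction
    case (const c)
    show ?case unfolding continuous_on_open_def using S by (auto simp: Collect_conj_eq)
  next
    case (gen D f) then show ?case by (rule G)
  next
    case (add D f E g)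
    show ?case unfolding continuous_on_open_def
    proof (intro allI impI)
      fix W :: "complex set" assume W: "open W"
      have "open ((\<lambda>p. fst p + snd p) -` W)" by (rule open_vimage[OF W]) (intro continuous_intros)
      from continuous_on_open_pair[OF add.IH this] show "openin \<tau> {x \<in> D \<inter> E. f x + g x \<in> W}" by simp
    qed
  next
    case (mult D f E g)
    show ?case unfolding continuous_on_open_def
    proof (intro allI impI)
      fix W :: "complex set" assume W: "open W"
      have "open ((\<lambda>p. fst p * snd p) -` W)" by (rule open_vimage[OF W]) (intro continuous_intros)
      from continuous_on_open_pair[OF mult.IH this] show "openin \<tau> {x \<in> D \<inter> E. f x * g x \<in> W}" by simp
    qed
  qed
  show ?thesis unfolding continuous_on_open_def
  proof (intro allI impI)
    fix W :: "complex set" assume W: "open W"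
    show "openin \<tau> {x \<in> U. f x \<in> W}"
    proof (subst openin_subopen, intro ballI)
      fix x assume x: "x \<in> {x \<in> U. f x \<in> W}"
      then have xU: "x \<in> U" by simp
      obtain D g h where 1: "(D, g) \<in> generated_algebra S G" "(D, h) \<in> generated_algebra S G"
        "x \<in> D" "h x \<noteq> 0" "\<forall>y\<in>D. h y \<noteq> 0 \<longrightarrow> y \<in> U \<and> f y = g y / h y"
        by (rule initial_space_regularD[OF _ f xU]) (erule dom, blast)
      \<comment> \<open>Division is continuous only off the zeros of the denominator, so the
        quotient is handled through an open set of pairs.\<close>
      define Q where "Q = {p :: complex \<times> complex. snd p \<noteq> 0} \<inter> (\<lambda>p. fst p / snd p) -` W"
      have o: "open {p :: complex \<times> complex. snd p \<noteq> 0}"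
        by (rule open_Collect_neq) (intro continuous_intros)+
      have "continuous_on {p :: complex \<times> complex. snd p \<noteq> 0} (\<lambda>p. fst p / snd p)"
        by (intro continuous_intros) auto
      then have "open Q" unfolding Q_def by (rule continuous_open_preimage[OF _ o W])
      from continuous_on_open_pair[OF gen[OF 1(1)] gen[OF 1(2)] this]
      have "openin \<tau> {x \<in> D \<inter> D. (g x, h x) \<in> Q}" .
      then show "\<exists>T. openin \<tau> T \<and> x \<in> T \<and> T \<subseteq> {x \<in> U. f x \<in> W}"
        using 1 x by (intro exI[of _ "{x \<in> D \<inter> D. (g x, h x) \<in> Q}"]) (auto simp: Q_def)
    qed
  qed
qed

text \<open>A Zariski open set is the domain of a regular constant, so continuity of regular
  functions already includes openness of Zariski open sets.\<close>

lemma zariski_open_imp_initial: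
  assumes dom: "\<And>D f. (D, f) \<in> G \<Longrightarrow> D \<subseteq> S" and S: "openin \<tau> S"
    and G: "\<And>D f. (D, f) \<in> G \<Longrightarrow> continuous_on_open \<tau> D f"
    and U: "openin (zariski (initial_space S G)) U"
  shows "openin \<tau> U"
proof -
  have "space_with_functions (initial_space S G)" by (rule swf_initial_space) (rule dom)
  from regular_const[OF this U, of 1] have "(\<lambda>_. 1) \<in> regular (initial_space S G) U" .
  from analytic_continuous_initial[OF dom S G this] show ?thesis by (rule continuous_on_open_dom)
qed

context
  fixes X :: "'a fspace"
  assumes X: "space_with_functions X"
begin

lemma openin_analytic:
  "f \<in> regular X U \<Longrightarrow> open W \<Longrightarrow> openin (analytic_topology X) {x\<in>U. f x \<in> W}"
  unfolding analytic_topology_def by (rule topology_generated_by_Basis) blast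

lemma openin_zariski_analytic: "openin (zariski X) U \<Longrightarrow> openin (analytic_topology X) U"
  using openin_analytic[OF regular_const[OF X, of U 0] open_UNIV] by simp

lemma topspace_analytic: "topspace (analytic_topology X) = points X"
proof
  show "topspace (analytic_topology X) \<subseteq> points X"
    unfolding analytic_topology_def topology_generated_by_topspace
    using openin_subset[OF regular_openin[OF X]] by fastforce
  show "points X \<subseteq> topspace (analytic_topology X)"
    by (rule openin_subset[OF openin_zariski_analytic[OF openin_topspace]])
qed

lemma openin_analytic_finer:
  assumes "\<And>f U. f \<in> regular X U \<Longrightarrow> continuous_on_open \<tau> U f" and V: "openin (analytic_topology X) V"
  shows "openin \<tau> V"
  by (rule openin_generated_local[OF _ V[unfolded analytic_topology_def]])
     (use assms(1) in \<open>auto simp: continuous_on_open_def\<close>)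

end

lemma morphism_analytic_continuous:
  assumes X: "space_with_functions X" and Y: "space_with_functions Y" and F: "morphism X Y F"
  shows "continuous_map (analytic_topology X) (analytic_topology Y) F"
  unfolding analytic_topology_def[of Y]
proof (rule continuous_on_generated_topo)
  fix U assume "U \<in> {{x \<in> U. f x \<in> W} |U f W. f \<in> regular Y U \<and> open W}"
  then obtain V f W where U: "U = {x\<in>V. f x \<in> W}" "f \<in> regular Y V" "open W" by blast
  have "F -` U \<inter> topspace (analytic_topology X) = {x\<in>{x\<in>points X. F x \<in> V}. f (F x) \<in> W}"
    unfolding topspace_analytic[OF X] U by auto
  then show "openin (analytic_topology X) (F -` U \<inter> topspace (analytic_topology X))"
    using openin_analytic[OF X morphism_regular[OF F U(2)] U(3)] by simp
next
  show "F ` topspace (analytic_topology X) \<subseteq> \<Union> {{x \<in> U. f x \<in> W} |U f W. f \<in> regular Y U \<and> open W}"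
    using morphism_points[OF F] topspace_analytic[OF X] topspace_analytic[OF Y]
    unfolding analytic_topology_def[of Y] topology_generated_by_topspace by blast
qed

section \<open>Affine space\<close>

lemma coordinates_dom: "(D, f) \<in> coordinates n \<Longrightarrow> D \<subseteq> affine_points n"
  unfolding coordinates_def by auto

lemma swf_affine_space: "space_with_functions (affine_space n)"
  unfolding affine_space_def by (rule swf_initial_space) (rule coordinates_dom)

lemma points_affine_space [simp]: "points (affine_space n) = affine_points n"
  unfolding affine_space_def zariski_initial_space by (rule topspace_initial) (rule coordinates_dom)

lemma coordinate_regular: "(\<lambda>z. z i) \<in> regular (affine_space n) (affine_points n)"
proof (cases "i < n")
  case True
  have "(affine_points n, \<lambda>z. z i) \<in> generated_algebra (affine_points n) (coordinates n)"
    by (rule generated_algebra.gen) (use True in \<open>auto simp: coordinates_def\<close>)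
  then show ?thesis unfolding affine_space_def
    by (rule generated_algebra_regular[rotated]) (rule coordinates_dom)
next
  case False
  show ?thesis
    by (rule regular_cong[OF swf_affine_space regular_const[OF swf_affine_space, of _ _ 0]])
       (use False openin_topspace[of "zariski (affine_space n)"] in \<open>auto simp: affine_points_def\<close>)
qed

lemma closed_affine_points: "closed (affine_points n)"
proof -
  have "affine_points n = (\<Inter>i\<in>{n..}. (\<lambda>z. z i) -` {0})" unfolding affine_points_def by auto
  moreover have "closed ((\<lambda>z. z i :: complex) -` {0})" for i :: nat
    by (rule continuous_closed_vimage) (auto intro: continuous_on_product_coordinates[THEN continuous_on_eq_continuous_within[THEN iffD1], rule_format])
  ultimately show ?thesis by auto
qed

lemma affine_space_continuous:
  assumes "f \<in> regular (affine_space n) U"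
  shows "continuous_on_open (subtopology euclidean (affine_points n)) U f"
proof (rule analytic_continuous_initial[OF coordinates_dom _ _ assms[unfolded affine_space_def]])
  show "openin (top_of_set (affine_points n)) (affine_points n)"
    by simp
  fix D :: "(nat \<Rightarrow> complex) set" and f assume "(D, f) \<in> coordinates n"
  then obtain i where i: "D = affine_points n" "f = (\<lambda>z. z i)" unfolding coordinates_def by auto
  show "continuous_on_open (top_of_set (affine_points n)) D f"
    unfolding continuous_on_open_def i
  proof (intro allI impI)
    fix W :: "complex set" assume "open W"
    then have "open ((\<lambda>z::nat \<Rightarrow> complex. z i) -` W)"
      by (rule open_vimage) (rule continuous_on_product_coordinates)
    then show "openin (top_of_set (affine_points n)) {x \<in> affine_points n. x i \<in> W}"
      unfolding openin_open by (intro exI conjI) auto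
  qed
qed

lemma induced_affine_continuous:
  assumes Z: "Z \<subseteq> affine_points n" and f: "f \<in> regular (induced (affine_space n) Z) U"
  shows "continuous_on_open (subtopology euclidean Z) U f"
proof (rule analytic_continuous_initial[OF pulled_back_dom _ _ f[unfolded induced_def]])
  show "openin (top_of_set Z) Z" by simp
  fix D :: "(nat \<Rightarrow> complex) set" and f assume "(D, f) \<in> pulled_back Z (\<lambda>x. x) (affine_space n)"
  then obtain V where V: "D = {x\<in>Z. x \<in> V}" "f \<in> regular (affine_space n) V" unfolding pulled_back_def by auto
  show "continuous_on_open (top_of_set Z) D f"
    unfolding continuous_on_open_def
  proof (intro allI impI)
    fix W :: "complex set" assume "open W"
    then have "openin (top_of_set (affine_points n)) {x\<in>V. f x \<in> W}"
      using affine_space_continuous[OF V(2)] unfolding continuous_on_open_def by blast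
    then obtain T where T: "open T" "{x\<in>V. f x \<in> W} = affine_points n \<inter> T" unfolding openin_open by blast
    have "{x \<in> D. f x \<in> W} = Z \<inter> {x\<in>V. f x \<in> W}" unfolding V by auto
    also have "\<dots> = Z \<inter> T" unfolding T(2) using Z by auto
    finally show "openin (top_of_set Z) {x \<in> D. f x \<in> W}" unfolding openin_open using T(1) by blast
  qed
qed

lemma affine_zariski_open_classical:
  assumes "openin (zariski (affine_space n)) V"
  obtains T where "open T" "V = affine_points n \<inter> T"
  using continuous_on_open_dom[OF affine_space_continuous[OF regular_const[OF swf_affine_space assms, of 1]]]
  unfolding openin_open by blast

text \<open>Affine spaces serve as the test varieties for properness, with one coordinate per chart
  for compactness and with a single coordinate for constancy. Distinct points differ in some
  coordinate, and the difference of that coordinate is regular on the product; this gives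
  separatedness.\<close>

lemma variety_affine_space: "variety (affine_space n)"
  unfolding variety_def prevariety_def
proof (intro conjI)
  let ?A = "affine_space n"
  show "space_with_functions ?A" by (rule swf_affine_space)
  have "affine_variety (induced ?A (affine_points n))"
    unfolding affine_variety_def
  proof (intro exI conjI)
    show "closedin (zariski ?A) (affine_points n)"
      using closedin_topspace[of "zariski ?A"] by simp
    show "isomorphism (induced ?A (affine_points n)) (induced ?A (affine_points n)) (\<lambda>x. x)"
      by (rule isomorphismI) (auto intro: morphism_id swf_induced)
  qed
  then show "\<exists>\<U>. finite \<U> \<and> \<Union>\<U> = points ?A \<and> (\<forall>U\<in>\<U>. openin (zariski ?A) U \<and> affine_variety (induced ?A U))"
    using openin_topspace[of "zariski ?A"] by (intro exI[of _ "{affine_points n}"]) simp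
  let ?P = "product_space ?A ?A" and ?\<Delta> = "{(x, x) |x. x \<in> points (affine_space n)}"
  note fs = morphism_fst_snd[OF swf_affine_space[of n] swf_affine_space[of n] order_refl, folded product_space_def]
  have P: "space_with_functions ?P" by (rule swf_product_space)
  show "closedin (zariski ?P) ?\<Delta>"
    unfolding closedin_def
  proof (intro conjI)
    show "?\<Delta> \<subseteq> topspace (zariski ?P)" by auto
    show "openin (zariski ?P) (topspace (zariski ?P) - ?\<Delta>)"
    proof (subst openin_subopen, intro ballI)
      fix p assume p: "p \<in> topspace (zariski ?P) - ?\<Delta>"
      then have "fst p \<noteq> snd p" by (auto simp: prod_eq_iff)
      then obtain i where i: "fst p i \<noteq> snd p i" by auto
      have r: "(\<lambda>q. fst q i) \<in> regular ?P (points ?P)" "(\<lambda>q. snd q i) \<in> regular ?P (points ?P)"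
        using morphism_regular[OF fs(1) coordinate_regular[of i]] morphism_regular[OF fs(2) coordinate_regular[of i]]
          morphism_points[OF fs(1)] morphism_points[OF fs(2)]
        by (auto simp: Collect_mem_eq mem_Times_iff conj_commute elim!: back_subst[where P="\<lambda>S. _ \<in> regular ?P S"])
      have "(\<lambda>q. fst q i + (-1) * snd q i) \<in> regular ?P (points ?P)"
        by (rule regular_add[OF P r(1) regular_mult[OF P regular_const[OF P openin_topspace] r(2)]])
      from regular_nonzero_openin[OF P this]
      have "openin (zariski ?P) {q \<in> points ?P. fst q i + (-1) * snd q i \<noteq> 0}" .
      then show "\<exists>T. openin (zariski ?P) T \<and> p \<in> T \<and> T \<subseteq> topspace (zariski ?P) - ?\<Delta>"
        using p i by (intro exI conjI) auto
    qed
  qed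
qed

lemma compact_affine_box:
  assumes Z: "closedin (zariski (affine_space n)) Z"
  shows "compact {z\<in>Z. \<forall>i<n. norm (z i) \<le> R}"
proof -
  have "openin (zariski (affine_space n)) (affine_points n - Z)" and sub: "Z \<subseteq> affine_points n"
    using Z unfolding closedin_def by auto
  then obtain T where T: "open T" "affine_points n - Z = affine_points n \<inter> T"
    by (elim affine_zariski_open_classical)
  have "Z = affine_points n \<inter> - T" using T(2) sub by auto
  then have cZ: "closed Z" using closed_affine_points T(1) by auto
  \<comment> \<open>Confining the coordinates from \<open>n\<close> on to 0 turns the bounded part
    of affine space into a full product of compact sets, to which Tychonoff's theorem
    applies.\<close>
  let ?B = "\<Pi>\<^sub>E i\<in>UNIV. if i < n then cball (0::complex) R else {0}"
  have "compactin (product_topology (\<lambda>i. euclidean) UNIV) ?B"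
    unfolding compactin_PiE by auto
  then have "compact ?B" unfolding euclidean_product_topology by simp
  then have "compact (Z \<inter> ?B)" using cZ by (rule closed_Int_compact[rotated])
  moreover have "Z \<inter> ?B = {z\<in>Z. \<forall>i<n. norm (z i) \<le> R}"
    using sub by (auto simp: PiE_iff affine_points_def subset_iff split: if_splits)
  ultimately show ?thesis by simp
qed

text \<open>The euclidean topology on \<open>Z\<close> is at least as fine as the one generated by
  the regular functions, so the box of \<open>Z\<close> is compact for the latter too. The inverse
  chart is a morphism, hence continuous, and carries the box to \<open>X\<close>.\<close>

lemma affine_chart_box_compact:
  assumes X: "space_with_functions X" and U: "openin (zariski X) U"
    and Z: "closedin (zariski (affine_space n)) Z"
    and \<phi>: "isomorphism (induced X U) (induced (affine_space n) Z) \<phi>"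
  shows "compactin (analytic_topology X) {x\<in>U. \<forall>i<n. norm (\<phi> x i) \<le> R}"
proof -
  let ?K = "{z\<in>Z. \<forall>i<n. norm (z i) \<le> R}" and ?\<psi> = "inv_into U \<phi>"
  have sub: "Z \<subseteq> affine_points n" using closedin_subset[OF Z] by simp
  have bij: "bij_betw \<phi> U Z" and m: "morphism (induced (affine_space n) Z) (induced X U) ?\<psi>"
    using \<phi> unfolding isomorphism_def by simp_all
  have m': "morphism (induced (affine_space n) Z) X ?\<psi>"
    using m unfolding morphism_induced_iff[OF swf_induced X openin_subset[OF U]] by blast
  have "compactin (top_of_set Z) ?K"
    unfolding compactin_subtopology using compact_affine_box[OF Z] by auto
  moreover have "continuous_map (top_of_set Z) (analytic_topology (induced (affine_space n) Z)) (\<lambda>z. z)"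
    unfolding continuous_map_def
  proof (intro conjI allI impI)
    show "(\<lambda>z. z) \<in> topspace (top_of_set Z) \<rightarrow> topspace (analytic_topology (induced (affine_space n) Z))"
      using topspace_analytic[OF swf_induced, of "affine_space n" Z] by simp
    fix V assume V: "openin (analytic_topology (induced (affine_space n) Z)) V"
    have "openin (top_of_set Z) V"
      by (rule openin_analytic_finer[OF swf_induced induced_affine_continuous[OF sub] V])
    moreover have "{x \<in> topspace (top_of_set Z). x \<in> V} = V"
      using openin_subset[OF calculation] by auto
    ultimately show "openin (top_of_set Z) {x \<in> topspace (top_of_set Z). x \<in> V}" by simp
  qed
  ultimately have "compactin (analytic_topology (induced (affine_space n) Z)) ((\<lambda>z. z) ` ?K)"
    by (rule image_compactin)
  then have "compactin (analytic_topology X) (?\<psi> ` (\<lambda>z. z) ` ?K)"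
    by (rule image_compactin[OF _ morphism_analytic_continuous[OF swf_induced X m']])
  moreover have "?\<psi> ` (\<lambda>z. z) ` ?K = {x\<in>U. \<forall>i<n. norm (\<phi> x i) \<le> R}"
  proof (intro Set.set_eqI iffI)
    fix x assume "x \<in> ?\<psi> ` (\<lambda>z. z) ` ?K"
    then obtain z where z: "z \<in> ?K" "x = ?\<psi> z" by auto
    then have "\<phi> x = z" "x \<in> U" using bij bij_betw_inv_into_right[OF bij] bij_betwE[OF bij_betw_inv_into[OF bij]] by auto
    with z show "x \<in> {x\<in>U. \<forall>i<n. norm (\<phi> x i) \<le> R}" by simp
  next
    fix x assume x: "x \<in> {x\<in>U. \<forall>i<n. norm (\<phi> x i) \<le> R}"
    then have "?\<psi> (\<phi> x) = x" "\<phi> x \<in> ?K" using bij_betw_inv_into_left[OF bij] bij_betwE[OF bij] by auto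
    then show "x \<in> ?\<psi> ` (\<lambda>z. z) ` ?K" unfolding image_ident by (intro image_eqI[of x ?\<psi> "\<phi> x"]) simp_all
  qed
  ultimately show ?thesis by simp
qed

section \<open>Compactness of proper varieties\<close>

text \<open>
  If the reciprocals of suitable chart coordinates could all be small simultaneously, then the closure
  of the graph of these reciprocals would contain a point over the origin of affine space. In some
  chart around this point one of the equations (reciprocal) (coordinate) = 1 extends to the closure,
  which is absurd over the origin.
\<close>

lemma reciprocals_bounded_below:
  fixes X :: "'a fspace" and \<phi> :: "nat \<Rightarrow> 'a \<Rightarrow> nat \<Rightarrow> complex"
  assumes X: "space_with_functions X" and proper: "proper X"
    and V: "\<And>j. j < m \<Longrightarrow> openin (zariski X) (V j)" and cover: "points X \<subseteq> (\<Union>j<m. V j)"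
    and \<phi>: "\<And>j. j < m \<Longrightarrow> (\<lambda>x. \<phi> j x (s j)) \<in> regular X (V j)"
  shows "\<exists>\<epsilon>>0. \<forall>x\<in>points X. (\<forall>j<m. x \<in> V j \<longleftrightarrow> j \<in> J) \<longrightarrow> (\<forall>j<m. j \<in> J \<longrightarrow> \<phi> j x (s j) \<noteq> 0) \<longrightarrow>
    (\<exists>j<m. j \<in> J \<and> norm (1 / \<phi> j x (s j)) \<ge> \<epsilon>)"
proof -
  let ?A = "affine_space m" and ?P = "product_space X (affine_space m)"
  \<comment> \<open>Fixing the set \<open>J\<close> of all charts that contain the point turns the
    reciprocals into one map \<open>y\<close> to affine space, with zeros filled in for the
    remaining charts.\<close>
  define B where "B = {x\<in>points X. (\<forall>j<m. x \<in> V j \<longleftrightarrow> j \<in> J) \<and> (\<forall>j<m. j \<in> J \<longrightarrow> \<phi> j x (s j) \<noteq> 0)}"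
  define y where "y x j = (if j < m \<and> j \<in> J then 1 / \<phi> j x (s j) else 0)" for x and j :: nat
  have yA: "y x \<in> affine_points m" for x unfolding y_def affine_points_def by auto
  define \<Gamma> where "\<Gamma> = (\<lambda>x. (x, y x)) ` B"
  define Z where "Z = zariski ?P closure_of \<Gamma>"
  have P: "space_with_functions ?P" by (rule swf_product_space)
  note fs = morphism_fst_snd[OF X swf_affine_space[of m] order_refl, folded product_space_def]
  have "closedin (zariski ?P) Z" unfolding Z_def by simp
  moreover have "closed_map (zariski ?P) (zariski ?A) snd"
    using proper variety_affine_space unfolding proper_def by blast
  ultimately have cl: "closedin (zariski ?A) (snd ` Z)" unfolding closed_map_def by blast
  have "(x, \<lambda>_. 0) \<notin> Z" for x
  proof
    assume z: "(x, \<lambda>_. 0) \<in> Z"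
    then have xP: "(x, \<lambda>_. 0) \<in> points ?P" and meet: "\<And>T. (x, \<lambda>_. 0) \<in> T \<Longrightarrow> openin (zariski ?P) T \<Longrightarrow> \<exists>p\<in>\<Gamma>. p \<in> T"
      unfolding Z_def in_closure_of by blast+
    then obtain j where j: "j < m" "x \<in> V j" using cover by auto
    show False
    proof (cases "j \<in> J")
      \<comment> \<open>No point of \<open>B\<close> lies in \<open>V j\<close>, so an open set over
        \<open>V j\<close> misses the graph and cannot contain a point of its closure.\<close>
      case False
      have "openin (zariski ?P) {p \<in> points ?P. fst p \<in> V j}" by (rule morphism_openin[OF fs(1) V[OF j(1)]])
      from meet[OF _ this] xP j obtain p where "p \<in> \<Gamma>" "fst p \<in> V j" by auto
      with False j(1) show False unfolding \<Gamma>_def B_def by auto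
    next
      case True
      have 1: "(\<lambda>p. \<phi> j (fst p) (s j)) \<in> regular ?P {p \<in> points ?P. fst p \<in> V j}"
        by (rule morphism_regular[OF fs(1) \<phi>[OF j(1)]])
      have 2: "(\<lambda>p. snd p j) \<in> regular ?P {p \<in> points ?P. snd p \<in> affine_points m}"
        by (rule morphism_regular[OF fs(2) coordinate_regular])
      let ?D = "{p \<in> points ?P. fst p \<in> V j} \<inter> {p \<in> points ?P. snd p \<in> affine_points m} \<inter> points ?P"
      have "(\<lambda>p. \<phi> j (fst p) (s j) * snd p j + (-1)) \<in> regular ?P ?D"
        by (rule regular_Int_mult(1)[OF P regular_Int_mult(2)[OF P 1 2] regular_const[OF P openin_topspace]])
      from regular_nonzero_openin[OF P this]
      have "openin (zariski ?P) {p \<in> ?D. \<phi> j (fst p) (s j) * snd p j + (-1) \<noteq> 0}" .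
      from meet[OF _ this] xP j obtain p where p: "p \<in> \<Gamma>" "\<phi> j (fst p) (s j) * snd p j + (-1) \<noteq> 0" by auto
      then show False using True j(1) unfolding \<Gamma>_def B_def y_def by auto
    qed
  qed
  then have "(\<lambda>_. 0) \<notin> snd ` Z" by auto
  moreover have "openin (zariski ?A) (affine_points m - snd ` Z)" using cl unfolding closedin_def by simp
  then obtain T where T: "open T" "affine_points m - snd ` Z = affine_points m \<inter> T"
    by (rule affine_zariski_open_classical)
  ultimately have "(\<lambda>_. 0) \<in> T" unfolding affine_points_def by auto
  with T(1) obtain N where N: "(\<lambda>_. 0) \<in> Pi\<^sub>E UNIV N" "\<forall>i. open (N i)" "Pi\<^sub>E UNIV N \<subseteq> T"
    using product_topology_open_contains_basis[of "\<lambda>_. euclidean" UNIV T "\<lambda>_. 0"] unfolding open_fun_def by auto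
  have "\<exists>\<epsilon>>0. ball 0 \<epsilon> \<subseteq> N i" for i
    using N(1,2) open_contains_ball[of "N i"] by (auto simp: PiE_iff)
  then obtain \<epsilon> where \<epsilon>: "\<And>i. \<epsilon> i > 0" "\<And>i. ball 0 (\<epsilon> i) \<subseteq> N i" by metis
  \<comment> \<open>The 1 keeps the minimum meaningful when there are no charts.\<close>
  define \<delta> where "\<delta> = Min (insert 1 (\<epsilon> ` {..<m}))"
  have \<delta>: "\<delta> > 0" "\<And>i. i < m \<Longrightarrow> \<delta> \<le> \<epsilon> i" unfolding \<delta>_def using \<epsilon>(1) by auto
  have "\<exists>j<m. j \<in> J \<and> norm (1 / \<phi> j x (s j)) \<ge> \<delta>" if x: "x \<in> B" for x
  proof (rule ccontr)
    assume neg: "\<not> ?thesis"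
    have "y x j \<in> N j" for j
    proof (cases "j < m \<and> j \<in> J")
      case True
      then have "norm (y x j) < \<epsilon> j" using neg \<delta>(2)[of j] unfolding y_def by force
      then show ?thesis using \<epsilon>(2)[of j] by (auto simp: subset_iff dist_norm)
    next
      case False
      then have "y x j = 0" unfolding y_def by auto
      then show ?thesis using N(1) by (auto simp: PiE_iff)
    qed
    then have "y x \<in> T" using N(3) by auto
    then have "y x \<notin> snd ` Z" using T(2) yA by auto
    moreover have "(x, y x) \<in> Z"
    proof -
      have "\<Gamma> \<subseteq> points ?P" unfolding \<Gamma>_def B_def using yA by auto
      moreover have "(x, y x) \<in> \<Gamma>" using x unfolding \<Gamma>_def by (rule imageI)
      ultimately show ?thesis unfolding Z_def by (rule subsetD[OF closure_of_subset])
    qed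
    ultimately show False by force
  qed
  with \<delta>(1) show ?thesis unfolding B_def by blast
qed

text \<open>For large \<open>R\<close> the boxes of radius \<open>R\<close> in finitely many affine
  charts cover \<open>X\<close>. A point outside all boxes has, in every chart containing it, a
  coordinate larger than \<open>R\<close>. The set of these charts together with the choice of
  coordinates takes finitely many values, and for each of them
  \<open>reciprocals_bounded_below\<close> bounds one of the chosen coordinates from above; so one
  \<open>R\<close> serves all.\<close>

lemma compact_space_proper:
  assumes proper: "proper X" shows "compact_space (analytic_topology X)"
proof -
  have X: "space_with_functions X" using proper unfolding proper_def variety_def prevariety_def by blast
  have "\<exists>\<U>. finite \<U> \<and> \<Union>\<U> = points X \<and> (\<forall>U\<in>\<U>. openin (zariski X) U \<and> affine_variety (induced X U))"
    using proper unfolding proper_def variety_def prevariety_def by (elim conjE)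
  then obtain \<U> where \<U>: "finite \<U>" "\<Union>\<U> = points X" "\<forall>U\<in>\<U>. openin (zariski X) U \<and> affine_variety (induced X U)"
    by (elim exE conjE)
  obtain V0 and m :: nat where V0: "\<U> = V0 ` {i. i < m}" using finite_imp_nat_seg_image_inj_on[OF \<U>(1)] by blast
  have V: "openin (zariski X) (V0 j)" "affine_variety (induced X (V0 j))" if "j < m" for j
    using \<U>(3) V0 that by auto
  have cover: "points X = (\<Union>j<m. V0 j)" using \<U>(2) V0 by auto
  have "\<forall>j\<in>{..<m}. \<exists>q. closedin (zariski (affine_space (fst q))) (fst (snd q)) \<and>
     isomorphism (induced X (V0 j)) (induced (affine_space (fst q)) (fst (snd q))) (snd (snd q))"
    using V(2) unfolding affine_variety_def by fastforce
  from bchoice[OF this] obtain q where q: "\<forall>j\<in>{..<m}. closedin (zariski (affine_space (fst (q j)))) (fst (snd (q j))) \<and>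
     isomorphism (induced X (V0 j)) (induced (affine_space (fst (q j))) (fst (snd (q j)))) (snd (snd (q j)))"
    by (elim exE)
  define n Z \<phi> where "n j = fst (q j)" and "Z j = fst (snd (q j))" and "\<phi> j = snd (snd (q j))" for j
  have Z: "closedin (zariski (affine_space (n j))) (Z j)"
    and \<phi>: "isomorphism (induced X (V0 j)) (induced (affine_space (n j)) (Z j)) (\<phi> j)" if "j < m" for j
    using q that unfolding n_def Z_def \<phi>_def by auto
  have reg: "(\<lambda>x. \<phi> j x i) \<in> regular X (V0 j)" if j: "j < m" for i j
  proof -
    have sub: "Z j \<subseteq> points (affine_space (n j))" by (rule closedin_subset[OF Z[OF j]])
    have "morphism (induced X (V0 j)) (affine_space (n j)) (\<phi> j)"
      using \<phi>[OF j] morphism_induced_iff[OF swf_induced swf_affine_space sub]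
      unfolding isomorphism_def by blast
    from morphism_regular[OF this coordinate_regular]  morphism_points[OF this]
    have "(\<lambda>x. \<phi> j x i) \<in> regular (induced X (V0 j)) {x \<in> V0 j. \<phi> j x \<in> affine_points (n j)}"
      "{x \<in> V0 j. \<phi> j x \<in> affine_points (n j)} = V0 j" by auto
    then show ?thesis using regular_induced_open[OF X V(1)[OF j], of "V0 j"] by simp
  qed
  define Q where "Q = (\<lambda>(J, s) R. \<forall>x\<in>points X. (\<forall>j<m. x \<in> V0 j \<longleftrightarrow> j \<in> J) \<longrightarrow>
    (\<forall>j<m. j \<in> J \<longrightarrow> \<phi> j x (s j) \<noteq> 0) \<longrightarrow> (\<exists>j<m. j \<in> J \<and> norm (\<phi> j x (s j)) \<le> R))"
  \<comment> \<open>The index \<open>n j\<close> is included so that the default choice 0 is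
    admissible even in a chart of dimension 0; what counts is finiteness.\<close>
  let ?I = "Pow {..<m} \<times> (\<Pi>\<^sub>E j\<in>{..<m}. {..n j})"
  have Q: "eventually (Q p) (at_top :: real filter)" for p
  proof -
    obtain J s where p: "p = (J, s)" by (cases p)
    obtain \<epsilon> :: real where \<epsilon>: "\<epsilon> > 0" "\<forall>x\<in>points X. (\<forall>j<m. x \<in> V0 j \<longleftrightarrow> j \<in> J) \<longrightarrow>
      (\<forall>j<m. j \<in> J \<longrightarrow> \<phi> j x (s j) \<noteq> 0) \<longrightarrow> (\<exists>j<m. j \<in> J \<and> norm (1 / \<phi> j x (s j)) \<ge> \<epsilon>)"
      using reciprocals_bounded_below[where X=X and V=V0 and m=m and s=s and J=J and \<phi>=\<phi>, OF X proper V(1) _ reg] cover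
      by auto
    have "Q p R" if R: "R \<ge> 1 / \<epsilon>" for R
      unfolding Q_def p prod.case
    proof (intro ballI impI)
      fix x assume x: "x \<in> points X" "\<forall>j<m. (x \<in> V0 j) = (j \<in> J)" "\<forall>j<m. j \<in> J \<longrightarrow> \<phi> j x (s j) \<noteq> 0"
      then obtain j where j: "j < m" "j \<in> J" "norm (1 / \<phi> j x (s j)) \<ge> \<epsilon>" using \<epsilon>(2) by blast
      have "norm (\<phi> j x (s j)) > 0" using x j by auto
      then have "norm (\<phi> j x (s j)) \<le> 1 / \<epsilon>" using j(3) \<epsilon>(1) by (simp add: norm_divide field_simps)
      with R j show "\<exists>j<m. j \<in> J \<and> norm (\<phi> j x (s j)) \<le> R" by (intro exI[of _ j]) auto
    qed
    then show ?thesis unfolding eventually_at_top_linorder by blast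
  qed
  have "finite ?I" by (intro finite_cartesian_product finite_PiE) auto
  then have "eventually (\<lambda>R. \<forall>p\<in>?I. Q p R) (at_top :: real filter)"
    by (rule eventually_ball_finite) (use Q in blast)
  \<comment> \<open>The bound \<open>R \<ge> 1\<close> makes coordinates larger than
    \<open>R\<close> nonzero, as the premise inside \<open>Q\<close> requires.\<close>
  then obtain R where R: "R \<ge> 1" "\<forall>p\<in>?I. Q p R"
    unfolding eventually_at_top_linorder by (metis max.cobounded1 max.cobounded2)
  let ?E = "\<lambda>j. {x\<in>V0 j. \<forall>i<n j. norm (\<phi> j x i) \<le> R}"
  have "points X \<subseteq> (\<Union>j<m. ?E j)"
  proof
    fix x assume x: "x \<in> points X"
    define J where "J = {j. j < m \<and> x \<in> V0 j}"
    show "x \<in> (\<Union>j<m. ?E j)"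
    proof (rule ccontr)
      assume neg: "x \<notin> (\<Union>j<m. ?E j)"
      have "\<exists>i<n j. (\<forall>i'<n j. norm (\<phi> j x i') \<le> norm (\<phi> j x i)) \<and> norm (\<phi> j x i) > R" if "j \<in> J" for j
      proof -
        have "j < m" "x \<in> V0 j" using that unfolding J_def by auto
        then have "\<not> (\<forall>i<n j. norm (\<phi> j x i) \<le> R)" using neg by blast
        then obtain i0 where i0: "i0 < n j" "norm (\<phi> j x i0) > R" by (auto simp: not_le)
        define M where "M = Max ((\<lambda>i. norm (\<phi> j x i)) ` {..<n j})"
        have "M \<in> (\<lambda>i. norm (\<phi> j x i)) ` {..<n j}" unfolding M_def by (rule Max_in) (use i0 in auto)
        then obtain i where i: "i < n j" "M = norm (\<phi> j x i)" by auto
        have "norm (\<phi> j x i') \<le> M" if "i' < n j" for i' unfolding M_def by (rule Max_ge) (use that in auto)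
        with i i0 show ?thesis by (intro exI[of _ i]) force
      qed
      then have "\<forall>j\<in>J. \<exists>i. i < n j \<and> (\<forall>i'<n j. norm (\<phi> j x i') \<le> norm (\<phi> j x i)) \<and> norm (\<phi> j x i) > R" by blast
      from bchoice[OF this] obtain s where s: "\<forall>j\<in>J. s j < n j \<and> (\<forall>i'<n j. norm (\<phi> j x i') \<le> norm (\<phi> j x (s j))) \<and> norm (\<phi> j x (s j)) > R"
        by (elim exE)
      define s' where "s' = (\<lambda>j\<in>{..<m}. if j \<in> J then s j else 0)"
      have s': "s' j = s j" if "j \<in> J" for j using that unfolding s'_def J_def by auto
      have "(J, s') \<in> ?I" using s unfolding s'_def J_def by (auto simp: less_imp_le)
      then have "Q (J, s') R" using R(2) by blast
      moreover have "\<forall>j<m. x \<in> V0 j \<longleftrightarrow> j \<in> J" unfolding J_def by auto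
      moreover have "\<forall>j<m. j \<in> J \<longrightarrow> \<phi> j x (s' j) \<noteq> 0" using s s' R(1) by fastforce
      ultimately obtain j where "j \<in> J" "norm (\<phi> j x (s' j)) \<le> R" using x unfolding Q_def by auto
      then show False using s s' by force
    qed
  qed
  moreover have "compactin (analytic_topology X) (?E j)" if "j < m" for j
    by (rule affine_chart_box_compact[OF X V(1)[OF that] Z[OF that] \<phi>[OF that]])
  then have "compactin (analytic_topology X) (\<Union> (?E ` {..<m}))"
    by (intro compactin_Union) auto
  moreover have "\<Union> (?E ` {..<m}) \<subseteq> points X" using cover by auto
  ultimately have "compactin (analytic_topology X) (\<Union> (?E ` {..<m}))" "\<Union> (?E ` {..<m}) = points X" by auto
  then show ?thesis unfolding compact_space_def topspace_analytic[OF X] by (rule back_subst)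
qed

text \<open>The Zariski topology of the product is generated by functions coming from the factors,
  and these are continuous for the product of the classical topologies. The complement of the
  diagonal, Zariski open by separatedness, is therefore open in that product, and its boxes separate
  points.\<close>

lemma Hausdorff_space_variety:
  assumes var: "variety X" shows "Hausdorff_space (analytic_topology X)"
  unfolding Hausdorff_space_def
proof (intro allI impI)
  have X: "space_with_functions X" using var unfolding variety_def prevariety_def by blast
  let ?a = "analytic_topology X" and ?S = "points X \<times> points X"
  let ?G = "pulled_back ?S fst X \<union> pulled_back ?S snd X"
  let ?\<tau> = "prod_topology ?a ?a"
  fix x y assume xy: "x \<in> topspace ?a \<and> y \<in> topspace ?a \<and> x \<noteq> y"
  have "openin (zariski (initial_space ?S ?G)) (?S - {(x, x) |x. x \<in> points X})"
    using var unfolding variety_def closedin_def product_space_def fibre_space_def[symmetric]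
    by (simp add: points_fibre_space)
  then have "openin ?\<tau> (?S - {(x, x) |x. x \<in> points X})"
  proof (rule zariski_open_imp_initial[rotated -1])
    show "D \<subseteq> ?S" if "(D, f) \<in> ?G" for D f using that by (auto dest: pulled_back_dom)
    show "openin ?\<tau> ?S" using openin_topspace[of ?\<tau>] topspace_analytic[OF X] by simp
    show "continuous_on_open ?\<tau> D f" if "(D, f) \<in> ?G" for D f
      unfolding continuous_on_open_def
    proof (intro allI impI)
      fix W :: "complex set" assume W: "open W"
      from that show "openin ?\<tau> {x \<in> D. f x \<in> W}"
      proof
        assume "(D, f) \<in> pulled_back ?S fst X"
        then obtain V g where Vg: "D = {p\<in>?S. fst p \<in> V}" "f = (\<lambda>p. g (fst p))" "g \<in> regular X V"
          unfolding pulled_back_def by auto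
        have "V \<subseteq> points X" by (rule openin_subset[OF regular_openin[OF X Vg(3)]])
        then have "{x \<in> D. f x \<in> W} = {x\<in>V. g x \<in> W} \<times> points X" unfolding Vg by auto
        then show ?thesis using openin_analytic[OF X Vg(3) W] openin_topspace[of ?a]
          unfolding topspace_analytic[OF X] by (simp add: openin_prod_Times_iff)
      next
        assume "(D, f) \<in> pulled_back ?S snd X"
        then obtain V g where Vg: "D = {p\<in>?S. snd p \<in> V}" "f = (\<lambda>p. g (snd p))" "g \<in> regular X V"
          unfolding pulled_back_def by auto
        have "V \<subseteq> points X" by (rule openin_subset[OF regular_openin[OF X Vg(3)]])
        then have "{x \<in> D. f x \<in> W} = points X \<times> {x\<in>V. g x \<in> W}" unfolding Vg by auto
        then show ?thesis using openin_analytic[OF X Vg(3) W] openin_topspace[of ?a]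
          unfolding topspace_analytic[OF X] by (simp add: openin_prod_Times_iff)
      qed
    qed
  qed
  moreover have "(x, y) \<in> ?S - {(x, x) |x. x \<in> points X}" using xy topspace_analytic[OF X] by auto
  ultimately have "\<exists>A B. openin ?a A \<and> openin ?a B \<and> x \<in> A \<and> y \<in> B \<and> A \<times> B \<subseteq> ?S - {(x, x) |x. x \<in> points X}"
    unfolding openin_prod_topology_alt by (elim allE impE)
  then obtain A B where AB: "openin ?a A" "openin ?a B" "x \<in> A" "y \<in> B" "A \<times> B \<subseteq> ?S - {(x, x) |x. x \<in> points X}"
    by (elim exE conjE)
  then have "disjnt A B" unfolding disjnt_iff by blast
  with AB show "\<exists>U V. openin ?a U \<and> openin ?a V \<and> x \<in> U \<and> y \<in> V \<and> disjnt U V" by blast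
qed

section \<open>Regular functions on proper connected varieties\<close>

text \<open>Supplies finiteness of zero sets on the affine line through the finiteness of the roots
  of a polynomial.\<close>

lemma polynomial_function:
  assumes "(D, f) \<in> generated_algebra (affine_points 1) (coordinates 1)"
  shows "D = affine_points 1 \<and> (\<exists>p. \<forall>z\<in>affine_points 1. f z = poly p (z 0))"
  using assms
proof induction
  case (const c) then show ?case by (auto intro!: exI[of _ "[:c:]"])
next
  case (gen D f) then show ?case unfolding coordinates_def by (auto intro!: exI[of _ "[:0, 1:]"])
next
  case (add D f E g)
  then obtain p q where "\<forall>z\<in>affine_points 1. f z = poly p (z 0)" "\<forall>z\<in>affine_points 1. g z = poly q (z 0)" by blast
  with add show ?case by (auto intro!: exI[of _ "p + q"])
next
  case (mult D f E g)
  then obtain p q where "\<forall>z\<in>affine_points 1. f z = poly p (z 0)" "\<forall>z\<in>affine_points 1. g z = poly q (z 0)" by blast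
  with mult show ?case by (auto intro!: exI[of _ "p * q"])
qed

text \<open>The graph of \<open>h\<close> is closed, so by properness its image in the affine line
  is closed; by compactness of \<open>X\<close> it is bounded. It therefore misses a point, lies in
  the zero set of a nonzero polynomial and is finite. The fibres of \<open>h\<close> are then open
  as well as closed, and connectedness leaves only one.\<close>

lemma regular_constant:
  assumes proper: "proper X" and con: "connected_space (zariski X)" and h: "h \<in> regular X (points X)"
    and x0: "x0 \<in> points X" and x: "x \<in> points X"
  shows "h x = h x0"
proof -
  have X: "space_with_functions X" using proper unfolding proper_def variety_def prevariety_def by blast
  let ?A = "affine_space 1" and ?P = "product_space X (affine_space 1)"
  have P: "space_with_functions ?P" by (rule swf_product_space)
  note fs = morphism_fst_snd[OF X swf_affine_space[of 1] order_refl, folded product_space_def]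
  let ?\<Gamma> = "{p \<in> points ?P. snd p 0 = h (fst p)}"
  have 1: "(\<lambda>p. h (fst p)) \<in> regular ?P {p \<in> points ?P. fst p \<in> points X}" by (rule morphism_regular[OF fs(1) h])
  have 2: "(\<lambda>p. snd p 0) \<in> regular ?P {p \<in> points ?P. snd p \<in> affine_points 1}"
    by (rule morphism_regular[OF fs(2) coordinate_regular])
  let ?D = "{p \<in> points ?P. snd p \<in> affine_points 1} \<inter> (points ?P \<inter> {p \<in> points ?P. fst p \<in> points X})"
  have "(\<lambda>p. snd p 0 + (-1) * h (fst p)) \<in> regular ?P ?D"
    by (rule regular_Int_mult(1)[OF P 2 regular_Int_mult(2)[OF P regular_const[OF P openin_topspace] 1]])
  from regular_nonzero_openin[OF P this]
  have "openin (zariski ?P) {p \<in> ?D. snd p 0 + (-1) * h (fst p) \<noteq> 0}" .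
  moreover have "{p \<in> ?D. snd p 0 + (-1) * h (fst p) \<noteq> 0} = points ?P - ?\<Gamma>" by auto
  ultimately have "closedin (zariski ?P) ?\<Gamma>" unfolding closedin_def by simp
  moreover have "closed_map (zariski ?P) (zariski ?A) snd"
    using proper variety_affine_space unfolding proper_def by blast
  ultimately have "closedin (zariski ?A) (snd ` ?\<Gamma>)" unfolding closed_map_def by blast
  then have op: "openin (zariski ?A) (affine_points 1 - snd ` ?\<Gamma>)" unfolding closedin_def by simp
  have hc: "continuous_map (analytic_topology X) euclidean h"
    unfolding continuous_map_def topspace_analytic[OF X] using openin_analytic[OF X h] by auto
  have "compact (h ` points X)"
    using image_compactin[OF compact_space_proper[OF proper, unfolded compact_space_def] hc]
    unfolding topspace_analytic[OF X] by simp
  from compact_imp_bounded[OF this] obtain B where "\<forall>w\<in>h ` points X. norm w \<le> B" unfolding bounded_iff by (elim exE)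
  then have B: "norm (h x) \<le> B" if "x \<in> points X" for x using that by blast
  \<comment> \<open>A value that \<open>h\<close> cannot attain; the absolute value guards against a
    negative \<open>B\<close>, which is possible only if there are no points.\<close>
  define y0 :: "nat \<Rightarrow> complex" where "y0 i = (if i = 0 then of_real (\<bar>B\<bar> + 1) else 0)" for i
  have "y0 \<in> affine_points 1" unfolding y0_def affine_points_def by auto
  moreover have "y0 \<notin> snd ` ?\<Gamma>"
  proof
    assume "y0 \<in> snd ` ?\<Gamma>"
    then obtain p where p: "p \<in> points ?P" "y0 0 = h (fst p)" by auto
    then have "norm (y0 0) \<le> B" using B[of "fst p"] by auto
    then show False unfolding y0_def by simp
  qed
  ultimately have "y0 \<in> affine_points 1 - snd ` ?\<Gamma>" by simp
  then have "y0 \<in> affine_points 1 - snd ` ?\<Gamma>" .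
  moreover have "openin (initial_topology (affine_points 1) (coordinates 1)) (affine_points 1 - snd ` ?\<Gamma>)"
    using op unfolding affine_space_def[of 1, symmetric] zariski_initial_space[symmetric] .
  ultimately have "\<exists>D q. (D, q) \<in> generated_algebra (affine_points 1) (coordinates 1) \<and> y0 \<in> D \<and> q y0 \<noteq> 0 \<and>
    {y \<in> D. q y \<noteq> 0} \<subseteq> affine_points 1 - snd ` ?\<Gamma>"
    by (intro initial_topology_basis)
  then obtain E q where q: "(E, q) \<in> generated_algebra (affine_points 1) (coordinates 1)" "q y0 \<noteq> 0"
    "y0 \<in> E" "{y \<in> E. q y \<noteq> 0} \<subseteq> affine_points 1 - snd ` ?\<Gamma>"
    by (elim exE conjE)
  obtain p where p: "E = affine_points 1" "\<forall>z\<in>affine_points 1. q z = poly p (z 0)" using polynomial_function[OF q(1)] by blast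
  have p0: "p \<noteq> 0" using q(2,3) p by auto
  have "h ` points X \<subseteq> {w. poly p w = 0}"
  proof
    fix w assume "w \<in> h ` points X"
    then obtain x where x: "x \<in> points X" "w = h x" by blast
    define y where "y i = (if i = (0::nat) then h x else 0)" for i
    have y: "y \<in> affine_points 1" unfolding y_def affine_points_def by auto
    have "(x, y) \<in> ?\<Gamma>" using x y by (simp add: y_def)
    then have "y \<in> snd ` ?\<Gamma>" by force
    then have "q y = 0" using q(4) p(1) y by blast
    then show "w \<in> {w. poly p w = 0}" using p(2) y x by (simp add: y_def)
  qed
  then have fin: "finite (h ` points X)" using poly_roots_finite[OF p0] finite_subset by blast
  have ne: "openin (zariski X) {x \<in> points X. h x \<noteq> c}" for c
    using regular_nonzero_openin[OF X regular_add[OF X h regular_const[OF X openin_topspace, of "- c"]]] by simp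
  let ?E = "{x \<in> points X. h x = h x0}"
  have "closedin (zariski X) ?E"
  proof -
    have "points X - ?E = {x \<in> points X. h x \<noteq> h x0}" by auto
    then show ?thesis using ne unfolding closedin_def by simp
  qed
  moreover have "openin (zariski X) ?E"
  proof -
    have "?E = points X \<inter> (\<Inter>c\<in>h ` points X - {h x0}. {x \<in> points X. h x \<noteq> c})" by auto
    moreover have "openin (zariski X) (points X \<inter> (\<Inter>c\<in>h ` points X - {h x0}. {x \<in> points X. h x \<noteq> c}))"
    proof (cases "h ` points X - {h x0} = {}")
      case False
      then show ?thesis by (intro openin_Int openin_topspace openin_Inter) (use fin ne in auto)
    next
      case True
      show ?thesis unfolding True by simp
    qed
    ultimately show ?thesis by simp
  qed
  ultimately have "?E = points X" using con x0 unfolding connected_space_clopen_in by blast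
  then show ?thesis using x by blast
qed

section \<open>Bounded measurable functions\<close>

lemma ln_norm_mult:
  fixes x y :: complex
  shows "x \<noteq> 0 \<Longrightarrow> y \<noteq> 0 \<Longrightarrow> ln (norm (x * y)) = ln (norm x) + ln (norm y)"
  by (simp add: norm_mult ln_mult)

lemma ln_norm_inverse: "ln (norm (1 / x :: complex)) = - ln (norm x)"
  by (simp add: norm_divide ln_inverse[symmetric] inverse_eq_divide)

lemma ln_norm_divide:
  fixes x y :: complex
  assumes "x \<noteq> 0" "y \<noteq> 0" shows "ln (norm (x / y)) = ln (norm x) - ln (norm y)"
  using ln_norm_mult[of x "1 / y"] ln_norm_inverse[of y] assms by simp

lemma ln_norm_power_int: "ln (norm ((x :: complex) powi n)) = of_int n * ln (norm x)"
proof (cases n rule: int_cases2)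
  case (nonneg m) then show ?thesis by (simp add: norm_power ln_realpow)
next
  case (nonpos m)
  then show ?thesis
    using ln_norm_inverse[of "x ^ m"] by (simp add: power_int_minus inverse_eq_divide norm_power ln_realpow)
qed

lemma ln_norm_prod:
  fixes f :: "nat \<Rightarrow> complex"
  shows "(\<And>i. i < r \<Longrightarrow> f i \<noteq> 0) \<Longrightarrow> ln (norm (\<Prod>i<r. f i)) = (\<Sum>i<r. ln (norm (f i)))"
  by (induction r) (simp_all add: ln_norm_mult)

text \<open>A local condition that compactness turns into boundedness and measurability, hence
  integrability for a finite measure. Continuity would be too much to ask, since the frames will
  jump between Borel pieces.\<close>

definition tame_at :: "'a fspace \<Rightarrow> 'a \<Rightarrow> ('a \<Rightarrow> real) \<Rightarrow> bool" where
  "tame_at X x \<phi> \<longleftrightarrow> (\<exists>N B. openin (analytic_topology X) N \<and> x \<in> N \<and> (\<forall>z\<in>N. \<bar>\<phi> z\<bar> \<le> B) \<and>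
     \<phi> \<in> borel_measurable (restrict_space (analytic_borel X) N))"

context
  fixes X :: "'a fspace"
  assumes X: "space_with_functions X"
begin

lemma openin_analytic_subset: "openin (analytic_topology X) N \<Longrightarrow> N \<subseteq> points X"
  using openin_subset topspace_analytic[OF X] by metis

lemma space_analytic_borel: "space (analytic_borel X) = points X"
  unfolding analytic_borel_def by (rule space_measure_of) (use openin_analytic_subset in blast)

lemma sets_analytic_borel: "openin (analytic_topology X) N \<Longrightarrow> N \<in> sets (analytic_borel X)"
  unfolding analytic_borel_def
  by (subst sets_measure_of) (use openin_analytic_subset in blast)+

lemma closed_sets_analytic_borel: "closedin (analytic_topology X) K \<Longrightarrow> K \<in> sets (analytic_borel X)"
proof -
  assume "closedin (analytic_topology X) K"
  then have "K \<subseteq> points X" "openin (analytic_topology X) (points X - K)"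
    unfolding closedin_def topspace_analytic[OF X] by auto
  moreover from this have "points X - (points X - K) \<in> sets (analytic_borel X)"
    using sets_analytic_borel sets.compl_sets[of "points X - K" "analytic_borel X"] space_analytic_borel by simp
  ultimately show "K \<in> sets (analytic_borel X)" by (simp add: double_diff)
qed

lemma morphism_measurable:
  assumes \<gamma>: "morphism X X \<gamma>" shows "\<gamma> \<in> measurable (analytic_borel X) (analytic_borel X)"
proof -
  have "\<gamma> \<in> measurable (analytic_borel X) (sigma (points X) {V. openin (analytic_topology X) V})"
  proof (rule measurable_measure_of)
    show "{V. openin (analytic_topology X) V} \<subseteq> Pow (points X)" using openin_analytic_subset by blast
    show "\<gamma> \<in> space (analytic_borel X) \<rightarrow> points X" using space_analytic_borel morphism_points[OF \<gamma>] by auto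
    fix V assume "V \<in> {V. openin (analytic_topology X) V}"
    then have "openin (analytic_topology X) {x \<in> topspace (analytic_topology X). \<gamma> x \<in> V}"
      using morphism_analytic_continuous[OF X X \<gamma>] unfolding continuous_map_def by simp
    then have "{x \<in> points X. \<gamma> x \<in> V} \<in> sets (analytic_borel X)"
      unfolding topspace_analytic[OF X] by (rule sets_analytic_borel)
    moreover have "\<gamma> -` V \<inter> space (analytic_borel X) = {x \<in> points X. \<gamma> x \<in> V}"
      unfolding space_analytic_borel by auto
    ultimately show "\<gamma> -` V \<inter> space (analytic_borel X) \<in> sets (analytic_borel X)" by simp
  qed
  then show ?thesis unfolding analytic_borel_def .
qed

lemma tame_atE:
  assumes "tame_at X x \<phi>"
  obtains N B where "openin (analytic_topology X) N" "x \<in> N" "\<forall>z\<in>N. \<bar>\<phi> z\<bar> \<le> B"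
    "\<phi> \<in> borel_measurable (restrict_space (analytic_borel X) N)"
  using assms unfolding tame_at_def by (elim exE conjE) (rule that)

lemma tame_at_add:
  assumes "tame_at X x \<phi>" "tame_at X x \<psi>" shows "tame_at X x (\<lambda>z. \<phi> z + \<psi> z)"
proof -
  obtain N B where N: "openin (analytic_topology X) N" "x \<in> N" "\<forall>z\<in>N. \<bar>\<phi> z\<bar> \<le> B"
    "\<phi> \<in> borel_measurable (restrict_space (analytic_borel X) N)" by (rule tame_atE[OF assms(1)])
  obtain N' B' where N': "openin (analytic_topology X) N'" "x \<in> N'" "\<forall>z\<in>N'. \<bar>\<psi> z\<bar> \<le> B'"
    "\<psi> \<in> borel_measurable (restrict_space (analytic_borel X) N')" by (rule tame_atE[OF assms(2)])
  have "\<phi> \<in> borel_measurable (restrict_space (analytic_borel X) (N \<inter> N'))"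
    "\<psi> \<in> borel_measurable (restrict_space (analytic_borel X) (N \<inter> N'))"
    by (rule measurable_restrict_mono[OF N(4)], simp) (rule measurable_restrict_mono[OF N'(4)], simp)
  then have "(\<lambda>z. \<phi> z + \<psi> z) \<in> borel_measurable (restrict_space (analytic_borel X) (N \<inter> N'))" by simp
  moreover have "\<forall>z\<in>N \<inter> N'. \<bar>\<phi> z + \<psi> z\<bar> \<le> B + B'" using N(3) N'(3) by fastforce
  ultimately show ?thesis unfolding tame_at_def using N(1,2) N'(1,2)
    by (intro exI[of _ "N \<inter> N'"] exI[of _ "B + B'"]) auto
qed

lemma tame_at_const: "x \<in> points X \<Longrightarrow> tame_at X x (\<lambda>_. c)"
  unfolding tame_at_def using openin_topspace[of "analytic_topology X"] topspace_analytic[OF X]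
  by (intro exI[of _ "points X"] exI[of _ "\<bar>c\<bar>"]) auto

lemma tame_at_cmult:
  assumes "tame_at X x \<phi>" shows "tame_at X x (\<lambda>z. c * \<phi> z)"
proof -
  obtain N B where N: "openin (analytic_topology X) N" "x \<in> N" "\<forall>z\<in>N. \<bar>\<phi> z\<bar> \<le> B"
    "\<phi> \<in> borel_measurable (restrict_space (analytic_borel X) N)" by (rule tame_atE[OF assms(1)])
  then have "(\<lambda>z. c * \<phi> z) \<in> borel_measurable (restrict_space (analytic_borel X) N)" by simp
  moreover have "\<forall>z\<in>N. \<bar>c * \<phi> z\<bar> \<le> \<bar>c\<bar> * B" using N(3) by (simp add: abs_mult mult_left_mono)
  ultimately show ?thesis unfolding tame_at_def using N(1,2) by blast
qed

lemma tame_at_diff: "tame_at X x \<phi> \<Longrightarrow> tame_at X x \<psi> \<Longrightarrow> tame_at X x (\<lambda>z. \<phi> z - \<psi> z)"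
  using tame_at_add[of x \<phi> "\<lambda>z. -1 * \<psi> z"] tame_at_cmult[of x \<psi> "-1"] by simp

lemma tame_at_sum:
  fixes r :: nat
  assumes "x \<in> points X" "\<And>i. i < r \<Longrightarrow> tame_at X x (\<phi> i)" shows "tame_at X x (\<lambda>z. \<Sum>i<r. \<phi> i z)"
  using assms(2) by (induction r) (auto intro!: tame_at_add tame_at_const assms(1))

lemma tame_at_unit:
  assumes "unit_at X x f" shows "tame_at X x (\<lambda>z. ln (norm (f z)))"
proof -
  obtain V where V: "openin (zariski X) V" "x \<in> V" "f \<in> regular X V" "\<forall>y\<in>V. f y \<noteq> 0"
    by (rule unit_atE[OF X assms])
  define a where "a = norm (f x)"
  have a: "a > 0" using V unfolding a_def by auto
  \<comment> \<open>An open annulus around the circle through \<open>f x\<close>, staying away from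
    0 and infinity, so that the logarithm is bounded on both sides.\<close>
  define W where "W = {w :: complex. a / 2 < norm w \<and> norm w < 2 * a}"
  have W: "open W" unfolding W_def
    by (intro open_Collect_conj open_Collect_less continuous_intros)
  let ?N = "{z\<in>V. f z \<in> W}"
  have N: "openin (analytic_topology X) ?N" by (rule openin_analytic[OF X V(3) W])
  have VX: "V \<subseteq> points X" by (rule openin_subset[OF V(1)])
  have Vs: "V \<in> sets (analytic_borel X)" by (rule sets_analytic_borel[OF openin_zariski_analytic[OF X V(1)]])
  have "f \<in> borel_measurable (restrict_space (analytic_borel X) V)"
  proof (rule borel_measurableI)
    fix S :: "complex set" assume "open S"
    have "{z\<in>V. f z \<in> S} \<in> sets (analytic_borel X)" by (rule sets_analytic_borel[OF openin_analytic[OF X V(3) \<open>open S\<close>]])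
    moreover have "f -` S \<inter> space (restrict_space (analytic_borel X) V) = {z\<in>V. f z \<in> S}"
      using VX by (auto simp: space_restrict_space space_analytic_borel)
    ultimately show "f -` S \<inter> space (restrict_space (analytic_borel X) V) \<in> sets (restrict_space (analytic_borel X) V)"
      using Vs VX by (simp add: sets_restrict_space_iff space_analytic_borel Int_absorb2)
  qed
  then have "(\<lambda>z. ln (norm (f z))) \<in> borel_measurable (restrict_space (analytic_borel X) V)" by simp
  then have "(\<lambda>z. ln (norm (f z))) \<in> borel_measurable (restrict_space (analytic_borel X) ?N)"
    by (rule measurable_restrict_mono) auto
  moreover have "\<bar>ln (norm (f z))\<bar> \<le> \<bar>ln (a / 2)\<bar> + \<bar>ln (2 * a)\<bar>" if "z \<in> ?N" for z
  proof -
    have "a / 2 < norm (f z)" "norm (f z) < 2 * a" using that unfolding W_def by auto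
    then have "ln (a / 2) \<le> ln (norm (f z))" "ln (norm (f z)) \<le> ln (2 * a)"
      using a by (subst ln_le_cancel_iff; linarith)+
    then show ?thesis by linarith
  qed
  moreover have "x \<in> ?N" using V(2) a unfolding W_def a_def by auto
  ultimately show ?thesis unfolding tame_at_def using N by blast
qed

lemma tame_at_compose:
  assumes \<gamma>: "morphism X X \<gamma>" and x: "x \<in> points X" and \<phi>: "tame_at X (\<gamma> x) \<phi>"
  shows "tame_at X x (\<lambda>z. \<phi> (\<gamma> z))"
proof -
  obtain N B where N: "openin (analytic_topology X) N" "\<gamma> x \<in> N" "\<forall>z\<in>N. \<bar>\<phi> z\<bar> \<le> B"
    "\<phi> \<in> borel_measurable (restrict_space (analytic_borel X) N)" by (rule tame_atE[OF \<phi>])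
  let ?N = "{z \<in> points X. \<gamma> z \<in> N}"
  have "openin (analytic_topology X) ?N"
    using morphism_analytic_continuous[OF X X \<gamma>] N(1) unfolding continuous_map_def topspace_analytic[OF X] by blast
  moreover have "\<gamma> \<in> measurable (restrict_space (analytic_borel X) ?N) (restrict_space (analytic_borel X) N)"
    by (rule measurable_restrict_space3[OF morphism_measurable[OF \<gamma>]]) auto
  from measurable_compose[OF this N(4)]
  have "(\<lambda>z. \<phi> (\<gamma> z)) \<in> borel_measurable (restrict_space (analytic_borel X) ?N)" .
  ultimately show ?thesis unfolding tame_at_def using N(2,3) x by blast
qed

text \<open>Finitely many of the local neighbourhoods cover \<open>X\<close>. The maximum of their
  bounds is a global bound, and measurability is assembled piecewise on this finite cover.\<close>

lemma tame_global:
  assumes comp: "compact_space (analytic_topology X)" and \<phi>: "\<And>x. x \<in> points X \<Longrightarrow> tame_at X x \<phi>"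
  shows "\<phi> \<in> borel_measurable (analytic_borel X)" "\<exists>B. \<forall>z\<in>points X. \<bar>\<phi> z\<bar> \<le> B"
proof -
  define \<U> where "\<U> = {N. openin (analytic_topology X) N \<and> (\<exists>B. \<forall>z\<in>N. \<bar>\<phi> z\<bar> \<le> B) \<and>
     \<phi> \<in> borel_measurable (restrict_space (analytic_borel X) N)}"
  have "topspace (analytic_topology X) \<subseteq> \<Union>\<U>"
  proof
    fix x assume "x \<in> topspace (analytic_topology X)"
    then have x: "x \<in> points X" using topspace_analytic[OF X] by simp
    obtain N B where N: "openin (analytic_topology X) N" "x \<in> N" "\<forall>z\<in>N. \<bar>\<phi> z\<bar> \<le> B"
      "\<phi> \<in> borel_measurable (restrict_space (analytic_borel X) N)"
      by (rule tame_atE[OF \<phi>[OF x]])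
    then have "N \<in> \<U>" unfolding \<U>_def by blast
    with N(2) show "x \<in> \<Union>\<U>" by blast
  qed
  moreover have "\<forall>N\<in>\<U>. openin (analytic_topology X) N" unfolding \<U>_def by blast
  ultimately have "\<exists>\<F>. finite \<F> \<and> \<F> \<subseteq> \<U> \<and> topspace (analytic_topology X) \<subseteq> \<Union>\<F>"
    using comp[unfolded compact_space_alt] by (elim allE[of _ \<U>] impE) (rule conjI)
  then obtain \<F> where \<F>: "finite \<F>" "\<F> \<subseteq> \<U>" "topspace (analytic_topology X) \<subseteq> \<Union>\<F>"
    by (elim exE conjE)
  show "\<phi> \<in> borel_measurable (analytic_borel X)"
  proof (rule measurable_piecewise_restrict)
    show "countable \<F>" using \<F>(1) by (rule countable_finite)
    show "N \<inter> space (analytic_borel X) \<in> sets (analytic_borel X)" if "N \<in> \<F>" for N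
      using that \<F>(2) sets_analytic_borel[of N] unfolding \<U>_def by blast
    show "space (analytic_borel X) \<subseteq> \<Union>\<F>" using \<F>(3) topspace_analytic[OF X] space_analytic_borel by simp
    show "\<phi> \<in> borel_measurable (restrict_space (analytic_borel X) N)" if "N \<in> \<F>" for N
      using that \<F>(2) unfolding \<U>_def by blast
  qed
  have "\<forall>N\<in>\<F>. \<exists>B. \<forall>z\<in>N. \<bar>\<phi> z\<bar> \<le> B" using \<F>(2) unfolding \<U>_def by blast
  from bchoice[OF this] obtain B where B: "\<forall>N\<in>\<F>. \<forall>z\<in>N. \<bar>\<phi> z\<bar> \<le> B N" by (elim exE)
  have "\<bar>\<phi> z\<bar> \<le> Max (B ` \<F>)" if "z \<in> points X" for z
  proof -
    have "z \<in> topspace (analytic_topology X)" using that topspace_analytic[OF X] by simp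
    then have "z \<in> \<Union>\<F>" by (rule subsetD[OF \<F>(3)])
    then obtain N where N: "N \<in> \<F>" "z \<in> N" by (elim UnionE)
    have "\<bar>\<phi> z\<bar> \<le> B N" by (rule B[rule_format, OF N])
    also have "\<dots> \<le> Max (B ` \<F>)" using \<F>(1) N(1) by simp
    finally show ?thesis .
  qed
  then show "\<exists>B. \<forall>z\<in>points X. \<bar>\<phi> z\<bar> \<le> B" by blast
qed

text \<open>
  Here a Hermitian metric is replaced by a frame of locally bounded norm, pieced together from
  the local frames over closed sets that are contained in their domains.
\<close>

lemma gauge_tame:
  assumes comp: "compact_space (analytic_topology X)" and haus: "Hausdorff_space (analytic_topology X)"
    and d: "gauge_on X d"
  obtains h where "\<And>z. h z \<noteq> 0" "\<And>x. x \<in> points X \<Longrightarrow> tame_at X x (\<lambda>z. ln (norm (h z * d x z)))"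
proof -
  let ?a = "analytic_topology X" and ?M = "analytic_borel X"
  have nz: "d x z \<noteq> 0" for x z using d unfolding gauge_on_def by blast
  \<comment> \<open>Compact Hausdorff spaces are regular, so every point has a closed neighbourhood
    inside the set on which its member of the gauge is valid.\<close>
  have nb: "neighbourhood_base_of (closedin ?a) ?a"
    unfolding neighbourhood_base_of_closedin by (rule compact_Hausdorff_imp_regular_space[OF comp haus])
  have "\<exists>q. openin ?a (fst q) \<and> closedin ?a (snd q) \<and> x \<in> fst q \<and> fst q \<subseteq> snd q \<and>
    (\<forall>y\<in>snd q. unit_at X y (\<lambda>z. d x z / d y z))" if "x \<in> points X" for x
  proof -
    from d[unfolded gauge_on_def, THEN conjunct2, rule_format, OF that]
    obtain V where V: "openin (zariski X) V" "x \<in> V" "\<forall>y\<in>V. unit_at X y (\<lambda>z. d x z / d y z)"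
      by (elim exE conjE)
    from nb[unfolded neighbourhood_base_of, rule_format, OF conjI[OF openin_zariski_analytic[OF X V(1)] V(2)]]
    obtain U K where "openin ?a U" "closedin ?a K" "x \<in> U" "U \<subseteq> K" "K \<subseteq> V"
      by (elim exE conjE)
    with V(3) show ?thesis by (intro exI[of _ "(U, K)"]) auto
  qed
  then have "\<forall>x\<in>points X. \<exists>q. openin ?a (fst q) \<and> closedin ?a (snd q) \<and> x \<in> fst q \<and> fst q \<subseteq> snd q \<and>
    (\<forall>y\<in>snd q. unit_at X y (\<lambda>z. d x z / d y z))" by blast
  from bchoice[OF this] obtain q where q: "\<forall>x\<in>points X. openin ?a (fst (q x)) \<and> closedin ?a (snd (q x)) \<and>
    x \<in> fst (q x) \<and> fst (q x) \<subseteq> snd (q x) \<and> (\<forall>y\<in>snd (q x). unit_at X y (\<lambda>z. d x z / d y z))" by (elim exE)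
  have "topspace ?a \<subseteq> \<Union>((\<lambda>x. fst (q x)) ` points X)" using q topspace_analytic[OF X] by blast
  then obtain \<F> where \<F>: "finite \<F>" "\<F> \<subseteq> (\<lambda>x. fst (q x)) ` points X" "topspace ?a \<subseteq> \<Union>\<F>"
    using comp[unfolded compact_space_alt, rule_format, of "(\<lambda>x. fst (q x)) ` points X"] q by blast
  obtain P where P: "finite P" "P \<subseteq> points X" "\<F> = (\<lambda>x. fst (q x)) ` P"
    using finite_subset_image[OF \<F>(1,2)] by blast
  obtain c and m :: nat where c: "P = c ` {i. i < m}" using finite_imp_nat_seg_image_inj_on[OF P(1)] by blast
  define K where "K i = snd (q (c i))" for i
  have cX: "c i \<in> points X" if "i < m" for i using c P(2) that by auto
  have K: "closedin ?a (K i)" "\<And>y. y \<in> K i \<Longrightarrow> unit_at X y (\<lambda>z. d (c i) z / d y z)" if "i < m" for i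
    using q cX[OF that] unfolding K_def by auto
  have cov: "\<exists>i<m. z \<in> K i" if "z \<in> points X" for z
  proof -
    have "z \<in> topspace ?a" using that topspace_analytic[OF X] by simp
    then have "z \<in> (\<Union>x\<in>P. fst (q x))" using \<F>(3) unfolding P(3) by (rule rev_subsetD)
    then obtain x where "x \<in> P" "z \<in> fst (q x)" by (elim UN_E)
    then obtain i where "i < m" "z \<in> fst (q (c i))" using c by auto
    then show ?thesis using q cX[of i] unfolding K_def by blast
  qed
  \<comment> \<open>The first closed set that contains \<open>z\<close>. The level sets of this
    index are differences of closed sets, hence Borel, and they divide the points into
    \<open>m\<close> pieces.\<close>
  define \<kappa> where "\<kappa> z = (LEAST i. z \<in> K i)" for z
  have \<kappa>: "\<kappa> z < m" "z \<in> K (\<kappa> z)" if z: "z \<in> points X" for z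
  proof -
    obtain i where i: "i < m" "z \<in> K i" using cov[OF z] by blast
    show "z \<in> K (\<kappa> z)" unfolding \<kappa>_def by (rule LeastI[of "\<lambda>i. z \<in> K i", OF i(2)])
    have "\<kappa> z \<le> i" unfolding \<kappa>_def by (rule Least_le[of "\<lambda>i. z \<in> K i", OF i(2)])
    with i(1) show "\<kappa> z < m" by simp
  qed
  have meas: "{z \<in> points X. \<kappa> z = i} \<in> sets ?M" if i: "i < m" for i
  proof -
    have "{z \<in> points X. \<kappa> z = i} = K i - (\<Union>j<i. K j)"
    proof (intro Set.set_eqI iffI)
      fix z assume z: "z \<in> {z \<in> points X. \<kappa> z = i}"
      have "z \<notin> K j" if "j < i" for j
        using not_less_Least[of j "\<lambda>i. z \<in> K i"] that z unfolding \<kappa>_def by simp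
      moreover have "z \<in> K i" using \<kappa>(2)[of z] z by simp
      ultimately show "z \<in> K i - (\<Union>j<i. K j)" by blast
    next
      fix z assume z: "z \<in> K i - (\<Union>j<i. K j)"
      then have "\<kappa> z = i" unfolding \<kappa>_def by (intro Least_equality) (auto simp: not_less[symmetric])
      moreover have "z \<in> points X" using z closedin_subset[OF K(1)[OF i]] topspace_analytic[OF X] by auto
      ultimately show "z \<in> {z \<in> points X. \<kappa> z = i}" by simp
    qed
    moreover have "K j \<in> sets ?M" if "j \<le> i" for j using K(1)[of j] closed_sets_analytic_borel i that by auto
    ultimately show ?thesis by (auto intro!: sets.Diff sets.countable_UN')
  qed
  \<comment> \<open>Over the \<open>i\<close>-th piece the frame is replaced by the local section at
    \<open>c i\<close>. The new gauge is there the quotient of \<open>d x\<close> by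
    \<open>d (c i)\<close>, whose germ at \<open>x\<close> is a unit if \<open>x\<close> lies in
    \<open>K i\<close>.\<close>
  define h where "h z = 1 / d (c (\<kappa> z)) z" for z
  have "tame_at X x (\<lambda>z. ln (norm (h z * d x z)))" if x: "x \<in> points X" for x
  proof -
    let ?\<phi> = "\<lambda>z. ln (norm (h z * d x z))"
    \<comment> \<open>For fixed \<open>i\<close> there are two cases. At a point of
      \<open>K i\<close> the quotient is a unit, hence tame; at any other point the complement of
      \<open>K i\<close> is a neighbourhood free of points of the \<open>i\<close>-th piece.
      Closedness is decisive here, since a boundary point of the piece still belongs to
      \<open>K i\<close>.\<close>
    have "\<exists>p. openin ?a (fst p) \<and> x \<in> fst p \<and> (\<forall>z\<in>fst p. \<kappa> z = i \<longrightarrow> \<bar>?\<phi> z\<bar> \<le> snd p) \<and>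
      ?\<phi> \<in> borel_measurable (restrict_space ?M (fst p \<inter> {z. \<kappa> z = i}))" if i: "i < m" for i
    proof (cases "x \<in> K i")
      case True
      have "unit_at X x (\<lambda>z. 1 / (d (c i) z / d x z))" by (rule unit_at_inverse[OF X K(2)[OF i True]])
      then obtain N B where N: "openin ?a N" "x \<in> N" "\<forall>z\<in>N. \<bar>ln (norm (1 / (d (c i) z / d x z)))\<bar> \<le> B"
        "(\<lambda>z. ln (norm (1 / (d (c i) z / d x z)))) \<in> borel_measurable (restrict_space ?M N)"
        by (rule tame_atE[OF tame_at_unit])
      have eq: "?\<phi> z = ln (norm (1 / (d (c i) z / d x z)))" if "\<kappa> z = i" for z
        using that unfolding h_def by simp
      have "(\<lambda>z. ln (norm (1 / (d (c i) z / d x z)))) \<in> borel_measurable (restrict_space ?M (N \<inter> {z. \<kappa> z = i}))"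
        by (rule measurable_restrict_mono[OF N(4)]) auto
      moreover have "?\<phi> \<in> borel_measurable (restrict_space ?M (N \<inter> {z. \<kappa> z = i})) \<longleftrightarrow>
        (\<lambda>z. ln (norm (1 / (d (c i) z / d x z)))) \<in> borel_measurable (restrict_space ?M (N \<inter> {z. \<kappa> z = i}))"
        by (rule measurable_cong) (simp add: space_restrict_space eq)
      ultimately show ?thesis using N(1-3) eq by (intro exI[of _ "(N, B)"]) simp
    next
      case False
      let ?N = "topspace ?a - K i"
      have N: "openin ?a ?N" by (rule openin_diff[OF openin_topspace K(1)[OF i]])
      have none: "\<kappa> z \<noteq> i" if "z \<in> ?N" for z using that \<kappa>(2)[of z] topspace_analytic[OF X] by auto
      have "?\<phi> \<in> borel_measurable (restrict_space ?M (?N \<inter> {z. \<kappa> z = i}))"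
      proof (rule borel_measurableI)
        fix S :: "real set"
        have "?\<phi> -` S \<inter> space (restrict_space ?M (?N \<inter> {z. \<kappa> z = i})) = {}"
          using none by (auto simp: space_restrict_space)
        then show "?\<phi> -` S \<inter> space (restrict_space ?M (?N \<inter> {z. \<kappa> z = i})) \<in> sets (restrict_space ?M (?N \<inter> {z. \<kappa> z = i}))"
          by simp
      qed
      then show ?thesis using N False x none topspace_analytic[OF X] by (intro exI[of _ "(?N, 0)"]) auto
    qed
    then have "\<forall>i\<in>{..<m}. \<exists>p. openin ?a (fst p) \<and> x \<in> fst p \<and> (\<forall>z\<in>fst p. \<kappa> z = i \<longrightarrow> \<bar>?\<phi> z\<bar> \<le> snd p) \<and>
      ?\<phi> \<in> borel_measurable (restrict_space ?M (fst p \<inter> {z. \<kappa> z = i}))" by blast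
    from bchoice[OF this] obtain p where p: "\<forall>i\<in>{..<m}. openin ?a (fst (p i)) \<and> x \<in> fst (p i) \<and>
      (\<forall>z\<in>fst (p i). \<kappa> z = i \<longrightarrow> \<bar>?\<phi> z\<bar> \<le> snd (p i)) \<and>
      ?\<phi> \<in> borel_measurable (restrict_space ?M (fst (p i) \<inter> {z. \<kappa> z = i}))" by (elim exE)
    have m: "{..<m} \<noteq> {}" using cov[OF x] by auto
    define N where "N = (\<Inter>i<m. fst (p i))"
    have N: "openin ?a N" unfolding N_def by (rule openin_Inter) (use m p in auto)
    have xN: "x \<in> N" using p unfolding N_def by auto
    have NX: "N \<subseteq> points X" by (rule openin_analytic_subset[OF N])
    have Ns: "N \<in> sets ?M" by (rule sets_analytic_borel[OF N])
    have "\<bar>?\<phi> z\<bar> \<le> (\<Sum>i<m. \<bar>snd (p i)\<bar>)" if z: "z \<in> N" for z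
    proof -
      have k: "\<kappa> z < m" using \<kappa>(1) z NX by blast
      then have "\<bar>?\<phi> z\<bar> \<le> snd (p (\<kappa> z))" using p z unfolding N_def by blast
      also have "\<dots> \<le> \<bar>snd (p (\<kappa> z))\<bar>" by simp
      also have "\<dots> \<le> (\<Sum>i<m. \<bar>snd (p i)\<bar>)" by (rule member_le_sum) (use k in auto)
      finally show ?thesis .
    qed
    moreover have "?\<phi> \<in> borel_measurable (restrict_space ?M N)"
    proof (rule measurable_piecewise_restrict)
      let ?C = "(\<lambda>i. {z \<in> points X. \<kappa> z = i}) ` {..<m}"
      show "countable ?C" by (intro countable_finite) auto
      have sp: "space (restrict_space ?M N) = N" using NX by (auto simp: space_restrict_space space_analytic_borel)
      show "\<Omega> \<inter> space (restrict_space ?M N) \<in> sets (restrict_space ?M N)" if "\<Omega> \<in> ?C" for \<Omega>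
        unfolding sp using that meas Ns by (auto simp: sets_restrict_space)
      show "space (restrict_space ?M N) \<subseteq> \<Union>?C" unfolding sp using \<kappa>(1) NX by auto
      fix \<Omega> assume "\<Omega> \<in> ?C"
      then obtain i where i: "i < m" "\<Omega> = {z \<in> points X. \<kappa> z = i}" by auto
      have "restrict_space (restrict_space ?M N) \<Omega> = restrict_space ?M (N \<inter> \<Omega>)"
        by (rule restrict_restrict_space) (use Ns meas[OF i(1)] i(2) in auto)
      moreover have "?\<phi> \<in> borel_measurable (restrict_space ?M (N \<inter> \<Omega>))"
      proof (rule measurable_restrict_mono)
        show "?\<phi> \<in> borel_measurable (restrict_space ?M (fst (p i) \<inter> {z. \<kappa> z = i}))" using p i(1) by blast
        show "N \<inter> \<Omega> \<subseteq> fst (p i) \<inter> {z. \<kappa> z = i}" using i unfolding N_def by auto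
      qed
      ultimately show "?\<phi> \<in> borel_measurable (restrict_space (restrict_space ?M N) \<Omega>)" by simp
    qed
    ultimately show ?thesis unfolding tame_at_def using N xN by blast
  qed
  moreover have "h z \<noteq> 0" for z unfolding h_def using nz by simp
  ultimately show thesis by (intro that)
qed

lemma line_bundle_on_tame_frame:
  fixes L :: "('a, 'l) line_bundle"
  assumes comp: "compact_space (analytic_topology X)" and haus: "Hausdorff_space (analytic_topology X)"
    and L: "line_bundle_on X L"
  shows "\<exists>e d k. framed X L e d k \<and> (\<forall>x\<in>points X. tame_at X x (\<lambda>z. ln (norm (d x z))))"
proof -
  obtain e d k where f: "framed X L e d k" by (rule line_bundle_on_framed[OF X L])
  obtain h where h: "\<And>z. h z \<noteq> 0" "\<And>x. x \<in> points X \<Longrightarrow> tame_at X x (\<lambda>z. ln (norm (h z * d x z)))"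
    by (rule gauge_tame[OF comp haus framed.gauge[OF f]]) blast
  show ?thesis using framed.reframe[OF f, of h] h by blast
qed

end

section \<open>Normalised lifts\<close>

locale tame_torsor_setup = torsor_setup X r L e d k + prob_space \<mu>
  for X :: "'a fspace" and r and L :: "nat \<Rightarrow> ('a, 'l) line_bundle" and e d k and \<mu> :: "'a measure" +
  assumes tame: "\<And>i x. i < r \<Longrightarrow> x \<in> points X \<Longrightarrow> tame_at X x (\<lambda>z. ln (norm (d i x z)))"
    and compact: "compact_space (analytic_topology X)"
    and sets_\<mu>: "sets \<mu> = sets (analytic_borel X)"
begin

lemma space_\<mu>: "space \<mu> = points X"
  using sets_eq_imp_space_eq[OF sets_\<mu>] space_analytic_borel[OF base] by simp

lemma ln_norm_torus:
  "t \<in> T \<Longrightarrow> \<alpha> \<in> C \<Longrightarrow> ln (norm (t \<alpha>)) = (\<Sum>i<r. of_int (coord \<alpha> i) * ln (norm (t (b i))))"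
  by (subst torus_expand) (auto simp: ln_norm_prod ln_norm_power_int torus_nonzero b(1))

text \<open>All classes are included, since the defect evaluates \<open>F\<^sub>2\<close> at a
  pulled back class, which is in general not a basis element.\<close>

definition normalised where
  "normalised F \<longleftrightarrow> (\<forall>\<alpha>\<in>C. integrable \<mu> (\<lambda>z. ln (norm (F z \<alpha>))) \<and> (\<integral>z. ln (norm (F z \<alpha>)) \<partial>\<mu>) = 0)"

text \<open>\<open>F\<close> is the discrepancy times the value of \<open>D\<close> at the pulled
  back class, divided by \<open>D\<close> around \<open>\<gamma> x\<close> composed with \<gamma>.
  The first factor is a unit; the other two are tame by the choice of frames, the last one because
  tameness survives composition with a morphism.\<close>

lemma tame_compatible:
  assumes \<gamma>: "morphism X X \<gamma>" and F: "compatible \<gamma> F" and i: "i < r" and x: "x \<in> points X"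
  shows "tame_at X x (\<lambda>z. ln (norm (F z (b i))))"
proof -
  let ?\<alpha> = "pic_pullback X \<gamma> (b i)"
  have \<alpha>: "?\<alpha> \<in> C" by (rule pic_pullback_closed[OF base \<gamma> b(1)[OF i]])
  have FT: "F z \<in> T" for z using F unfolding compatible_def by blast
  have 1: "tame_at X x (\<lambda>z. ln (norm (F z (b i) * D (\<gamma> x) (\<gamma> z) (b i) / D x z ?\<alpha>)))"
    by (rule tame_at_unit[OF base discrepancy_char[OF \<gamma> F x b(1)[OF i]]])
  have 2: "tame_at X x (\<lambda>z. ln (norm (d i (\<gamma> x) (\<gamma> z))))"
    by (rule tame_at_compose[OF base \<gamma> x tame[OF i morphism_points[OF \<gamma> x]]])
  have 3: "tame_at X x (\<lambda>z. \<Sum>j<r. of_int (coord ?\<alpha> j) * ln (norm (d j x z)))"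
    by (intro tame_at_sum[OF base x] tame_at_cmult[OF base] tame x)
  have "tame_at X x (\<lambda>z. ln (norm (F z (b i) * D (\<gamma> x) (\<gamma> z) (b i) / D x z ?\<alpha>)) +
    ((\<Sum>j<r. of_int (coord ?\<alpha> j) * ln (norm (d j x z))) - ln (norm (d i (\<gamma> x) (\<gamma> z)))))"
    by (intro tame_at_add[OF base] tame_at_diff[OF base] 1 2 3)
  moreover have "ln (norm (F z (b i) * D (\<gamma> x) (\<gamma> z) (b i) / D x z ?\<alpha>)) +
    ((\<Sum>j<r. of_int (coord ?\<alpha> j) * ln (norm (d j x z))) - ln (norm (d i (\<gamma> x) (\<gamma> z)))) = ln (norm (F z (b i)))" for z
    using torus_nonzero[OF FT b(1)[OF i]] torus_nonzero[OF D b(1)[OF i]] torus_nonzero[OF D \<alpha>] ln_norm_torus[OF D \<alpha>, of x z]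
    by (simp add: ln_norm_mult ln_norm_divide D_basis i)
  ultimately show ?thesis by simp
qed

text \<open>Bounded measurable logarithms have means. One constant torus element removes the means
  over the basis, and additivity of the logarithm in the character does the rest.\<close>

lemma normalised_exists:
  assumes \<gamma>: "morphism X X \<gamma>"
  shows "\<exists>F. compatible \<gamma> F \<and> normalised F"
proof -
  obtain F0 where F0: "compatible \<gamma> F0" by (rule compatible_exists[OF \<gamma>])
  have FT: "F0 z \<in> T" for z using F0 unfolding compatible_def by blast
  have int0: "integrable \<mu> (\<lambda>z. ln (norm (F0 z (b i))))" if i: "i < r" for i
  proof -
    have t: "tame_at X x (\<lambda>z. ln (norm (F0 z (b i))))" if "x \<in> points X" for x
      by (rule tame_compatible[OF \<gamma> F0 i that])
    from tame_global[OF base compact t]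
    obtain B where B: "\<forall>z\<in>points X. \<bar>ln (norm (F0 z (b i)))\<bar> \<le> B" by blast
    show ?thesis
    proof (rule integrable_const_bound)
      show "AE x in \<mu>. norm (ln (norm (F0 x (b i)))) \<le> B" by (rule AE_I2) (use B space_\<mu> in auto)
      show "(\<lambda>z. ln (norm (F0 z (b i)))) \<in> borel_measurable \<mu>"
        unfolding measurable_cong_sets[OF sets_\<mu> refl] by (rule tame_global(1)[OF base compact t])
    qed
  qed
  \<comment> \<open>The positive real value at \<open>b i\<close> subtracts the mean of the
    \<open>i\<close>-th logarithm.\<close>
  define c where "c = torus_point (\<lambda>i. of_real (exp (- (\<integral>z. ln (norm (F0 z (b i))) \<partial>\<mu>))))"
  have c: "c \<in> T" unfolding c_def by (rule torus_point) simp
  define F where "F z = tmul c (F0 z)" for z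
  have F: "compatible \<gamma> F" unfolding F_def by (rule compatible_scale[OF \<gamma> F0 c])
  have ln_F: "ln (norm (F z (b i))) = ln (norm (F0 z (b i))) - (\<integral>z. ln (norm (F0 z (b i))) \<partial>\<mu>)" if i: "i < r" for i z
    using torus_nonzero[OF FT b(1)[OF i]] b(1)[OF i] i
    by (simp add: F_def tmul_apply ln_norm_mult c_def torus_point_basis)
  have int1: "integrable \<mu> (\<lambda>z. ln (norm (F z (b i))))" "(\<integral>z. ln (norm (F z (b i))) \<partial>\<mu>) = 0" if i: "i < r" for i
    unfolding ln_F[OF i] using int0[OF i] by (simp_all add: prob_space)
  have "normalised F" unfolding normalised_def
  proof (intro ballI conjI)
    fix \<alpha> assume \<alpha>: "\<alpha> \<in> C"
    have FT': "F z \<in> T" for z using F unfolding compatible_def by blast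
    show "integrable \<mu> (\<lambda>z. ln (norm (F z \<alpha>)))"
      unfolding ln_norm_torus[OF FT' \<alpha>] using int1(1) by (intro Bochner_Integration.integrable_sum integrable_mult_right) auto
    show "(\<integral>z. ln (norm (F z \<alpha>)) \<partial>\<mu>) = 0"
      unfolding ln_norm_torus[OF FT' \<alpha>] using int1 by (subst Bochner_Integration.integral_sum) auto
  qed
  with F show ?thesis by blast
qed

lemma defect_compact:
  assumes iso: "isomorphism X X \<gamma>\<^sub>1" "isomorphism X X \<gamma>\<^sub>2" "isomorphism X X \<gamma>\<^sub>3"
    and \<gamma>: "\<And>x. x \<in> points X \<Longrightarrow> \<gamma>\<^sub>3 x = \<gamma>\<^sub>1 (\<gamma>\<^sub>2 x)"
    and F: "compatible \<gamma>\<^sub>1 F\<^sub>1" "compatible \<gamma>\<^sub>2 F\<^sub>2" "compatible \<gamma>\<^sub>3 F\<^sub>3"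
    and nF: "normalised F\<^sub>1" "normalised F\<^sub>2" "normalised F\<^sub>3"
    and inv: "distr \<mu> \<mu> \<gamma>\<^sub>2 = \<mu>" and proper: "proper X" and con: "connected_space (zariski X)"
  shows "\<exists>t\<in>compact_NS_torus X. \<forall>x\<in>points X. defect F\<^sub>1 F\<^sub>2 F\<^sub>3 \<gamma>\<^sub>1 \<gamma>\<^sub>2 x = t"
proof -
  let ?t = "defect F\<^sub>1 F\<^sub>2 F\<^sub>3 \<gamma>\<^sub>1 \<gamma>\<^sub>2"
  note asm = iso \<gamma> F
  have tT: "?t x \<in> T" for x by (rule defect) (fact asm)+
  have u: "unit_at X x (\<lambda>z. ?t z \<alpha>)" if "\<alpha> \<in> C" "x \<in> points X" for \<alpha> x
    by (rule unit_at_defect) (fact asm that)+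
  have ap: "?t x \<alpha> = F\<^sub>3 x \<alpha> / (F\<^sub>1 (\<gamma>\<^sub>2 x) \<alpha> * F\<^sub>2 x (pic_pullback X \<gamma>\<^sub>1 \<alpha>))" if "\<alpha> \<in> C" for \<alpha> x
    by (rule defect_apply) (fact asm that)+
  \<comment> \<open>A probability space is not empty, which supplies a base point for the comparison
    of values.\<close>
  obtain x0 where x0: "x0 \<in> points X" using not_empty[unfolded space_\<mu>] by blast
  have const: "?t x \<alpha> = ?t x0 \<alpha>" if \<alpha>: "\<alpha> \<in> C" and x: "x \<in> points X" for \<alpha> x
    by (rule regular_constant[OF proper con unit_at_regularI[OF base openin_topspace u[OF \<alpha>]] x0 x])
  have "?t x = ?t x0" if x: "x \<in> points X" for x
    by (rule torus_eqI[OF tT tT const[OF b(1) x]])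
  moreover have "norm (?t x0 \<alpha>) = 1" if \<alpha>: "\<alpha> \<in> C" for \<alpha>
  proof -
    let ?\<beta> = "pic_pullback X \<gamma>\<^sub>1 \<alpha>"
    have m1: "morphism X X \<gamma>\<^sub>1" and m2: "morphism X X \<gamma>\<^sub>2" using iso unfolding isomorphism_def by auto
    have \<beta>: "?\<beta> \<in> C" by (rule pic_pullback_closed[OF base m1 \<alpha>])
    have FT: "F\<^sub>1 z \<in> T" "F\<^sub>2 z \<in> T" "F\<^sub>3 z \<in> T" for z using F unfolding compatible_def by auto
    have \<gamma>m: "\<gamma>\<^sub>2 \<in> measurable \<mu> \<mu>"
      using morphism_measurable[OF base m2] measurable_cong_sets[OF sets_\<mu> sets_\<mu>] by simp
    have i1: "integrable \<mu> (\<lambda>z. ln (norm (F\<^sub>1 z \<alpha>)))" "(\<integral>z. ln (norm (F\<^sub>1 z \<alpha>)) \<partial>\<mu>) = 0"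
      and i2: "integrable \<mu> (\<lambda>z. ln (norm (F\<^sub>2 z ?\<beta>)))" "(\<integral>z. ln (norm (F\<^sub>2 z ?\<beta>)) \<partial>\<mu>) = 0"
      and i3: "integrable \<mu> (\<lambda>z. ln (norm (F\<^sub>3 z \<alpha>)))" "(\<integral>z. ln (norm (F\<^sub>3 z \<alpha>)) \<partial>\<mu>) = 0"
      using nF \<alpha> \<beta> unfolding normalised_def by auto
    \<comment> \<open>Invariance under \<open>\<gamma>\<^sub>2\<close> removes the shift in the
      argument of \<open>F\<^sub>1\<close>. The twisted character in the term of
      \<open>F\<^sub>2\<close> is harmless because the normalisation covers all classes.\<close>
    have j1: "integrable \<mu> (\<lambda>z. ln (norm (F\<^sub>1 (\<gamma>\<^sub>2 z) \<alpha>)))"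
      using integrable_distr[OF \<gamma>m, of "\<lambda>z. ln (norm (F\<^sub>1 z \<alpha>))"] i1(1) unfolding inv by simp
    have j1': "(\<integral>z. ln (norm (F\<^sub>1 (\<gamma>\<^sub>2 z) \<alpha>)) \<partial>\<mu>) = 0"
      using integral_distr[OF \<gamma>m borel_measurable_integrable[OF i1(1)]] i1(2) unfolding inv by simp
    have eq: "ln (norm (?t x0 \<alpha>)) = ln (norm (F\<^sub>3 x \<alpha>)) - (ln (norm (F\<^sub>1 (\<gamma>\<^sub>2 x) \<alpha>)) + ln (norm (F\<^sub>2 x ?\<beta>)))"
      if x: "x \<in> points X" for x
    proof -
      have "ln (norm (?t x0 \<alpha>)) = ln (norm (F\<^sub>3 x \<alpha> / (F\<^sub>1 (\<gamma>\<^sub>2 x) \<alpha> * F\<^sub>2 x ?\<beta>)))"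
        using const[OF \<alpha> x] ap[OF \<alpha>, of x] by simp
      also have "\<dots> = ln (norm (F\<^sub>3 x \<alpha>)) - (ln (norm (F\<^sub>1 (\<gamma>\<^sub>2 x) \<alpha>)) + ln (norm (F\<^sub>2 x ?\<beta>)))"
        using torus_nonzero[OF FT(1) \<alpha>] torus_nonzero[OF FT(2) \<beta>] torus_nonzero[OF FT(3) \<alpha>]
        by (subst ln_norm_divide) (simp_all add: ln_norm_mult)
      finally show ?thesis .
    qed
    have "ln (norm (?t x0 \<alpha>)) = (\<integral>x. ln (norm (?t x0 \<alpha>)) \<partial>\<mu>)" by (simp add: prob_space)
    also have "\<dots> = (\<integral>x. ln (norm (F\<^sub>3 x \<alpha>)) - (ln (norm (F\<^sub>1 (\<gamma>\<^sub>2 x) \<alpha>)) + ln (norm (F\<^sub>2 x ?\<beta>))) \<partial>\<mu>)"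
      by (rule Bochner_Integration.integral_cong[OF refl]) (use eq space_\<mu> in simp)
    also have "\<dots> = 0" using i2 i3 j1 j1' by simp
    finally have "ln (norm (?t x0 \<alpha>)) = 0" .
    then show ?thesis using torus_nonzero[OF tT \<alpha>, of x0] by simp
  qed
  ultimately show ?thesis using tT unfolding compact_NS_torus_def by blast
qed

end

text \<open>The lifts are chosen for each automorphism independently. The normalisation of each
  single one forces the discrepancies into the compact torus, so no coherence between the choices
  has to be arranged along products in \<Gamma>.\<close>

theorem mainTheorem3:
  fixes X :: "'a fspace"
    and r :: nat
    and L :: "nat \<Rightarrow> ('a, 'l) line_bundle"
    and U :: "('a, 'a \<times> (nat \<Rightarrow> 'l)) NS_torsor"
    and \<Gamma> :: "('a \<Rightarrow> 'a) set"
    and \<mu> :: "'a measure"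
  assumes "variety X" and "smooth X" and "proper X" and "connected_space (zariski X)"
    and "Pic0 X = {\<one>\<^bsub>Pic X\<^esub>}"
    and "torsion_free (Pic X)"
    and "\<forall>i<r. line_bundle_on X (L i)"
    and "integral_basis (Pic X) r (\<lambda>i. pic_class X (L i))"
    and "U = bundle_torsor X r L"
    and "subgroup \<Gamma> (Aut X)"
    and "prob_space \<mu>" and "sets \<mu> = sets (analytic_borel X)"
    and "\<forall>\<gamma>\<in>\<Gamma>. distr \<mu> \<mu> \<gamma> = \<mu>"
  shows "\<exists>c. (\<forall>\<gamma>\<in>\<Gamma>. torsor_isomorphism X (torsor_pushforward X \<gamma> U) U (c \<gamma>)) \<and>
    (let lift = (\<lambda>\<gamma>. c \<gamma> \<circ> to_pushforward \<gamma> U);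
         lift_inv = (\<lambda>\<gamma>. inv_into (points (torsor_space U)) (lift \<gamma>))
     in \<forall>\<gamma>\<^sub>1\<in>\<Gamma>. \<forall>\<gamma>\<^sub>2\<in>\<Gamma>. \<exists>t \<in> compact_NS_torus X. \<forall>u \<in> points (torsor_space U).
          lift (\<gamma>\<^sub>1 \<otimes>\<^bsub>Aut X\<^esub> \<gamma>\<^sub>2) (lift_inv \<gamma>\<^sub>2 (lift_inv \<gamma>\<^sub>1 u)) = torsor_act U t u)"
proof -
  have X: "space_with_functions X" using assms(1) unfolding variety_def prevariety_def by (elim conjE)
  have compact: "compact_space (analytic_topology X)" by (rule compact_space_proper[OF assms(3)])
  have haus: "Hausdorff_space (analytic_topology X)" by (rule Hausdorff_space_variety[OF assms(1)])
  have "\<forall>i\<in>{..<r}. \<exists>q. framed X (L i) (fst q) (fst (snd q)) (snd (snd q)) \<and>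
    (\<forall>x\<in>points X. tame_at X x (\<lambda>z. ln (norm (fst (snd q) x z))))"
  proof
    fix i assume "i \<in> {..<r}"
    then have "line_bundle_on X (L i)" using assms(7) by simp
    from line_bundle_on_tame_frame[OF X compact haus this] obtain e d k
      where "framed X (L i) e d k" "\<forall>x\<in>points X. tame_at X x (\<lambda>z. ln (norm (d x z)))" by (elim exE conjE)
    then show "\<exists>q. framed X (L i) (fst q) (fst (snd q)) (snd (snd q)) \<and>
      (\<forall>x\<in>points X. tame_at X x (\<lambda>z. ln (norm (fst (snd q) x z))))"
      by (intro exI[of _ "(e, d, k)"]) simp
  qed
  from bchoice[OF this] obtain q where q: "\<forall>i\<in>{..<r}. framed X (L i) (fst (q i)) (fst (snd (q i))) (snd (snd (q i))) \<and>
    (\<forall>x\<in>points X. tame_at X x (\<lambda>z. ln (norm (fst (snd (q i)) x z))))" by (elim exE)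
  have q1: "framed X (L i) (fst (q i)) (fst (snd (q i))) (snd (snd (q i)))"
    and q2: "x \<in> points X \<Longrightarrow> tame_at X x (\<lambda>z. ln (norm (fst (snd (q i)) x z)))" if "i < r" for i x
    using q[rule_format, of i] that by simp_all
  interpret tame_torsor_setup X r L "\<lambda>i. fst (q i)" "\<lambda>i. fst (snd (q i))" "\<lambda>i. snd (snd (q i))" \<mu>
    by (intro tame_torsor_setup.intro torsor_setup.intro tame_torsor_setup_axioms.intro)
       (fact X q1 q2 assms(8,11,12) compact)+
  have U: "U = bundle_torsor X r L" by (rule assms(9))
  have iso: "isomorphism X X \<gamma>" and bij: "\<gamma> \<in> Bij (points X)" if "\<gamma> \<in> \<Gamma>" for \<gamma>
    using subgroup.subset[OF assms(10)] that unfolding Aut_def by auto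
  have mult: "\<gamma>\<^sub>1 \<otimes>\<^bsub>Aut X\<^esub> \<gamma>\<^sub>2 \<in> \<Gamma>" "\<And>x. x \<in> points X \<Longrightarrow> (\<gamma>\<^sub>1 \<otimes>\<^bsub>Aut X\<^esub> \<gamma>\<^sub>2) x = \<gamma>\<^sub>1 (\<gamma>\<^sub>2 x)"
    if "\<gamma>\<^sub>1 \<in> \<Gamma>" "\<gamma>\<^sub>2 \<in> \<Gamma>" for \<gamma>\<^sub>1 \<gamma>\<^sub>2
  proof -
    show "\<gamma>\<^sub>1 \<otimes>\<^bsub>Aut X\<^esub> \<gamma>\<^sub>2 \<in> \<Gamma>" by (rule subgroup.m_closed[OF assms(10) that])
    show "(\<gamma>\<^sub>1 \<otimes>\<^bsub>Aut X\<^esub> \<gamma>\<^sub>2) x = \<gamma>\<^sub>1 (\<gamma>\<^sub>2 x)" if "x \<in> points X" for x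
      using bij[OF \<open>\<gamma>\<^sub>1 \<in> \<Gamma>\<close>] bij[OF \<open>\<gamma>\<^sub>2 \<in> \<Gamma>\<close>] that unfolding Aut_def BijGroup_def by (simp add: compose_def)
  qed
  have "\<forall>\<gamma>\<in>\<Gamma>. \<exists>F. compatible \<gamma> F \<and> normalised F"
    using normalised_exists iso unfolding isomorphism_def by blast
  from bchoice[OF this] obtain F where F: "\<forall>\<gamma>\<in>\<Gamma>. compatible \<gamma> (F \<gamma>) \<and> normalised (F \<gamma>)" by (elim exE)
  \<comment> \<open>The natural map to the pushforward is the identity on the common total space, so
    these maps are at once the isomorphisms \<open>c \<gamma>\<close> and the lifts.\<close>
  let ?c = "\<lambda>\<gamma>. lift \<gamma> (F \<gamma>)"
  have surj: "?c \<gamma> (inv_into (points US) (?c \<gamma>) u) = u" "inv_into (points US) (?c \<gamma>) u \<in> points US"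
    if "\<gamma> \<in> \<Gamma>" "u \<in> points US" for \<gamma> u
  proof -
    have "bij_betw (?c \<gamma>) (points US) (points US)"
      using lift_bijective[OF iso[OF that(1)]] F that(1) unfolding isomorphism_def by blast
    note bij_betw_inv_into_right[OF this that(2)] bij_betwE[OF bij_betw_inv_into[OF this], rule_format, OF that(2)]
    then show "?c \<gamma> (inv_into (points US) (?c \<gamma>) u) = u" "inv_into (points US) (?c \<gamma>) u \<in> points US" by auto
  qed
  have "\<exists>t\<in>compact_NS_torus X. \<forall>u\<in>points US.
      ?c (\<gamma>\<^sub>1 \<otimes>\<^bsub>Aut X\<^esub> \<gamma>\<^sub>2) (inv_into (points US) (?c \<gamma>\<^sub>2) (inv_into (points US) (?c \<gamma>\<^sub>1) u)) =
      torsor_act (bundle_torsor X r L) t u" if \<gamma>: "\<gamma>\<^sub>1 \<in> \<Gamma>" "\<gamma>\<^sub>2 \<in> \<Gamma>" for \<gamma>\<^sub>1 \<gamma>\<^sub>2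
  proof -
    let ?\<gamma>\<^sub>3 = "\<gamma>\<^sub>1 \<otimes>\<^bsub>Aut X\<^esub> \<gamma>\<^sub>2"
    have F3: "compatible \<gamma>\<^sub>1 (F \<gamma>\<^sub>1)" "compatible \<gamma>\<^sub>2 (F \<gamma>\<^sub>2)" "compatible ?\<gamma>\<^sub>3 (F ?\<gamma>\<^sub>3)"
      and N3: "normalised (F \<gamma>\<^sub>1)" "normalised (F \<gamma>\<^sub>2)" "normalised (F ?\<gamma>\<^sub>3)"
      using F \<gamma> mult(1)[OF \<gamma>] by auto
    have inv: "distr \<mu> \<mu> \<gamma>\<^sub>2 = \<mu>" using assms(13) \<gamma>(2) by blast
    obtain t where t: "t \<in> compact_NS_torus X" "\<forall>x\<in>points X. defect (F \<gamma>\<^sub>1) (F \<gamma>\<^sub>2) (F ?\<gamma>\<^sub>3) \<gamma>\<^sub>1 \<gamma>\<^sub>2 x = t"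
      using defect_compact[OF iso[OF \<gamma>(1)] iso[OF \<gamma>(2)] iso[OF mult(1)[OF \<gamma>]] mult(2)[OF \<gamma>] F3 N3 inv assms(3,4)] by blast
    show ?thesis
    proof (intro bexI[of _ t] ballI t(1))
      fix u assume u: "u \<in> points US"
      let ?v = "inv_into (points US) (?c \<gamma>\<^sub>1) u"
      \<comment> \<open>Writing \<open>u\<close> as the image of \<open>?p\<close> under the two
        successive lifts reduces the claim to \<open>lift_defect\<close> at \<open>?p\<close>, where
        the defect no longer depends on the base point.\<close>
      let ?p = "inv_into (points US) (?c \<gamma>\<^sub>2) ?v"
      have p: "?p \<in> S" using surj(2)[OF \<gamma>(2) surj(2)[OF \<gamma>(1) u]] points_US by simp
      have "?c ?\<gamma>\<^sub>3 ?p = torsor_act (bundle_torsor X r L) (defect (F \<gamma>\<^sub>1) (F \<gamma>\<^sub>2) (F ?\<gamma>\<^sub>3) \<gamma>\<^sub>1 \<gamma>\<^sub>2 (fst ?p)) (?c \<gamma>\<^sub>1 (?c \<gamma>\<^sub>2 ?p))"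
        by (rule lift_defect[OF iso[OF \<gamma>(1)] iso[OF \<gamma>(2)] iso[OF mult(1)[OF \<gamma>]] mult(2)[OF \<gamma>] F3 p])
      also have "defect (F \<gamma>\<^sub>1) (F \<gamma>\<^sub>2) (F ?\<gamma>\<^sub>3) \<gamma>\<^sub>1 \<gamma>\<^sub>2 (fst ?p) = t" using t(2) S_proj[OF p] by blast
      also have "?c \<gamma>\<^sub>1 (?c \<gamma>\<^sub>2 ?p) = u"
        unfolding surj(1)[OF \<gamma>(2) surj(2)[OF \<gamma>(1) u]] by (rule surj(1)[OF \<gamma>(1) u])
      finally show "?c ?\<gamma>\<^sub>3 ?p = torsor_act (bundle_torsor X r L) t u" .
    qed
  qed
  moreover have "\<forall>\<gamma>\<in>\<Gamma>. torsor_isomorphism X (torsor_pushforward X \<gamma> U) U (?c \<gamma>)"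
    unfolding U using torsor_isomorphism_lift iso F by blast
  ultimately show ?thesis
    unfolding U Let_def to_pushforward_def comp_def by (intro exI[of _ ?c] conjI) auto
qed

end
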